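(* Let $\alpha>-2$ and $2\le N<10+4\alpha$, and let $F,Q,F^0$ be as in the context. Then there is no weak stable solution of $$-Qu=(F^0(x))^\alpha e^u\quad\text{in }\mathbb{R}^N.$$
   Context: Standing assumptions on $F$: $F:\mathbb{R}^N\to[0,\infty)$ is convex, $F\in C^2(\mathbb{R}^N\setminus\{0\})$, $F(t\xi)=|t|F(\xi)$ for $t\in\mathbb{R}$, $F(\xi)>0$ for $\xi\neq0$; $a|\xi|\le F(\xi)\le b|\xi|$ for constants $0<a\le b$; and $\mu^2|V|^2\le\sum_{i,j}F_{\xi_i\xi_j}(\xi)V_iV_j\le\Lambda|V|^2$ for all unit $\xi$ and all $V\perp\xi$. $Qu:=\sum_i\partial_{x_i}(F(\nabla u)F_{\xi_i}(\nabla u))$. $F^0(x):=\sup_{\xi\in K}\langle x,\xi\rangle$ where $K=\{\xi: F(\xi)<1\}$. A weak solution in an open set $\Omega$ is $u\in H^1_{loc}(\Omega)$ with $(F^0)^\alpha e^u\in L^1_{loc}(\Omega)$ and $\int_\Omega F(\nabla u)F_\xi(\nabla u)\cdot\nabla\phi\,dx=\int_\Omega(F^0(x))^\alpha e^u\phi\,dx$ for all $\phi\in C_c^\infty(\Omega)$; it is stable if $\int_\Omega\big[F_{\xi_i}(\nabla u)F_{\xi_j}(\nabla u)\phi_{x_i}\phi_{x_j}+F(\nabla u)F_{\xi_i\xi_j}(\nabla u)\phi_{x_i}\phi_{x_j}-(F^0(x))^\alpha e^u\phi^2\big]dx\ge0$ for all $\phi\in C_c^\infty(\Omega)$. *)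

theory Defs
  imports "HOL-Analysis.Analysis"
begin

fun pder :: "('a::euclidean_space \<Rightarrow> real) \<Rightarrow> 'a list \<Rightarrow> 'a \<Rightarrow> real" where
  "pder f [] = f"
| "pder f (b # bs) = (\<lambda>x. frechet_derivative (pder f bs) (at x) b)"

definition smooth_fun :: "('a::euclidean_space \<Rightarrow> real) \<Rightarrow> bool" where
  "smooth_fun f \<longleftrightarrow> (\<forall>bs. set bs \<subseteq> Basis \<longrightarrow> (\<forall>x. pder f bs differentiable (at x)))"

definition test_fun :: "('a::euclidean_space \<Rightarrow> real) \<Rightarrow> bool" where
  "test_fun \<phi> \<longleftrightarrow> smooth_fun \<phi> \<and> compact (closure {x. \<phi> x \<noteq> 0})"

definition grad :: "('a::euclidean_space \<Rightarrow> real) \<Rightarrow> 'a \<Rightarrow> 'a" where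
  "grad f x = (\<Sum>b\<in>Basis. frechet_derivative f (at x) b *\<^sub>R b)"

definition Fgrad :: "('a::euclidean_space \<Rightarrow> real) \<Rightarrow> 'a \<Rightarrow> 'a" where
  "Fgrad F \<xi> = (if \<xi> = 0 then 0 else grad F \<xi>)"

definition Fhess :: "('a::euclidean_space \<Rightarrow> real) \<Rightarrow> 'a \<Rightarrow> 'a \<Rightarrow> 'a \<Rightarrow> real" where
  "Fhess F \<xi> i j = (if \<xi> = 0 then 0 else frechet_derivative (\<lambda>\<eta>. Fgrad F \<eta> \<bullet> j) (at \<xi>) i)"

definition Fdual :: "('a::euclidean_space \<Rightarrow> real) \<Rightarrow> 'a \<Rightarrow> real" where
  "Fdual F x = Sup ((\<lambda>\<xi>. x \<bullet> \<xi>) ` {\<xi>. F \<xi> < 1})"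

definition admissible_F :: "('a::euclidean_space \<Rightarrow> real) \<Rightarrow> bool" where
  "admissible_F F \<longleftrightarrow>
     convex_on UNIV F \<and> (\<forall>\<xi>. F \<xi> \<ge> 0) \<and>
     (\<forall>\<xi>. \<xi> \<noteq> 0 \<longrightarrow> F differentiable (at \<xi>)) \<and>
     (\<forall>\<xi> j. \<xi> \<noteq> 0 \<longrightarrow> j \<in> Basis \<longrightarrow> (\<lambda>\<eta>. Fgrad F \<eta> \<bullet> j) differentiable (at \<xi>)) \<and>
     (\<forall>i\<in>Basis. \<forall>j\<in>Basis. continuous_on (UNIV - {0}) (\<lambda>\<xi>. Fhess F \<xi> i j)) \<and>
     (\<forall>t \<xi>. F (t *\<^sub>R \<xi>) = \<bar>t\<bar> * F \<xi>) \<and>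
     (\<forall>\<xi>. \<xi> \<noteq> 0 \<longrightarrow> F \<xi> > 0) \<and>
     (\<exists>a b. 0 < a \<and> a \<le> b \<and> (\<forall>\<xi>. a * norm \<xi> \<le> F \<xi> \<and> F \<xi> \<le> b * norm \<xi>)) \<and>
     (\<exists>\<mu> \<Lambda>. 0 < \<mu> \<and> (\<forall>\<xi> V. norm \<xi> = 1 \<longrightarrow> V \<bullet> \<xi> = 0 \<longrightarrow>
         \<mu>\<^sup>2 * (norm V)\<^sup>2 \<le> (\<Sum>i\<in>Basis. \<Sum>j\<in>Basis. Fhess F \<xi> i j * (V \<bullet> i) * (V \<bullet> j)) \<and>
         (\<Sum>i\<in>Basis. \<Sum>j\<in>Basis. Fhess F \<xi> i j * (V \<bullet> i) * (V \<bullet> j)) \<le> \<Lambda> * (norm V)\<^sup>2))"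

definition loc_integrable :: "('a::euclidean_space \<Rightarrow> real) \<Rightarrow> bool" where
  "loc_integrable f \<longleftrightarrow> (\<forall>K. compact K \<longrightarrow> set_integrable lborel K f)"

definition loc_L2 :: "('a::euclidean_space \<Rightarrow> 'b::euclidean_space) \<Rightarrow> bool" where
  "loc_L2 f \<longleftrightarrow> f \<in> borel_measurable lborel \<and> loc_integrable (\<lambda>x. (norm (f x))\<^sup>2)"

definition weak_grad :: "('a::euclidean_space \<Rightarrow> real) \<Rightarrow> ('a \<Rightarrow> 'a) \<Rightarrow> bool" where
  "weak_grad u g \<longleftrightarrow> (\<forall>\<phi>. test_fun \<phi> \<longrightarrow> (\<forall>b\<in>Basis.
      (\<integral>x. u x * (grad \<phi> x \<bullet> b) \<partial>lborel) = - (\<integral>x. (g x \<bullet> b) * \<phi> x \<partial>lborel)))"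

definition H1loc_grad :: "('a::euclidean_space \<Rightarrow> real) \<Rightarrow> ('a \<Rightarrow> 'a) \<Rightarrow> bool" where
  "H1loc_grad u g \<longleftrightarrow> loc_L2 u \<and> loc_L2 g \<and> weak_grad u g"

definition weak_solution :: "('a::euclidean_space \<Rightarrow> real) \<Rightarrow> real \<Rightarrow> ('a \<Rightarrow> real) \<Rightarrow> ('a \<Rightarrow> 'a) \<Rightarrow> bool" where
  "weak_solution F \<alpha> u Du \<longleftrightarrow> H1loc_grad u Du \<and>
     loc_integrable (\<lambda>x. Fdual F x powr \<alpha> * exp (u x)) \<and>
     (\<forall>\<phi>. test_fun \<phi> \<longrightarrow>
        (\<integral>x. F (Du x) * (Fgrad F (Du x) \<bullet> grad \<phi> x) \<partial>lborel) =
        (\<integral>x. Fdual F x powr \<alpha> * exp (u x) * \<phi> x \<partial>lborel))"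

definition stable :: "('a::euclidean_space \<Rightarrow> real) \<Rightarrow> real \<Rightarrow> ('a \<Rightarrow> real) \<Rightarrow> ('a \<Rightarrow> 'a) \<Rightarrow> bool" where
  "stable F \<alpha> u Du \<longleftrightarrow>
     (\<forall>\<phi>. test_fun \<phi> \<longrightarrow>
        (\<integral>x. (\<Sum>i\<in>Basis. \<Sum>j\<in>Basis.
               (Fgrad F (Du x) \<bullet> i) * (Fgrad F (Du x) \<bullet> j) * (grad \<phi> x \<bullet> i) * (grad \<phi> x \<bullet> j)
             + F (Du x) * Fhess F (Du x) i j * (grad \<phi> x \<bullet> i) * (grad \<phi> x \<bullet> j))
           - Fdual F x powr \<alpha> * exp (u x) * (\<phi> x)\<^sup>2 \<partial>lborel) \<ge> 0)"

end

theory Submission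
  imports Defs
begin

text \<open>
  Put \<open>\<beta>(s) = ln (1 + exp (t s))\<close> with \<open>0 < t < 2\<close>. It lies below \<open>exp (t s)\<close> but grows only
  linearly, so that \<open>\<beta>(u)\<close> is controlled by \<open>u \<in> H\<^sup>1\<close>; and \<open>\<gamma> = \<integral> \<beta>'\<^sup>2\<close> satisfies both
  \<open>\<gamma> \<le> (t/2) \<beta>\<^sup>2\<close> and \<open>\<gamma> \<le> \<beta> \<beta>'\<close>. Test the stability inequality with \<open>\<beta>(u) \<eta>\<close> and subtract
  \<open>\<kappa> > 1\<close> times the equation tested with \<open>\<gamma>(u) \<eta>\<^sup>2\<close>. By homogeneity of \<open>F\<close> the gradient terms
  combine to \<open>- (\<kappa> - 1) \<beta>'\<^sup>2 F(Du)\<^sup>2 \<eta>\<^sup>2\<close>, which absorbs the mixed terms, and what remains is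
  \<open>\<integral> (F\<^sup>0)\<^sup>\<alpha> e\<^sup>u \<beta>(u)\<^sup>2 \<eta>\<^sup>2 \<le> C \<integral> \<beta>(u)\<^sup>2 |\<nabla>\<eta>|\<^sup>2\<close>. These functions are not admissible for a merely
  \<open>H\<^sup>1\<close> solution, but they become so when the inner \<open>u\<close> is replaced by a mollification of it;
  since \<open>\<beta>\<^sup>2 - \<kappa> \<gamma> \<ge> 0\<close>, a single application of Fatou's lemma removes the mollification. For a
  cutoff \<open>\<eta>\<close> at scale \<open>R\<close> the right-hand side is partly absorbed because \<open>\<beta>(u) \<le> exp (t u)\<close>,
  which leaves the power \<open>R\<close> to the \<open>N - 2 - 2 t (2 + \<alpha>)\<close>. For \<open>N < 10 + 4 \<alpha>\<close> this exponent is
  negative once \<open>t\<close> is close to \<open>2\<close>, and \<open>R \<rightarrow> \<infinity>\<close> gives a contradiction.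
\<close>

section \<open>Smooth functions\<close>

text \<open>Powers of exp(u) beyond the weighted first one are not known to be locally integrable,
  hence the truncation of linear growth. It has to leave room for \<kappa>: \<kappa> > 1 makes the
  gradient term negative, while \<kappa> < 2 / t keeps \<beta>^2 - \<kappa> \<gamma> above a
  positive multiple of \<beta>^2. Such a \<kappa> exists exactly for t < 2.

  Only the u inside the test functions is mollified; F, its gradient and its Hessian stay evaluated
  at Du. The Hessian need not be continuous at 0, whereas the integrands are continuous in the value
  and the gradient of the mollified function. The price is that the homogeneity computation, which
  needs the gradient of that function to be Du itself, has to wait until the limit has been taken.

  The cutoff is a fifth power \<zeta>^5: the mixed terms then carry \<zeta>^8, and the absorption
  step needs \<zeta>^8 \<le> \<zeta>^(4 t) for all t < 2. The number 10 + 4 \<alpha> arises from the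
  final exponent of R, which equals N - 10 - 4 \<alpha> at t = 2.\<close>

lemma pder_append: "pder f (bs @ [b]) = pder (pder f [b]) bs"
  by (induction bs) auto

text \<open>\<open>pder\<close> differentiates along the last list entry first, so splitting off
  that entry passes from a function to its first partials. This recursive form replaces inductions
  on lists of directions.\<close>

lemma smooth_fun_iff:
  "smooth_fun f \<longleftrightarrow> (\<forall>x. f differentiable (at x)) \<and> (\<forall>b\<in>Basis. smooth_fun (pder f [b]))"
proof
  assume f: "smooth_fun f"
  have "pder f (bs @ [b]) differentiable (at x)" if "b \<in> Basis" "set bs \<subseteq> Basis" for b bs x
    using f that unfolding smooth_fun_def by auto
  moreover have "f differentiable (at x)" for x
    using f unfolding smooth_fun_def by (metis empty_set empty_subsetI pder.simps(1))
  ultimately show "(\<forall>x. f differentiable (at x)) \<and> (\<forall>b\<in>Basis. smooth_fun (pder f [b]))"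
    unfolding smooth_fun_def pder_append by blast
next
  assume f: "(\<forall>x. f differentiable (at x)) \<and> (\<forall>b\<in>Basis. smooth_fun (pder f [b]))"
  show "smooth_fun f"
    unfolding smooth_fun_def
  proof (intro allI impI)
    fix bs :: "'a list" and x
    assume "set bs \<subseteq> Basis"
    then show "pder f bs differentiable (at x)"
      using f by (cases bs rule: rev_cases) (auto simp: smooth_fun_def pder_append)
  qed
qed

text \<open>Smoothness is the largest class of differentiable functions closed under first partials.
  Exhibiting any such class that contains \<open>f\<close> suffices, so no formula for higher
  derivatives has to be written down.\<close>

lemma smooth_fun_coinduct:
  assumes "f \<in> S" "\<And>g x. g \<in> S \<Longrightarrow> g differentiable (at x)"
    and "\<And>g b. g \<in> S \<Longrightarrow> b \<in> Basis \<Longrightarrow> pder g [b] \<in> S"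
  shows "smooth_fun f"
proof -
  have "pder f bs \<in> S" if "set bs \<subseteq> Basis" for bs
    using that
  proof (induction bs)
    case (Cons b bs)
    then show ?case using assms(3)[of "pder f bs" b] by simp
  qed (use assms in simp)
  then show ?thesis
    unfolding smooth_fun_def using assms(2) by blast
qed

lemma pder_single_eqI:
  assumes "\<And>x. (f has_derivative D x) (at x)"
  shows "pder f [b] = (\<lambda>x. D x b)"
  using frechet_derivative_at[OF assms] by (metis pder.simps)

text \<open>The class fed to \<open>smooth_fun_coinduct\<close> for the algebra of smooth functions.
  The operations are treated together because the chain rule produces products and the product rule
  produces sums.\<close>

inductive_set smooth_closure :: "('a::euclidean_space \<Rightarrow> real) set" where
  base: "smooth_fun f \<Longrightarrow> f \<in> smooth_closure"
| add: "f \<in> smooth_closure \<Longrightarrow> g \<in> smooth_closure \<Longrightarrow> (\<lambda>x. f x + g x) \<in> smooth_closure"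
| mult: "f \<in> smooth_closure \<Longrightarrow> g \<in> smooth_closure \<Longrightarrow> (\<lambda>x. f x * g x) \<in> smooth_closure"
| comp: "smooth_fun h \<Longrightarrow> f \<in> smooth_closure \<Longrightarrow> (\<lambda>x. h (f x)) \<in> smooth_closure"

lemma smooth_closure_pder:
  assumes "f \<in> smooth_closure"
  shows "(\<forall>x. f differentiable (at x)) \<and> (\<forall>b\<in>Basis. pder f [b] \<in> smooth_closure)"
  using assms
proof induction
  case (base f)
  then show ?case
    using smooth_fun_iff smooth_closure.base by blast
next
  case (add f g)
  then have "pder (\<lambda>x. f x + g x) [b] = (\<lambda>x. pder f [b] x + pder g [b] x)" for b
    by (subst pder_single_eqI[OF has_derivative_add, of f _ g])
      (auto simp: frechet_derivative_works[symmetric])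
  moreover have "(\<lambda>x. pder f [b] x + pder g [b] x) \<in> smooth_closure" if "b \<in> Basis" for b
    using add that by (intro smooth_closure.add) auto
  ultimately show ?case
    using add by (simp del: pder.simps)
next
  case (mult f g)
  then have "pder (\<lambda>x. f x * g x) [b] = (\<lambda>x. f x * pder g [b] x + pder f [b] x * g x)" for b
    by (subst pder_single_eqI[OF has_derivative_mult, of f _ g])
      (auto simp: frechet_derivative_works[symmetric])
  moreover have "(\<lambda>x. f x * pder g [b] x + pder f [b] x * g x) \<in> smooth_closure" if "b \<in> Basis" for b
    using mult that by (intro smooth_closure.add smooth_closure.mult) auto
  ultimately show ?case
    using mult by (simp del: pder.simps)
next
  case (comp h f)
  have h: "h differentiable (at s)" for s
    using comp smooth_fun_iff by blast
  have d: "((\<lambda>x. h (f x)) has_derivative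
      (\<lambda>v. frechet_derivative h (at (f x)) (frechet_derivative f (at x) v))) (at x)" for x
    using comp h by (intro has_derivative_compose[where g=h and f=f])
      (auto simp: frechet_derivative_works[symmetric])
  have lin: "frechet_derivative h (at s) r = r * frechet_derivative h (at s) 1" for s r
    using linear_cmul[OF linear_frechet_derivative[OF h[of s]], of r 1] by simp
  have "pder (\<lambda>x. h (f x)) [b] = (\<lambda>x. pder f [b] x * pder h [1] (f x))" for b
    by (rule trans[OF pder_single_eqI[OF d]], unfold pder.simps, rule ext, rule lin)
  moreover have "(\<lambda>x. pder f [b] x * pder h [1] (f x)) \<in> smooth_closure" if "b \<in> Basis" for b
  proof (rule smooth_closure.mult)
    show "pder f [b] \<in> smooth_closure"
      using comp that by blast
    show "(\<lambda>x. pder h [1] (f x)) \<in> smooth_closure"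
      using comp smooth_fun_iff[of h] by (intro smooth_closure.comp[of "pder h [1]" f]) auto
  qed
  moreover have "(\<lambda>x. h (f x)) differentiable (at x)" for x
    using d differentiable_def by blast
  ultimately show ?case
    by (simp del: pder.simps)
qed

lemma smooth_closure_smooth: "f \<in> smooth_closure \<Longrightarrow> smooth_fun f"
  using smooth_fun_coinduct[of f smooth_closure] smooth_closure_pder by blast

lemma smooth_fun_add: "smooth_fun f \<Longrightarrow> smooth_fun g \<Longrightarrow> smooth_fun (\<lambda>x. f x + g x)"
  by (rule smooth_closure_smooth[OF smooth_closure.add]; rule smooth_closure.base)

lemma smooth_fun_mult: "smooth_fun f \<Longrightarrow> smooth_fun g \<Longrightarrow> smooth_fun (\<lambda>x. f x * g x)"
  by (rule smooth_closure_smooth[OF smooth_closure.mult]; rule smooth_closure.base)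

lemma smooth_fun_compose: "smooth_fun h \<Longrightarrow> smooth_fun f \<Longrightarrow> smooth_fun (\<lambda>x. h (f x))"
  using smooth_closure_smooth[OF smooth_closure.comp[of h f]] smooth_closure.base[of f] by simp

lemma smooth_fun_const: "smooth_fun (\<lambda>x. c)"
  by (rule smooth_fun_coinduct[where S="range (\<lambda>c x. c)"]) auto

lemma smooth_fun_cmult: "smooth_fun f \<Longrightarrow> smooth_fun (\<lambda>x. c * f x)"
  by (rule smooth_fun_mult[OF smooth_fun_const])

lemma smooth_fun_diff: "smooth_fun f \<Longrightarrow> smooth_fun g \<Longrightarrow> smooth_fun (\<lambda>x. f x - g x)"
  using smooth_fun_add[OF _ smooth_fun_cmult[of g "-1"], of f] by simp

lemma smooth_fun_power: "smooth_fun f \<Longrightarrow> smooth_fun (\<lambda>x. f x ^ n)"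
  by (induction n) (auto intro: smooth_fun_const smooth_fun_mult)

lemma smooth_fun_inner: "smooth_fun (\<lambda>x. x \<bullet> v)"
proof -
  have d: "((\<lambda>x. x \<bullet> v) has_derivative (\<lambda>w. w \<bullet> v)) (at x)" for x
    by (auto intro!: derivative_eq_intros)
  have "pder (\<lambda>x. x \<bullet> v) [b] = (\<lambda>x. b \<bullet> v)" for b
    by (rule pder_single_eqI[OF d])
  then show ?thesis
    using d smooth_fun_const by (subst smooth_fun_iff) (auto simp: differentiable_def)
qed

lemma smooth_fun_dist_square: "smooth_fun (\<lambda>x. (x - z) \<bullet> (x - z))"
proof -
  have d: "((\<lambda>x. (x - z) \<bullet> (x - z)) has_derivative (\<lambda>w. 2 * ((x - z) \<bullet> w))) (at x)" for x
    by (auto intro!: derivative_eq_intros simp: inner_commute)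
  have "pder (\<lambda>x. (x - z) \<bullet> (x - z)) [b] = (\<lambda>x. 2 * (x \<bullet> b - z \<bullet> b))" for b
    unfolding pder_single_eqI[OF d] by (simp add: inner_diff_left)
  moreover have "smooth_fun (\<lambda>x. 2 * (x \<bullet> b - z \<bullet> b))" for b
    by (intro smooth_fun_cmult smooth_fun_diff smooth_fun_inner smooth_fun_const)
  ultimately show ?thesis
    using d by (subst smooth_fun_iff) (auto simp: differentiable_def)
qed

section \<open>Smooth functions of one real variable\<close>

lemma pder_real:
  assumes "\<And>x. (f has_real_derivative f' x) (at x)"
  shows "pder f [1] = f'"
proof
  fix x
  have "frechet_derivative f (at x) = (\<lambda>h. f' x * h)"
    using assms[of x] frechet_derivative_at unfolding has_field_derivative_def by metis
  then show "pder f [1] x = f' x"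
    by simp
qed

lemma smooth_fun_realI:
  assumes "\<And>x. (f has_real_derivative f' x) (at x)" "smooth_fun f'"
  shows "smooth_fun f"
  using assms pder_real[of f f']
  by (subst smooth_fun_iff) (auto simp: real_differentiable_def)

lemma smooth_fun_real_coinduct:
  assumes "f \<in> S" "\<And>g. g \<in> S \<Longrightarrow> \<exists>g'\<in>S. \<forall>x. (g has_real_derivative g' x) (at x)"
  shows "smooth_fun f"
  using assms(1)
proof (rule smooth_fun_coinduct)
  fix g :: "real \<Rightarrow> real" assume "g \<in> S"
  then obtain g' where g': "g' \<in> S" "\<And>x. (g has_real_derivative g' x) (at x)"
    using assms(2) by blast
  show "g differentiable (at x)" for x
    using g'(2)[of x] real_differentiable_def by blast
  show "pder g [b] \<in> S" if "b \<in> Basis" for b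
    using g'(1) pder_real[OF g'(2)] that by simp
qed

text \<open>All derivatives of exp(-1/s), extended by 0 to s \<le> 0, have this form for a suitable
  polynomial \<open>p\<close>; the family is closed under differentiation.\<close>

definition flat :: "real poly \<Rightarrow> real \<Rightarrow> real" where
  "flat p s = (if s > 0 then poly p (1 / s) * exp (- 1 / s) else 0)"

lemma poly_exp_neg_tendsto_0: "((\<lambda>y. poly p y * exp (- y)) \<longlongrightarrow> (0::real)) at_top"
proof -
  have "((\<lambda>y. \<Sum>i\<le>degree p. coeff p i * (y ^ i / exp y)) \<longlongrightarrow> (\<Sum>i\<le>degree p. coeff p i * 0)) at_top"
    by (intro tendsto_sum tendsto_mult tendsto_const tendsto_power_div_exp_0)
  then show ?thesis
    by (simp add: poly_altdef sum_distrib_right exp_minus divide_inverse mult.assoc)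
qed

lemma has_real_derivative_flat: "(flat p has_real_derivative flat (monom 1 2 * (p - pderiv p)) s) (at s)"
proof -
  consider "s > 0" | "s < 0" | "s = 0" by linarith
  then show ?thesis
  proof cases
    case 1
    have "((\<lambda>s. poly p (1 / s) * exp (- 1 / s)) has_real_derivative
        flat (monom 1 2 * (p - pderiv p)) s) (at s)"
      using 1 by (auto intro!: derivative_eq_intros
          simp: flat_def poly_monom field_simps power2_eq_square)
    then show ?thesis
      by (rule has_field_derivative_transform_within_open[where S="{0<..}"])
        (use 1 in \<open>auto simp: flat_def\<close>)
  next
    case 2
    have "((\<lambda>s. 0) has_real_derivative flat (monom 1 2 * (p - pderiv p)) s) (at s)"
      using 2 by (auto simp: flat_def)
    then show ?thesis
      by (rule has_field_derivative_transform_within_open[where S="{..<0}"])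
        (use 2 in \<open>auto simp: flat_def\<close>)
  next
    case 3
    \<comment> \<open>From the right, the difference quotient at 0 is y p(y) exp(-y) with y = 1/h;
      the extra factor y is \<open>monom 1 1\<close>.\<close>
    have "((\<lambda>y. poly (monom 1 1 * p) y * exp (- y)) \<longlongrightarrow> 0) at_top"
      by (rule poly_exp_neg_tendsto_0)
    then have "((\<lambda>h. poly (monom 1 1 * p) (inverse h) * exp (- inverse h)) \<longlongrightarrow> 0) (at_right 0)"
      by (rule filterlim_compose[OF _ filterlim_inverse_at_top_right])
    then have r: "((\<lambda>h. (flat p (0 + h) - flat p 0) / h) \<longlongrightarrow> 0) (at_right 0)"
      by (rule tendsto_cong[THEN iffD1, rotated])
        (auto simp: eventually_at_filter flat_def poly_monom field_simps)
    have l: "((\<lambda>h. (flat p (0 + h) - flat p 0) / h) \<longlongrightarrow> 0) (at_left 0)"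
      by (rule tendsto_cong[THEN iffD1, rotated, OF tendsto_const])
        (auto simp: eventually_at_filter flat_def)
    have "(flat p has_real_derivative 0) (at 0)"
      unfolding DERIV_def using filterlim_split_at[OF l r] by simp
    with 3 show ?thesis by (simp add: flat_def)
  qed
qed

lemma smooth_fun_flat: "smooth_fun (flat p)"
  using smooth_fun_real_coinduct[of "flat p" "range flat"] has_real_derivative_flat by blast

section \<open>The softplus truncation of the exponential\<close>

text \<open>The logistic function, which is the derivative of \<open>softplus\<close> and solves y'
  = y (1 - y).\<close>

definition sigm :: "real \<Rightarrow> real" where "sigm x = 1 - inverse (1 + exp x)"
definition softplus :: "real \<Rightarrow> real" where "softplus x = ln (1 + exp x)"

lemma sigm_bounds: "0 < sigm x" "sigm x < 1"
  by (auto simp: sigm_def add_pos_pos field_simps)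

lemma has_real_derivative_sigm: "(sigm has_real_derivative sigm x * (1 - sigm x)) (at x)"
proof -
  have "1 + exp x \<noteq> 0" using exp_gt_zero[of x] by linarith
  then show ?thesis
    unfolding sigm_def[abs_def]
    by (auto intro!: derivative_eq_intros simp: field_simps power2_eq_square)
qed

lemma has_real_derivative_softplus: "(softplus has_real_derivative sigm x) (at x)"
proof -
  have "1 + exp x > 0" using exp_gt_zero[of x] by linarith
  then show ?thesis
    unfolding softplus_def[abs_def] sigm_def
    by (auto intro!: derivative_eq_intros simp: field_simps)
qed

text \<open>Because \<sigma>' = \<sigma> (1 - \<sigma>), the polynomials in \<open>sigm\<close> are
  closed under differentiation; \<open>[:0, 1, -1:]\<close> is the right-hand side as a
  polynomial.\<close>

lemma smooth_fun_sigm: "smooth_fun sigm"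
proof (rule smooth_fun_real_coinduct[where S="range (\<lambda>p x. poly p (sigm x))"])
  show "sigm \<in> range (\<lambda>p x. poly p (sigm x))"
    by (rule image_eqI[of _ _ "[:0, 1:]"]) auto
  fix g :: "real \<Rightarrow> real" assume "g \<in> range (\<lambda>p x. poly p (sigm x))"
  then obtain p where p: "g = (\<lambda>x. poly p (sigm x))" by auto
  have "(g has_real_derivative poly (pderiv p * [:0, 1, -1:]) (sigm x)) (at x)" for x
    unfolding p using DERIV_chain2[OF poly_DERIV has_real_derivative_sigm, of p x]
    by (simp add: algebra_simps)
  then show "\<exists>g'\<in>range (\<lambda>p x. poly p (sigm x)). \<forall>x. (g has_real_derivative g' x) (at x)"
    by (intro bexI[of _ "\<lambda>x. poly (pderiv p * [:0, 1, -1:]) (sigm x)"] allI rangeI)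
qed

lemma smooth_fun_softplus: "smooth_fun softplus"
  using smooth_fun_realI[OF has_real_derivative_softplus smooth_fun_sigm] .

lemma softplus_pos: "0 < softplus x"
  unfolding softplus_def using ln_gt_zero[of "1 + exp x"] by simp

lemma softplus_le_exp: "softplus x \<le> exp x"
  unfolding softplus_def using exp_gt_zero ln_add_one_self_le_self by (simp add: less_imp_le)

lemma softplus_le_linear: "softplus x \<le> 1 + \<bar>x\<bar>"
proof -
  have "1 + exp x \<le> 2 * exp \<bar>x\<bar>"
    using exp_le_cancel_iff[THEN iffD2, OF abs_ge_self, of x] one_le_exp_iff[of "\<bar>x\<bar>"] by linarith
  also have "\<dots> \<le> exp 1 * exp \<bar>x\<bar>"
    using exp_ge_add_one_self[of 1] by simp
  finally have "1 + exp x \<le> exp (1 + \<bar>x\<bar>)" by (simp add: exp_add)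
  then show ?thesis
    unfolding softplus_def
    by (metis add_pos_pos exp_gt_zero ln_exp ln_le_cancel_iff zero_less_one)
qed

text \<open>In terms of y = \<open>softplus x\<close> the comparisons below become elementary
  inequalities for y - 1 + exp(-y) with y > 0.\<close>

lemma sigm_softplus: "sigm x = 1 - exp (- softplus x)"
  using exp_ln[of "1 + exp x"] add_pos_pos[OF zero_less_one exp_gt_zero[of x]]
  by (simp add: sigm_def softplus_def exp_minus)

lemma exp_neg_le_quadratic:
  fixes x :: real
  assumes "0 \<le> x"
  shows "exp (- x) \<le> 1 - x + x\<^sup>2 / 2"
proof -
  have "(\<lambda>x. 1 - x + x\<^sup>2 / 2 - exp (- x)) 0 \<le> (\<lambda>x. 1 - x + x\<^sup>2 / 2 - exp (- x)) x"
  proof (rule DERIV_nonneg_imp_nondecreasing[OF assms])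
    fix y :: real
    have "((\<lambda>x. 1 - x + x\<^sup>2 / 2 - exp (- x)) has_real_derivative (- 1 + y + exp (- y))) (at y)"
      by (auto intro!: derivative_eq_intros)
    moreover have "- 1 + y + exp (- y) \<ge> 0"
      using exp_ge_add_one_self[of "- y"] by linarith
    ultimately show "\<exists>D. ((\<lambda>x. 1 - x + x\<^sup>2 / 2 - exp (- x)) has_real_derivative D) (at y) \<and> 0 \<le> D"
      by blast
  qed
  then show ?thesis by simp
qed

lemma softplus_minus_sigm_nonneg: "0 \<le> softplus x - sigm x"
  using exp_ge_add_one_self[of "- softplus x"] by (simp add: sigm_softplus)

text \<open>The factor 1/2 is the second Taylor coefficient of exp(-y). It becomes the t/2 in the
  bound on \<open>gam\<close>, and thereby the restriction t < 2.\<close>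

lemma softplus_minus_sigm_le_square: "softplus x - sigm x \<le> (softplus x)\<^sup>2 / 2"
  using exp_neg_le_quadratic[of "softplus x"] softplus_pos[of x] by (simp add: sigm_softplus)

text \<open>With y = \<open>softplus x\<close> this is (1 + y) exp(-y) \<le> 1.\<close>

lemma softplus_minus_sigm_le_mult: "softplus x - sigm x \<le> softplus x * sigm x"
proof -
  have "(1 + softplus x) * exp (- softplus x) \<le> exp (softplus x) * exp (- softplus x)"
    by (intro mult_right_mono exp_ge_add_one_self) auto
  then show ?thesis
    by (simp add: sigm_softplus exp_minus algebra_simps)
qed

section \<open>Test functions\<close>

lemma test_funD: "test_fun f \<Longrightarrow> smooth_fun f"
  by (simp add: test_fun_def)

lemma smooth_fun_differentiable: "smooth_fun f \<Longrightarrow> f differentiable (at x)"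
  using smooth_fun_iff by blast

lemma smooth_fun_continuous: "smooth_fun f \<Longrightarrow> continuous_on S f"
  by (meson continuous_at_imp_continuous_on differentiable_imp_continuous_within smooth_fun_differentiable)

lemma test_funI:
  assumes "smooth_fun f" "\<And>x. x \<notin> cball 0 R \<Longrightarrow> f x = 0"
  shows "test_fun f"
proof -
  have "closure {x. f x \<noteq> 0} \<subseteq> cball 0 R"
    using assms(2) by (intro closure_minimal) blast+
  then show ?thesis
    using assms(1) unfolding test_fun_def
    by (meson bounded_cball bounded_subset closed_closure compact_eq_bounded_closed)
qed

lemma test_fun_support:
  assumes "test_fun f"
  obtains R where "R > 0" "\<And>x. x \<notin> cball 0 R \<Longrightarrow> f x = 0"
proof -
  have "bounded (closure {x. f x \<noteq> 0})"
    using assms unfolding test_fun_def by (simp add: compact_imp_bounded)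
  then obtain R where "R > 0" "\<And>x. x \<in> closure {x. f x \<noteq> 0} \<Longrightarrow> norm x \<le> R"
    unfolding bounded_pos by blast
  then show ?thesis
    using that[of R] closure_subset[of "{x. f x \<noteq> 0}"] by force
qed

lemma test_fun_mult: "smooth_fun f \<Longrightarrow> test_fun g \<Longrightarrow> test_fun (\<lambda>x. f x * g x)"
  using test_fun_support[of g] test_funI[OF smooth_fun_mult[of f g]] test_funD by (metis mult_eq_0_iff)

lemma has_derivative_grad:
  assumes "f differentiable (at x)"
  shows "(f has_derivative (\<lambda>h. grad f x \<bullet> h)) (at x)"
proof -
  let ?D = "frechet_derivative f (at x)"
  have "?D h = grad f x \<bullet> h" for h
  proof -
    have "?D h = ?D (\<Sum>b\<in>Basis. (h \<bullet> b) *\<^sub>R b)"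
      by (simp add: euclidean_representation)
    also have "\<dots> = (\<Sum>b\<in>Basis. (h \<bullet> b) * ?D b)"
      using linear_frechet_derivative[OF assms] by (simp add: linear_sum linear_cmul)
    also have "\<dots> = grad f x \<bullet> h"
      unfolding grad_def by (simp add: inner_sum_left inner_commute[of h] mult.commute)
    finally show ?thesis .
  qed
  then have "?D = (\<lambda>h. grad f x \<bullet> h)" by auto
  then show ?thesis
    using assms frechet_derivative_works by metis
qed

lemma grad_eqI:
  assumes "(f has_derivative (\<lambda>h. v \<bullet> h)) (at x)"
  shows "grad f x = v"
  unfolding grad_def frechet_derivative_at[OF assms, symmetric] by (rule euclidean_representation)

lemma grad_inner_Basis: "b \<in> Basis \<Longrightarrow> grad f x \<bullet> b = pder f [b] x"
  by (simp add: grad_def inner_sum_left inner_Basis if_distrib cong: if_cong)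

lemma continuous_on_grad: "smooth_fun f \<Longrightarrow> continuous_on S (grad f)"
  using smooth_fun_iff[of f] smooth_fun_continuous[where f="pder f [_]"] unfolding grad_def
  by (intro continuous_on_sum continuous_on_scaleR continuous_on_const) simp

lemma grad_eq_0_outside:
  assumes "\<And>x. x \<notin> cball 0 R \<Longrightarrow> f x = 0" "x \<notin> cball 0 R"
  shows "grad f x = 0"
proof (rule grad_eqI)
  have "((\<lambda>x. 0) has_derivative (\<lambda>h. 0 \<bullet> h)) (at x)" by simp
  then show "(f has_derivative (\<lambda>h. 0 \<bullet> h)) (at x)"
    by (rule has_derivative_transform_within_open[where s="- cball 0 R"]) (use assms in auto)
qed

lemma bounded_continuous_support:
  fixes f :: "'a::euclidean_space \<Rightarrow> 'b::real_normed_vector"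
  assumes "continuous_on UNIV f" "\<And>x. x \<notin> cball 0 R \<Longrightarrow> f x = 0"
  obtains B where "B > 0" "\<And>x. norm (f x) \<le> B"
proof -
  have "bounded (f ` cball 0 R)"
    using assms(1) by (intro compact_imp_bounded compact_continuous_image)
      (auto intro: continuous_on_subset)
  then obtain B where "B > 0" "\<And>x. x \<in> cball 0 R \<Longrightarrow> norm (f x) \<le> B"
    unfolding bounded_pos by blast
  then show ?thesis
    using that assms(2) by (metis less_imp_le norm_zero)
qed

lemma uniform_continuity_support:
  fixes f :: "'a::euclidean_space \<Rightarrow> 'b::real_normed_vector"
  assumes "continuous_on UNIV f" "\<And>x. x \<notin> cball 0 R \<Longrightarrow> f x = 0" "e > 0"
  obtains d where "d > 0" "\<And>x y. dist x y < d \<Longrightarrow> dist (f x) (f y) < e"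
proof -
  \<comment> \<open>The extra 1 is slack: of two points at distance below 1, either both lie in the
    larger ball or both lie outside the support.\<close>
  have "uniformly_continuous_on (cball 0 (R + 1)) f"
    using assms(1) by (intro compact_uniformly_continuous) (auto intro: continuous_on_subset)
  then obtain d where d: "d > 0"
    "\<And>x y. x \<in> cball 0 (R + 1) \<Longrightarrow> y \<in> cball 0 (R + 1) \<Longrightarrow> dist y x < d \<Longrightarrow> dist (f y) (f x) < e"
    unfolding uniformly_continuous_on_def using assms(3) by metis
  show ?thesis
  proof
    show "min d 1 > 0" using d by simp
    fix x y :: 'a assume xy: "dist x y < min d 1"
    show "dist (f x) (f y) < e"
    proof (cases "x \<in> cball 0 R \<or> y \<in> cball 0 R")
      case True
      with xy have "x \<in> cball 0 (R + 1)" "y \<in> cball 0 (R + 1)"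
        using norm_triangle_ineq2[of x y] norm_triangle_ineq3[of x y] by (auto simp: dist_norm)
      then show ?thesis using d xy by auto
    next
      case False
      then show ?thesis using assms by simp
    qed
  qed
qed

text \<open>Inside the ball of radius \<open>r\<close> about \<open>z\<close> this is exp(-1 / (1 -
  (|x - z| / r)^(2 m))). The value m = 1 gives the usual mollifier profile; a larger m flattens the
  centre and serves the cutoff.\<close>

definition bump :: "nat \<Rightarrow> real \<Rightarrow> 'a::euclidean_space \<Rightarrow> 'a \<Rightarrow> real" where
  "bump m r z x = flat 1 (1 - ((x - z) \<bullet> (x - z) / r\<^sup>2) ^ m)"

lemma smooth_fun_bump: "smooth_fun (bump m r z)"
proof -
  have "smooth_fun (\<lambda>x. flat 1 (1 - ((1 / r\<^sup>2) * ((x - z) \<bullet> (x - z))) ^ m))"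
    by (intro smooth_fun_compose[OF smooth_fun_flat] smooth_fun_diff smooth_fun_const
        smooth_fun_power smooth_fun_cmult smooth_fun_dist_square)
  then show ?thesis
    unfolding bump_def[abs_def] by simp
qed

lemma flat_1_bounds: "0 \<le> flat 1 s" "flat 1 s \<le> 1" "s > 0 \<Longrightarrow> flat 1 s > 0" "s \<le> 0 \<Longrightarrow> flat 1 s = 0"
  by (auto simp: flat_def)

lemma bump_eq_0:
  fixes x z :: "'a::euclidean_space"
  assumes "r > 0" "norm (x - z) \<ge> r"
  shows "bump m r z x = 0"
proof -
  have "1 \<le> (x - z) \<bullet> (x - z) / r\<^sup>2"
    using assms by (simp add: power2_norm_eq_inner[symmetric] power_mono)
  then have "1 \<le> ((x - z) \<bullet> (x - z) / r\<^sup>2) ^ m"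
    by (rule one_le_power)
  then show ?thesis
    unfolding bump_def by (intro flat_1_bounds) simp
qed

lemma bump_pos:
  fixes x z :: "'a::euclidean_space"
  assumes "r > 0" "norm (x - z) < r" "m > 0"
  shows "bump m r z x > 0"
proof -
  have "(x - z) \<bullet> (x - z) / r\<^sup>2 < 1"
    using assms by (simp add: power2_norm_eq_inner[symmetric] power_strict_mono)
  then have "((x - z) \<bullet> (x - z) / r\<^sup>2) ^ m < 1"
    using assms by (intro power_less_one_iff[THEN iffD2]) auto
  then show ?thesis
    unfolding bump_def by (intro flat_1_bounds) simp
qed

lemma test_fun_bump:
  fixes z :: "'a::euclidean_space"
  assumes "r > 0"
  shows "test_fun (bump m r z)"
proof (rule test_funI[OF smooth_fun_bump])
  fix x :: 'a assume "x \<notin> cball 0 (r + norm z)"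
  then show "bump m r z x = 0"
    using assms norm_triangle_ineq2[of x z] by (intro bump_eq_0) auto
qed

section \<open>Mollification\<close>

lemma integrable_bounded_support:
  fixes U :: "'a::euclidean_space \<Rightarrow> 'b::{banach, second_countable_topology}"
  assumes f: "f \<in> borel_measurable borel" "\<And>y. \<bar>f y\<bar> \<le> B" "\<And>y. y \<notin> cball 0 R \<Longrightarrow> f y = 0"
    and U: "set_integrable lborel (cball 0 R) U"
  shows "integrable lborel (\<lambda>y. f y *\<^sub>R U y)"
proof -
  have *: "(\<lambda>y. f y *\<^sub>R U y) = (\<lambda>y. f y *\<^sub>R (indicator (cball 0 R) y *\<^sub>R U y))"
    using f(3) by (auto simp: fun_eq_iff indicator_def)
  have [measurable]: "(\<lambda>y. indicator (cball 0 R) y *\<^sub>R U y) \<in> borel_measurable borel"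
    using U unfolding set_integrable_def by (auto dest: borel_measurable_integrable)
  note f(1)[measurable]
  show ?thesis
    unfolding *
  proof (rule Bochner_Integration.integrable_bound)
    show "integrable lborel (\<lambda>y. B *\<^sub>R (indicator (cball 0 R) y *\<^sub>R U y))"
      using U unfolding set_integrable_def by (intro integrable_scaleR_right)
    have "\<bar>f y\<bar> \<le> \<bar>B\<bar>" for y
      using f(2)[of y] by linarith
    then show "AE y in lborel. norm (f y *\<^sub>R (indicator (cball 0 R) y *\<^sub>R U y))
        \<le> norm (B *\<^sub>R (indicator (cball 0 R) y *\<^sub>R U y))"
      by (intro AE_I2) (simp add: abs_mult mult_right_mono)
  qed measurable
qed

lemma set_integrable_const_cball: "set_integrable lborel (cball 0 R) (\<lambda>x. c :: 'b::{banach, second_countable_topology})"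
  unfolding set_integrable_def
  by (intro integrable_scaleR_left integrable_real_indicator emeasure_lborel_cball_finite) simp

lemma distr_lborel_reflect: "distr lborel borel (\<lambda>y. c - y) = (lborel :: 'a::euclidean_space measure)"
  by (subst (2) lborel_affine[of "-1" c]) (auto simp: density_1)

lemma lborel_integral_reflect:
  fixes f :: "'a::euclidean_space \<Rightarrow> 'b::{banach, second_countable_topology}"
  assumes "f \<in> borel_measurable borel"
  shows "(\<integral> y. f (c - y) \<partial>lborel) = (\<integral> y. f y \<partial>lborel)"
  by (subst (2) distr_lborel_reflect[of c, symmetric]) (use assms in \<open>simp add: integral_distr\<close>)

lemma integrable_lborel_shift:
  fixes f :: "'a::euclidean_space \<Rightarrow> 'b::{banach, second_countable_topology}"
  assumes "integrable lborel f"
  shows "integrable lborel (\<lambda>y. f (y - c))" "(\<integral> y. f (y - c) \<partial>lborel) = (\<integral> y. f y \<partial>lborel)"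
proof -
  have [measurable]: "f \<in> borel_measurable borel"
    using assms by (auto dest: borel_measurable_integrable)
  have "integrable (distr lborel borel ((+) (- c))) f"
    using assms by (simp add: lborel_distr_plus)
  then show "integrable lborel (\<lambda>y. f (y - c))"
    by (subst (asm) integrable_distr_eq) (auto simp: o_def)
  have "(\<integral> y. f y \<partial>distr lborel borel ((+) (- c))) = (\<integral> y. f (y - c) \<partial>lborel)"
    by (subst integral_distr) auto
  then show "(\<integral> y. f (y - c) \<partial>lborel) = (\<integral> y. f y \<partial>lborel)"
    by (simp add: lborel_distr_plus)
qed

subsection \<open>Continuity of translations in \<open>L\<^sup>1\<close>\<close>

text \<open>Formulated along sequences so that dominated convergence applies directly;
  \<open>L1_shift_small\<close> recovers the version with a distance.\<close>

definition L1_shift_continuous :: "('a::euclidean_space \<Rightarrow> 'b::{banach, second_countable_topology}) \<Rightarrow> bool" where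
  "L1_shift_continuous V \<longleftrightarrow>
     (\<forall>z. z \<longlonglongrightarrow> 0 \<longrightarrow> (\<lambda>n. \<integral>x. norm (V (x - z n) - V x) \<partial>lborel) \<longlonglongrightarrow> 0)"

text \<open>The error V - W enters once translated and once untranslated, with equal integrals by
  translation invariance; hence the tolerance e/4 for it and e/2 for the translates of W.\<close>

lemma L1_shift_continuous_approx:
  assumes V: "integrable lborel V"
    and W: "\<And>e. e > 0 \<Longrightarrow> \<exists>W. integrable lborel W \<and> L1_shift_continuous W \<and> (\<integral>x. norm (V x - W x) \<partial>lborel) < e"
  shows "L1_shift_continuous V"
  unfolding L1_shift_continuous_def
proof (intro allI impI LIMSEQ_I)
  fix z :: "nat \<Rightarrow> 'a" and e :: real
  assume z: "z \<longlonglongrightarrow> 0" and e: "e > 0"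
  from e W[of "e / 4"] obtain W where W: "integrable lborel W" "L1_shift_continuous W"
    "(\<integral>x. norm (V x - W x) \<partial>lborel) < e / 4" by auto
  obtain N where N: "\<And>n. n \<ge> N \<Longrightarrow> (\<integral>x. norm (W (x - z n) - W x) \<partial>lborel) < e / 2"
    using LIMSEQ_D[of _ 0 "e/2"] W(2) z e unfolding L1_shift_continuous_def by fastforce
  have D: "integrable lborel (\<lambda>x. V x - W x)" using V W by simp
  note shifts = integrable_lborel_shift(1)[OF V] integrable_lborel_shift(1)[OF W(1)]
  have "(\<integral>x. norm (V (x - z n) - V x) \<partial>lborel) < e" if "n \<ge> N" for n
  proof -
    have "(\<integral>x. norm (V (x - z n) - V x) \<partial>lborel) \<le> (\<integral>x. norm (V (x - z n) - W (x - z n))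
        + norm (W (x - z n) - W x) + norm (V x - W x) \<partial>lborel)"
    proof (rule integral_mono)
      show "integrable lborel (\<lambda>x. norm (V (x - z n) - V x))"
        using V shifts by simp
      show "integrable lborel (\<lambda>x. norm (V (x - z n) - W (x - z n))
          + norm (W (x - z n) - W x) + norm (V x - W x))"
        using V W(1) shifts by simp
      show "norm (V (x - z n) - V x) \<le> norm (V (x - z n) - W (x - z n))
          + norm (W (x - z n) - W x) + norm (V x - W x)" for x
        using dist_triangle[of "V (x - z n)" "V x" "W (x - z n)"] dist_triangle[of "W (x - z n)" "V x" "W x"]
        by (simp add: dist_norm norm_minus_commute)
    qed
    also have "\<dots> = (\<integral>x. norm (V (x - z n) - W (x - z n)) \<partial>lborel)
        + (\<integral>x. norm (W (x - z n) - W x) \<partial>lborel) + (\<integral>x. norm (V x - W x) \<partial>lborel)"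
      using V W(1) shifts by simp
    also have "(\<integral>x. norm (V (x - z n) - W (x - z n)) \<partial>lborel) = (\<integral>x. norm (V x - W x) \<partial>lborel)"
      using integrable_lborel_shift(2)[OF integrable_norm[OF D], of "z n"] by simp
    finally show ?thesis
      using W(3) N[OF that] by simp
  qed
  then show "\<exists>no. \<forall>n\<ge>no. norm ((\<integral>x. norm (V (x - z n) - V x) \<partial>lborel) - 0) < e"
    by (auto intro!: exI[of _ N])
qed

text \<open>Pointwise convergence may fail on the boundary, which may have positive measure. For a,
  b in {0, 1} the identity |a - b| = (a - b) + 2 b (1 - a) avoids it: with a the translate, a - b
  integrates to 0 and the other term lives on U, where openness gives convergence.\<close>

lemma L1_shift_continuous_open:
  assumes U: "open U" "emeasure lborel U < \<infinity>"
  shows "L1_shift_continuous (indicator U :: 'a::euclidean_space \<Rightarrow> real)"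
  unfolding L1_shift_continuous_def
proof (intro allI impI)
  fix z :: "nat \<Rightarrow> 'a" assume z: "z \<longlonglongrightarrow> 0"
  let ?u = "indicator U :: 'a \<Rightarrow> real"
  have U_int: "integrable lborel ?u"
    using U by simp
  have [measurable]: "U \<in> sets borel" using U by simp
  have int2: "integrable lborel (\<lambda>x. ?u x * (1 - ?u (x - z n)))" for n
    by (rule Bochner_Integration.integrable_bound[OF U_int]) (auto simp: indicator_def)
  have eq: "(\<integral>x. norm (?u (x - z n) - ?u x) \<partial>lborel) = 2 * (\<integral>x. ?u x * (1 - ?u (x - z n)) \<partial>lborel)" for n
  proof -
    have "(\<integral>x. norm (?u (x - z n) - ?u x) \<partial>lborel)
        = (\<integral>x. (?u (x - z n) - ?u x) + 2 * (?u x * (1 - ?u (x - z n))) \<partial>lborel)"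
      by (rule Bochner_Integration.integral_cong) (auto simp: indicator_def)
    also have "\<dots> = (\<integral>x. ?u (x - z n) - ?u x \<partial>lborel) + (\<integral>x. 2 * (?u x * (1 - ?u (x - z n))) \<partial>lborel)"
      using U_int int2 by (intro Bochner_Integration.integral_add)
        (auto intro!: integrable_lborel_shift(1) simp del: integrable_indicator_iff integral_indicator)
    also have "(\<integral>x. ?u (x - z n) - ?u x \<partial>lborel) = 0"
      using U_int integrable_lborel_shift[OF U_int, of "z n"]
      by (subst Bochner_Integration.integral_diff) (auto simp del: integrable_indicator_iff integral_indicator)
    finally show ?thesis by simp
  qed
  have "(\<lambda>n. \<integral>x. ?u x * (1 - ?u (x - z n)) \<partial>lborel) \<longlonglongrightarrow> (\<integral>x. 0 \<partial>(lborel :: 'a measure))"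
  proof (rule integral_dominated_convergence[OF _ _ U_int])
    show "AE x in lborel. (\<lambda>n. ?u x * (1 - ?u (x - z n))) \<longlonglongrightarrow> 0"
    proof (rule AE_I2)
      fix x
      show "(\<lambda>n. ?u x * (1 - ?u (x - z n))) \<longlonglongrightarrow> 0"
      proof (cases "x \<in> U")
        case True
        have "(\<lambda>n. x - z n) \<longlonglongrightarrow> x"
          using tendsto_diff[OF tendsto_const z, of x] by simp
        then have "\<forall>\<^sub>F n in sequentially. x - z n \<in> U"
          using U(1) True by (rule topological_tendstoD)
        then show ?thesis
          by (rule tendsto_eventually[OF eventually_mono]) simp
      qed simp
    qed
  qed (auto simp: indicator_def)
  then show "(\<lambda>n. \<integral>x. norm (?u (x - z n) - ?u x) \<partial>lborel) \<longlonglongrightarrow> 0"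
    unfolding eq by (auto intro: tendsto_mult_right_zero)
qed

text \<open>Outer regularity reduces this to open sets.\<close>

lemma L1_shift_continuous_indicator:
  fixes A :: "'a::euclidean_space set"
  assumes A: "A \<in> sets borel" "emeasure lborel A < \<infinity>"
  shows "L1_shift_continuous (indicator A :: 'a \<Rightarrow> real)"
proof (rule L1_shift_continuous_approx)
  show "integrable lborel (indicator A :: 'a \<Rightarrow> real)" using A by simp
  fix e :: real assume e: "e > 0"
  obtain U where U: "open U" "A \<subseteq> U" "emeasure lborel (U - A) < ennreal e"
    using outer_regular_lborel[OF A(1) e] by blast
  have UA: "U = A \<union> (U - A)" using U by auto
  have m: "U - A \<in> sets borel" using A U by auto
  have "emeasure lborel (A \<union> (U - A)) \<le> emeasure lborel A + emeasure lborel (U - A)"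
    using A m by (intro emeasure_subadditive) auto
  then have "emeasure lborel U \<le> emeasure lborel A + emeasure lborel (U - A)"
    using UA by simp
  also have "\<dots> < \<infinity>"
    using A(2) U(3) by (auto simp: less_top[symmetric] ennreal_add_eq_top)
  finally have fin: "emeasure lborel U < \<infinity>" .
  have "(\<integral>x. norm (indicator A x - indicator U x :: real) \<partial>lborel) = (\<integral>x. indicator (U - A) x \<partial>lborel)"
    using U(2) by (intro Bochner_Integration.integral_cong) (auto simp: indicator_def)
  also have "\<dots> = measure lborel (U - A)" using m by simp
  also have "\<dots> < e"
    using U(3) e unfolding measure_def by (metis ennreal_less_top enn2real_less_iff less_imp_le order_less_trans ennreal_enn2real ennreal_less_iff enn2real_nonneg)
  finally show "\<exists>W. integrable lborel W \<and> L1_shift_continuous W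
      \<and> (\<integral>x. norm (indicator A x - W x :: real) \<partial>lborel) < e"
    using L1_shift_continuous_open[OF U(1) fin] U(1) fin
    by (intro exI[of _ "indicator U"]) auto
qed

lemma L1_shift_continuous_integrable:
  fixes V :: "'a::euclidean_space \<Rightarrow> 'b::{banach, second_countable_topology}"
  assumes "integrable lborel V"
  shows "L1_shift_continuous V"
  using assms
proof (induction rule: integrable_induct)
  case (base A c)
  have "norm (indicator A (x - z) *\<^sub>R c - indicator A x *\<^sub>R c)
      = norm (indicator A (x - z) - indicator A x :: real) * norm c" for x z :: 'a
    by (metis norm_scaleR real_norm_def scaleR_left_diff_distrib)
  then show ?case
    using L1_shift_continuous_indicator[of A] base
    unfolding L1_shift_continuous_def by (auto intro!: tendsto_mult_left_zero)
next
  case (add f g)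
  show ?case
    unfolding L1_shift_continuous_def
  proof (intro allI impI)
    fix z :: "nat \<Rightarrow> 'a" assume z: "z \<longlonglongrightarrow> 0"
    let ?T = "\<lambda>h n. \<integral>x. norm (h (x - z n) - h x) \<partial>lborel"
    have le: "?T (\<lambda>x. f x + g x) n \<le> ?T f n + ?T g n" for n
    proof -
      have "?T (\<lambda>x. f x + g x) n \<le> (\<integral>x. norm (f (x - z n) - f x) + norm (g (x - z n) - g x) \<partial>lborel)"
        using add integrable_lborel_shift(1)[OF add(1)] integrable_lborel_shift(1)[OF add(2)]
        by (intro integral_mono) (simp_all add: norm_diff_triangle_ineq)
      also have "\<dots> = ?T f n + ?T g n"
        using add integrable_lborel_shift(1)[OF add(1)] integrable_lborel_shift(1)[OF add(2)] by simp
      finally show ?thesis .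
    qed
    have lim: "(\<lambda>n. ?T f n + ?T g n) \<longlonglongrightarrow> 0"
      using add z tendsto_add[of "?T f" 0 _ "?T g" 0] unfolding L1_shift_continuous_def by simp
    show "?T (\<lambda>x. f x + g x) \<longlonglongrightarrow> 0"
      by (rule tendsto_sandwich[OF _ _ tendsto_const lim]) (use le in auto)
  qed
next
  case (lim f s)
  show ?case
  proof (rule L1_shift_continuous_approx[OF lim(4)])
    fix e :: real assume e: "e > 0"
    \<comment> \<open>The induction rule supplies approximants bounded by 2 |f|, whence the
      dominating function 3 |f|.\<close>
    have "(\<lambda>i. \<integral>x. norm (f x - s i x) \<partial>lborel) \<longlonglongrightarrow> (\<integral>x. 0 \<partial>(lborel :: 'a measure))"
    proof (rule integral_dominated_convergence[where w="\<lambda>x. 3 * norm (f x)"])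
      show "AE x in lborel. (\<lambda>i. norm (f x - s i x)) \<longlonglongrightarrow> 0"
      proof (rule AE_I2)
        fix x :: 'a
        show "(\<lambda>i. norm (f x - s i x)) \<longlonglongrightarrow> 0"
          using tendsto_norm[OF tendsto_diff[OF tendsto_const[of "f x"] lim(2)[of x]]] by simp
      qed
      show "AE x in lborel. norm (norm (f x - s i x)) \<le> 3 * norm (f x)" for i
      proof (rule AE_I2)
        fix x :: 'a
        show "norm (norm (f x - s i x)) \<le> 3 * norm (f x)"
          using lim(3)[of x i] norm_triangle_ineq4[of "f x" "s i x"] by simp
      qed
    qed (use lim(1,4) in \<open>auto dest: borel_measurable_integrable\<close>)
    then have "\<forall>\<^sub>F i in sequentially. (\<integral>x. norm (f x - s i x) \<partial>lborel) < e"
      using e order_tendstoD(2) by fastforce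
    then obtain i where "(\<integral>x. norm (f x - s i x) \<partial>lborel) < e"
      using eventually_happens'[OF sequentially_bot] by blast
    then show "\<exists>W. integrable lborel W \<and> L1_shift_continuous W \<and> (\<integral>x. norm (f x - W x) \<partial>lborel) < e"
      using lim by blast
  qed
qed

subsection \<open>Convolution with a test function\<close>

text \<open>The kernel carries the difference x - y, so derivatives in x fall on it. The values of
  \<open>U\<close> are vectors because functions, gradients and tuples of them are all mollified by
  this one operator.\<close>

definition conv :: "('a::euclidean_space \<Rightarrow> real) \<Rightarrow> ('a \<Rightarrow> 'b::{banach, second_countable_topology}) \<Rightarrow> 'a \<Rightarrow> 'b" where
  "conv \<rho> U x = (\<integral>y. \<rho> (x - y) *\<^sub>R U y \<partial>lborel)"

lemma integrable_conv:
  fixes U :: "'a::euclidean_space \<Rightarrow> 'b::{banach, second_countable_topology}"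
    and k :: "'a \<Rightarrow> real"
  assumes k: "continuous_on UNIV k" "\<And>x. x \<notin> cball 0 r \<Longrightarrow> k x = 0"
    and U: "\<And>R. set_integrable lborel (cball 0 R) U"
  shows "integrable lborel (\<lambda>y. k (x - y) *\<^sub>R U y)"
proof -
  obtain B where B: "\<And>x. norm (k x) \<le> B"
    using bounded_continuous_support[OF k] by blast
  show ?thesis
  proof (rule integrable_bounded_support[where B=B and R="norm x + r"])
    have "continuous_on UNIV (\<lambda>y. k (x - y))"
      by (intro continuous_on_compose2[OF k(1)]) (auto intro!: continuous_intros)
    then show "(\<lambda>y. k (x - y)) \<in> borel_measurable borel"
      by (rule borel_measurable_continuous_onI)
    show "k (x - y) = 0" if "y \<notin> cball 0 (norm x + r)" for y
      using that norm_triangle_ineq2[of y x] by (intro k(2)) (auto simp: norm_minus_commute)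
  qed (use B U in auto)
qed

text \<open>Uniform continuity of the gradient makes the first-order remainder small uniformly in
  the base point, which is what differentiation under the convolution integral requires.\<close>

lemma test_fun_linearization:
  assumes "test_fun \<rho>" "e > 0"
  obtains d where "d > 0" "\<And>w h. norm h < d \<Longrightarrow> \<bar>\<rho> (w + h) - \<rho> w - grad \<rho> w \<bullet> h\<bar> \<le> norm h * e"
proof -
  obtain R where "R > 0" and R: "\<And>x. x \<notin> cball 0 R \<Longrightarrow> \<rho> x = 0"
    using test_fun_support[OF assms(1)] by metis
  have "grad \<rho> x = 0" if "x \<notin> cball 0 R" for x
    using grad_eq_0_outside[of R \<rho>] R that by blast
  then obtain d where d: "d > 0" "\<And>x y. dist x y < d \<Longrightarrow> dist (grad \<rho> x) (grad \<rho> y) < e"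
    using uniform_continuity_support[OF continuous_on_grad[OF test_funD[OF assms(1)]] _ assms(2)] by metis
  show ?thesis
  proof
    show "d > 0" by (rule d)
    fix w h :: 'a assume h: "norm h < d"
    have "norm (\<rho> (w + h) - \<rho> w - grad \<rho> w \<bullet> (w + h - w)) \<le> norm (w + h - w) * e"
    proof (rule differentiable_bound_linearization[where S="ball w d" and f'="\<lambda>x h. grad \<rho> x \<bullet> h"])
      show "w + t *\<^sub>R (w + h - w) \<in> ball w d" if "t \<in> {0..1}" for t
        using that h mult_left_le_one_le[of "norm h" "\<bar>t\<bar>"] by (auto simp: dist_norm intro: order_le_less_trans)
      show "(\<rho> has_derivative (\<lambda>h. grad \<rho> x \<bullet> h)) (at x within ball w d)" for x
        using has_derivative_grad[OF smooth_fun_differentiable[OF test_funD[OF assms(1)]]]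
          has_derivative_at_withinI by blast
      show "onorm ((\<lambda>h. grad \<rho> x \<bullet> h) - (\<lambda>h. grad \<rho> w \<bullet> h)) \<le> e" if "x \<in> ball w d" for x
      proof (rule onorm_bound)
        fix v
        have "norm (grad \<rho> x - grad \<rho> w) \<le> e"
          using d(2)[of x w] that by (simp add: dist_commute dist_norm norm_minus_commute)
        then have "norm ((grad \<rho> x - grad \<rho> w) \<bullet> v) \<le> e * norm v"
          by (metis Cauchy_Schwarz_ineq2 mult_right_mono norm_ge_zero order_trans real_norm_def)
        then show "norm (((\<lambda>h. grad \<rho> x \<bullet> h) - (\<lambda>h. grad \<rho> w \<bullet> h)) v) \<le> e * norm v"
          by (simp add: inner_diff_left)
      qed (use assms in simp)
    qed (use d in simp)
    then show "\<bar>\<rho> (w + h) - \<rho> w - grad \<rho> w \<bullet> h\<bar> \<le> norm h * e"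
      by simp
  qed
qed

lemma integrable_conv_grad:
  fixes u :: "'a::euclidean_space \<Rightarrow> real"
  assumes \<rho>: "test_fun \<rho>" and u: "\<And>R. set_integrable lborel (cball 0 R) u"
  shows "integrable lborel (\<lambda>y. u y *\<^sub>R grad \<rho> (x - y))"
proof -
  obtain r where "r > 0" and r: "\<And>x. x \<notin> cball 0 r \<Longrightarrow> \<rho> x = 0"
    using test_fun_support[OF \<rho>] by metis
  have g0: "grad \<rho> x = 0" if "x \<notin> cball 0 r" for x
    using grad_eq_0_outside[of r \<rho> x] r that by blast
  have \<rho>c: "continuous_on UNIV (grad \<rho>)"
    using continuous_on_grad test_funD[OF \<rho>] by blast
  have "integrable lborel (\<lambda>y. (grad \<rho> (x - y) \<bullet> b) *\<^sub>R u y)" for b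
    by (rule integrable_conv[where r=r and k="\<lambda>w. grad \<rho> w \<bullet> b"])
      (use \<rho>c g0 u in \<open>auto intro!: continuous_intros\<close>)
  then have "integrable lborel (\<lambda>y. \<Sum>b\<in>Basis. ((grad \<rho> (x - y) \<bullet> b) *\<^sub>R u y) *\<^sub>R b)"
    by (intro Bochner_Integration.integrable_sum integrable_scaleR_left)
  moreover have "(\<Sum>b\<in>Basis. ((grad \<rho> (x - y) \<bullet> b) *\<^sub>R u y) *\<^sub>R b) = u y *\<^sub>R grad \<rho> (x - y)" for y
    by (subst (2) euclidean_representation[of "grad \<rho> (x - y)", symmetric])
      (simp add: scaleR_sum_right mult.commute)
  ultimately show ?thesis by simp
qed

lemma has_derivative_conv:
  fixes u :: "'a::euclidean_space \<Rightarrow> real"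
  assumes \<rho>: "test_fun \<rho>" and u: "\<And>R. set_integrable lborel (cball 0 R) u"
  shows "(conv \<rho> u has_derivative (\<lambda>h. (\<integral>y. u y *\<^sub>R grad \<rho> (x - y) \<partial>lborel) \<bullet> h)) (at x)"
  unfolding has_derivative_at_alt
proof (intro conjI allI impI bounded_linear_inner_right)
  fix e :: real assume e: "e > 0"
  obtain r where r: "r > 0" "\<And>x. x \<notin> cball 0 r \<Longrightarrow> \<rho> x = 0"
    using test_fun_support[OF \<rho>] by metis
  have \<rho>c: "continuous_on UNIV \<rho>" "continuous_on UNIV (grad \<rho>)"
    using smooth_fun_continuous continuous_on_grad test_funD[OF \<rho>] by blast+
  have g0: "grad \<rho> x = 0" if "x \<notin> cball 0 r" for x
    using grad_eq_0_outside[of r \<rho> x] r that by blast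
  \<comment> \<open>This ball contains every y with \<open>\<rho> (z - y)\<close> nonzero, for all z
    within distance 1 of x. The tolerance below is divided by I + 1 because I, the integral of |u|
    over the ball, may be 0.\<close>
  let ?S = "cball 0 (norm x + r + 1) :: 'a set"
  define I where "I = (\<integral>y. norm (indicator ?S y *\<^sub>R u y) \<partial>lborel)"
  have I: "I \<ge> 0" unfolding I_def by simp
  obtain d where d: "d > 0"
    "\<And>w h. norm h < d \<Longrightarrow> \<bar>\<rho> (w + h) - \<rho> w - grad \<rho> w \<bullet> h\<bar> \<le> norm h * (e / (I + 1))"
    using test_fun_linearization[OF \<rho>, of "e / (I + 1)"] e I by auto
  note gi = integrable_conv_grad[OF \<rho> u, of x]
  show "\<exists>d>0. \<forall>z. norm (z - x) < d \<longrightarrow>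
      norm (conv \<rho> u z - conv \<rho> u x - (\<integral>y. u y *\<^sub>R grad \<rho> (x - y) \<partial>lborel) \<bullet> (z - x)) \<le> e * norm (z - x)"
  proof (intro exI[of _ "min d 1"] conjI allI impI)
    show "min d 1 > 0" using d by simp
    fix z assume z: "norm (z - x) < min d 1"
    let ?q = "\<lambda>y. (\<rho> (z - y) - \<rho> (x - y) - grad \<rho> (x - y) \<bullet> (z - x)) * u y"
    have i1: "integrable lborel (\<lambda>y. \<rho> (w - y) * u y)" for w
      using integrable_conv[OF \<rho>c(1) r(2) u, where x=w] by simp
    have i2: "integrable lborel (\<lambda>y. (grad \<rho> (x - y) \<bullet> (z - x)) * u y)"
      using integrable_inner_left[OF gi, of "z - x"] by (simp add: mult.commute)
    have q: "?q = (\<lambda>y. \<rho> (z - y) * u y - \<rho> (x - y) * u y - (grad \<rho> (x - y) \<bullet> (z - x)) * u y)"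
      by (simp add: algebra_simps)
    have "conv \<rho> u z - conv \<rho> u x - (\<integral>y. u y *\<^sub>R grad \<rho> (x - y) \<partial>lborel) \<bullet> (z - x) = (\<integral>y. ?q y \<partial>lborel)"
      unfolding q conv_def using i1 i2 integral_inner_left[OF gi, of "z - x"]
      by (simp add: mult.commute)
    also have "norm \<dots> \<le> (\<integral>y. norm (z - x) * (e / (I + 1)) * norm (indicator ?S y *\<^sub>R u y) \<partial>lborel)"
    proof (rule Bochner_Integration.integral_norm_bound_integral)
      show "integrable lborel ?q" unfolding q using i1 i2 by simp
      show "integrable lborel (\<lambda>y. norm (z - x) * (e / (I + 1)) * norm (indicator ?S y *\<^sub>R u y))"
        using u[of "norm x + r + 1"] unfolding set_integrable_def
        by (intro integrable_mult_right integrable_norm)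
      fix y
      show "norm (?q y) \<le> norm (z - x) * (e / (I + 1)) * norm (indicator ?S y *\<^sub>R u y)"
      proof (cases "y \<in> ?S")
        case True
        have "\<bar>\<rho> (z - y) - \<rho> (x - y) - grad \<rho> (x - y) \<bullet> (z - x)\<bar> \<le> norm (z - x) * (e / (I + 1))"
          using d(2)[of "z - x" "x - y"] z by simp
        then have "\<bar>\<rho> (z - y) - \<rho> (x - y) - grad \<rho> (x - y) \<bullet> (z - x)\<bar> * \<bar>u y\<bar>
            \<le> norm (z - x) * (e / (I + 1)) * \<bar>u y\<bar>" by (rule mult_right_mono) simp
        then show ?thesis using True by (simp add: abs_mult)
      next
        case False
        have n: "norm y > norm x + r + 1" using False by simp
        have "norm y \<le> norm (z - y) + norm (z - x) + norm x"
          using norm_triangle_ineq[of "y - z" "z"] norm_triangle_ineq[of "z - x" x]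
          by (simp add: norm_minus_commute)
        then have "\<rho> (z - y) = 0" using n z by (intro r(2)) auto
        moreover have "norm y \<le> norm (x - y) + norm x"
          using norm_triangle_ineq[of "y - x" x] by (simp add: norm_minus_commute)
        then have "x - y \<notin> cball 0 r" using n by auto
        ultimately show ?thesis using r(2) g0 e I by simp
      qed
    qed
    also have "\<dots> = norm (z - x) * (e / (I + 1)) * I"
      unfolding I_def by simp
    also have "\<dots> \<le> e * norm (z - x)"
    proof -
      have "e * (I / (I + 1)) \<le> e * 1"
        using e I by (intro mult_left_mono) auto
      then have "norm (z - x) * (e * (I / (I + 1))) \<le> norm (z - x) * e"
        by (intro mult_left_mono) auto
      then show ?thesis by (simp add: mult.commute)
    qed
    finally show "norm (conv \<rho> u z - conv \<rho> u x - (\<integral>y. u y *\<^sub>R grad \<rho> (x - y) \<partial>lborel) \<bullet> (z - x)) \<le> e * norm (z - x)" .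
  qed
qed

lemma pder_conv:
  fixes u :: "'a::euclidean_space \<Rightarrow> real"
  assumes \<rho>: "test_fun \<rho>" and u: "\<And>R. set_integrable lborel (cball 0 R) u" and b: "b \<in> Basis"
  shows "test_fun (pder \<rho> [b])" "pder (conv \<rho> u) [b] = conv (pder \<rho> [b]) u"
proof -
  obtain r where "r > 0" and r: "\<And>x. x \<notin> cball 0 r \<Longrightarrow> \<rho> x = 0"
    using test_fun_support[OF \<rho>] by metis
  have g0: "grad \<rho> x = 0" if "x \<notin> cball 0 r" for x
    using grad_eq_0_outside[of r \<rho> x] r that by blast
  show "test_fun (pder \<rho> [b])"
    using \<rho> b g0 smooth_fun_iff[of \<rho>] test_funD
    by (intro test_funI[where R=r]) (auto simp del: pder.simps simp: grad_inner_Basis[OF b, symmetric])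
  have \<rho>c: "continuous_on UNIV (grad \<rho>)"
    using continuous_on_grad test_funD[OF \<rho>] by blast
  show "pder (conv \<rho> u) [b] = conv (pder \<rho> [b]) u"
  proof
    fix x
    have "pder (conv \<rho> u) [b] x = (\<integral>y. u y *\<^sub>R grad \<rho> (x - y) \<partial>lborel) \<bullet> b"
      unfolding pder_single_eqI[OF has_derivative_conv[OF \<rho> u]] ..
    also have "\<dots> = (\<integral>y. pder \<rho> [b] (x - y) *\<^sub>R u y \<partial>lborel)"
      unfolding integral_inner_left[OF integrable_conv_grad[OF \<rho> u], symmetric]
      by (simp del: pder.simps add: grad_inner_Basis[OF b] mult.commute)
    finally show "pder (conv \<rho> u) [b] x = conv (pder \<rho> [b]) u x"
      by (simp add: conv_def)
  qed
qed

text \<open>The convolutions of \<open>u\<close> with all test functions are closed under partials,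
  as derivatives fall on the kernel; they are the class for
  \<open>smooth_fun_coinduct\<close>.\<close>

lemma smooth_fun_conv:
  fixes u :: "'a::euclidean_space \<Rightarrow> real"
  assumes "test_fun \<rho>" and u: "\<And>R. set_integrable lborel (cball 0 R) u"
  shows "smooth_fun (conv \<rho> u)"
proof (rule smooth_fun_coinduct[where S="{conv \<rho> u | \<rho>. test_fun \<rho>}"])
  show "conv \<rho> u \<in> {conv \<rho> u | \<rho>. test_fun \<rho>}" using assms by blast
  fix g assume "g \<in> {conv \<rho> u | \<rho>. test_fun \<rho>}"
  then obtain \<rho> where \<rho>: "test_fun \<rho>" "g = conv \<rho> u" by blast
  show "g differentiable (at x)" for x
    using has_derivative_conv[OF \<rho>(1) u] unfolding \<rho>(2) differentiable_def by blast
  show "pder g [b] \<in> {conv \<rho> u | \<rho>. test_fun \<rho>}" if "b \<in> Basis" for b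
    using pder_conv[OF \<rho>(1) u that] \<rho>(2) by blast
qed

text \<open>Test the weak gradient with the reflected kernel \<open>\<rho> (x - y)\<close> as a
  function of y: the sign produced by the reflection cancels the one from integration by
  parts.\<close>

lemma grad_conv:
  fixes u :: "'a::euclidean_space \<Rightarrow> real"
  assumes \<rho>: "test_fun \<rho>" "\<And>x. test_fun (\<lambda>y. \<rho> (x - y))"
    and u: "\<And>R. set_integrable lborel (cball 0 R) u" and g: "\<And>R. set_integrable lborel (cball 0 R) g"
    and ug: "weak_grad u g"
  shows "grad (conv \<rho> u) x = conv \<rho> g x"
proof (rule euclidean_eqI)
  fix b :: 'a assume b: "b \<in> Basis"
  obtain r where "r > 0" and r: "\<And>x. x \<notin> cball 0 r \<Longrightarrow> \<rho> x = 0"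
    using test_fun_support[OF \<rho>(1)] by metis
  have gr: "grad (\<lambda>y. \<rho> (x - y)) y = - grad \<rho> (x - y)" for y
  proof (rule grad_eqI)
    have d: "((\<lambda>y. x - y) has_derivative (\<lambda>h. - h)) (at y)"
      by (auto intro!: derivative_eq_intros)
    show "((\<lambda>y. \<rho> (x - y)) has_derivative (\<lambda>h. - grad \<rho> (x - y) \<bullet> h)) (at y)"
      using has_derivative_compose[OF d has_derivative_grad[OF smooth_fun_differentiable[OF test_funD[OF \<rho>(1)]]]]
      by simp
  qed
  have i: "integrable lborel (\<lambda>y. \<rho> (x - y) *\<^sub>R g y)"
    using integrable_conv[OF smooth_fun_continuous[OF test_funD[OF \<rho>(1)]] r g] by blast
  have "grad (conv \<rho> u) x \<bullet> b = conv (pder \<rho> [b]) u x"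
    using pder_conv(2)[OF \<rho>(1) u b] grad_inner_Basis[OF b] by metis
  also have "\<dots> = - (\<integral>y. u y * (grad (\<lambda>y. \<rho> (x - y)) y \<bullet> b) \<partial>lborel)"
    unfolding gr conv_def by (simp del: pder.simps add: grad_inner_Basis[OF b] mult.commute)
  also have "\<dots> = (\<integral>y. (g y \<bullet> b) * \<rho> (x - y) \<partial>lborel)"
    using ug \<rho>(2)[of x] b unfolding weak_grad_def by simp
  also have "\<dots> = conv \<rho> g x \<bullet> b"
    unfolding conv_def integral_inner_left[OF i, symmetric] by (simp add: mult.commute)
  finally show "grad (conv \<rho> u) x \<bullet> b = conv \<rho> g x \<bullet> b" .
qed

subsection \<open>The standard mollifiers\<close>

text \<open>The radius 1 / \<open>Suc n\<close> never exceeds 1, so a margin of 1 around a ball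
  serves all n at once.\<close>

definition moll :: "nat \<Rightarrow> 'a::euclidean_space \<Rightarrow> real" where
  "moll n x = bump 1 (1 / Suc n) 0 x / (\<integral>y. bump 1 (1 / Suc n) (0::'a) y \<partial>lborel)"

lemma bump_nonneg: "0 \<le> bump m r z x" and bump_le_1: "bump m r z x \<le> 1"
  by (simp_all add: bump_def flat_1_bounds)

lemma integrable_test_fun:
  assumes "test_fun f"
  shows "integrable lborel f"
proof -
  obtain r where "r > 0" and r: "\<And>x. x \<notin> cball 0 r \<Longrightarrow> f x = 0"
    using test_fun_support[OF assms] by metis
  have c: "continuous_on UNIV f"
    using smooth_fun_continuous[OF test_funD[OF assms]] .
  obtain B where "B > 0" "\<And>x. norm (f x) \<le> B"
    using bounded_continuous_support[OF c r] by metis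
  then show ?thesis
    using integrable_bounded_support[of f B r "\<lambda>_. 1::real"] borel_measurable_continuous_onI[OF c] r
      set_integrable_const_cball by auto
qed

lemma bump_integral_pos:
  assumes "r > 0" "m > 0"
  shows "0 < (\<integral>y. bump m r (z::'a::euclidean_space) y \<partial>lborel)"
proof -
  have "(\<integral>y. bump m r z y \<partial>lborel) \<noteq> 0"
  proof
    assume "(\<integral>y. bump m r z y \<partial>lborel) = 0"
    then have "AE y in lborel. bump m r z y = 0"
      using integral_nonneg_eq_0_iff_AE[OF integrable_test_fun[OF test_fun_bump[OF assms(1)]], of m z]
      by (simp add: bump_nonneg)
    then have "AE y in lborel. y \<notin> ball z r"
      by (rule AE_mp) (use bump_pos[OF assms(1) _ assms(2)] in \<open>auto simp: dist_norm norm_minus_commute intro!: AE_I2\<close>, force)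
    then have "ball z r \<in> null_sets lborel"
      using AE_iff_null_sets[of "ball z r" lborel] by simp
    then have "measure lborel (ball z r) = 0"
      by (auto simp: null_sets_def measure_def)
    then show False using assms by simp
  qed
  moreover have "(\<integral>y. bump m r z y \<partial>lborel) \<ge> 0"
    using bump_nonneg by (intro Bochner_Integration.integral_nonneg) auto
  ultimately show ?thesis by simp
qed

lemma test_fun_cmult: "test_fun f \<Longrightarrow> test_fun (\<lambda>x. c * f x)"
  by (rule test_fun_mult[OF smooth_fun_const])

lemma bump_shift: "bump m r 0 (x - y) = bump m r x y"
  by (simp add: bump_def inner_diff_left inner_diff_right inner_commute algebra_simps)

lemma test_fun_moll: "test_fun (moll n)"
  unfolding moll_def[abs_def] divide_inverse mult.commute[of _ "inverse _"]
  by (intro test_fun_cmult test_fun_bump) simp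

lemma test_fun_moll_shift: "test_fun (\<lambda>y. moll n (x - y))"
  unfolding moll_def[abs_def] divide_inverse mult.commute[of _ "inverse _"] bump_shift
  by (intro test_fun_cmult test_fun_bump) simp

lemma moll_nonneg: "moll n x \<ge> 0"
  unfolding moll_def using bump_nonneg by (intro divide_nonneg_nonneg Bochner_Integration.integral_nonneg) auto

lemma moll_support: "norm x \<ge> 1 / Suc n \<Longrightarrow> moll n x = 0"
  unfolding moll_def by (subst bump_eq_0) auto

lemma moll_integral: "(\<integral>x. moll n (x::'a::euclidean_space) \<partial>lborel) = 1"
  unfolding moll_def using bump_integral_pos[of "1 / Suc n" 1 "0::'a"] by simp

lemma moll_continuous: "continuous_on S (moll n)"
  by (rule smooth_fun_continuous[OF test_funD[OF test_fun_moll]])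

lemma moll_measurable [measurable]: "moll n \<in> borel_measurable borel"
  by (rule borel_measurable_continuous_onI[OF moll_continuous])

lemma moll_nn_integral: "(\<integral>\<^sup>+x. ennreal (moll n (x::'a::euclidean_space)) \<partial>lborel) = 1"
  using nn_integral_eq_integral[OF integrable_test_fun[OF test_fun_moll]] moll_nonneg moll_integral
  by (metis (mono_tags, lifting) AE_I2 ennreal_1)

lemma moll_outside: "x \<notin> cball 0 1 \<Longrightarrow> moll n x = 0"
  by (rule moll_support) (auto intro: order_trans[of _ 1])

lemma integrable_moll_conv:
  fixes U :: "'a::euclidean_space \<Rightarrow> 'b::{banach, second_countable_topology}"
  assumes "\<And>R. set_integrable lborel (cball 0 R) U"
  shows "integrable lborel (\<lambda>y. moll n (x - y) *\<^sub>R U y)"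
  by (rule integrable_conv[OF moll_continuous moll_outside assms])

lemma conv_measurable [measurable]:
  fixes U :: "'a::euclidean_space \<Rightarrow> 'b::{banach, second_countable_topology}"
  assumes [measurable]: "U \<in> borel_measurable borel"
  shows "conv (moll n) U \<in> borel_measurable borel"
  unfolding conv_def[abs_def] by (rule lborel.borel_measurable_lebesgue_integral) measurable

text \<open>Jensen's inequality, obtained by expanding the average of \<open>(norm (U - m))\<^sup>2\<close> about the mean \<open>m\<close>.\<close>
lemma norm_conv_square_le:
  fixes U :: "'a::euclidean_space \<Rightarrow> 'b::euclidean_space"
  assumes U: "\<And>R. set_integrable lborel (cball 0 R) U"
    and U2: "\<And>R. set_integrable lborel (cball 0 R) (\<lambda>x. (norm (U x))\<^sup>2)"
  shows "(norm (conv (moll n) U x))\<^sup>2 \<le> conv (moll n) (\<lambda>x. (norm (U x))\<^sup>2) x"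
proof -
  define m where "m = conv (moll n) U x"
  have 1: "integrable lborel (\<lambda>y. moll n (x - y) * (norm (U y))\<^sup>2)"
    using integrable_moll_conv[OF U2, of n x] by simp
  have 2: "integrable lborel (\<lambda>y. moll n (x - y) *\<^sub>R U y)"
    using integrable_moll_conv[OF U, of n x] .
  then have 3: "integrable lborel (\<lambda>y. 2 * ((moll n (x - y) *\<^sub>R U y) \<bullet> m))"
    by (intro integrable_mult_right integrable_inner_left)
  have 4: "integrable lborel (\<lambda>y. moll n (x - y) * (norm m)\<^sup>2)"
    by (intro integrable_mult_left integrable_test_fun test_fun_moll_shift)
  have "0 \<le> (\<integral>y. moll n (x - y) * (norm (U y - m))\<^sup>2 \<partial>lborel)"
    by (intro Bochner_Integration.integral_nonneg) (simp add: moll_nonneg)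
  also have "\<dots> = (\<integral>y. moll n (x - y) * (norm (U y))\<^sup>2 - 2 * ((moll n (x - y) *\<^sub>R U y) \<bullet> m)
      + moll n (x - y) * (norm m)\<^sup>2 \<partial>lborel)"
    by (simp add: power2_norm_eq_inner inner_diff_left inner_diff_right inner_commute algebra_simps)
  also have "\<dots> = (\<integral>y. moll n (x - y) * (norm (U y))\<^sup>2 \<partial>lborel)
      - (\<integral>y. 2 * ((moll n (x - y) *\<^sub>R U y) \<bullet> m) \<partial>lborel) + (\<integral>y. moll n (x - y) * (norm m)\<^sup>2 \<partial>lborel)"
    using 1 3 4 by (subst Bochner_Integration.integral_add, simp, simp, subst Bochner_Integration.integral_diff) simp_all
  also have "(\<integral>y. moll n (x - y) * (norm (U y))\<^sup>2 \<partial>lborel) = conv (moll n) (\<lambda>x. (norm (U x))\<^sup>2) x"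
    by (simp add: conv_def)
  also have "(\<integral>y. 2 * ((moll n (x - y) *\<^sub>R U y) \<bullet> m) \<partial>lborel) = 2 * (m \<bullet> m)"
    unfolding integral_mult_right_zero integral_inner_left[OF 2] by (simp add: m_def conv_def)
  also have "(\<integral>y. moll n (x - y) * (norm m)\<^sup>2 \<partial>lborel) = m \<bullet> m"
    using lborel_integral_reflect[of "moll n" x] moll_integral[of n, where ?'a='a]
    by (simp add: power2_norm_eq_inner)
  finally show ?thesis
    by (simp add: m_def power2_norm_eq_inner)
qed

lemma L1_shift_small:
  fixes V :: "'a::euclidean_space \<Rightarrow> 'b::{banach, second_countable_topology}"
  assumes "integrable lborel V" "e > 0"
  obtains d where "d > 0" "\<And>z. norm z < d \<Longrightarrow> (\<integral>x. norm (V (x - z) - V x) \<partial>lborel) < e"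
proof -
  let ?P = "\<lambda>z. (\<integral>x. norm (V (x - z) - V x) \<partial>lborel) < e"
  have "\<forall>\<^sub>F n in sequentially. ?P (z n)" if "z \<longlonglongrightarrow> 0" for z
    using L1_shift_continuous_integrable[OF assms(1)] that order_tendstoD(2)[OF _ assms(2)]
    unfolding L1_shift_continuous_def by blast
  then have "eventually ?P (inf (nhds 0) (principal UNIV))"
    by (intro sequentially_imp_eventually_nhds_within) auto
  then have "eventually ?P (nhds 0)" by simp
  then show ?thesis
    using that unfolding eventually_nhds_metric by auto
qed

text \<open>The convolution differs from V by an average of V(x - z) - V(x) over small z; exchanging
  the two integrals leaves an average of translation errors. Nonnegative integrals are used because
  integrability of the difference is itself deduced from this bound.\<close>

lemma conv_L1_bound:
  fixes V :: "'a::euclidean_space \<Rightarrow> 'b::{banach, second_countable_topology}"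
  assumes V: "integrable lborel V"
    and e: "\<And>z. norm z < 1 / Suc n \<Longrightarrow> (\<integral>x. norm (V (x - z) - V x) \<partial>lborel) \<le> e"
  shows "(\<integral>\<^sup>+x. norm (conv (moll n) V x - V x) \<partial>lborel) \<le> ennreal e"
proof -
  have [measurable]: "V \<in> borel_measurable borel"
    using V by (auto dest: borel_measurable_integrable)
  have "set_integrable lborel (cball 0 R) V" for R
    using V unfolding set_integrable_def by (intro integrable_mult_indicator) auto
  note VR = integrable_moll_conv[OF this, of n]
  have int: "integrable lborel (\<lambda>z. moll n z *\<^sub>R V (x - z))" for x
  proof -
    have "integrable (distr lborel borel (\<lambda>z. x - z)) (\<lambda>y. moll n (x - y) *\<^sub>R V y)"
      unfolding distr_lborel_reflect by (rule VR)
    then show ?thesis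
      by (subst (asm) integrable_distr_eq) auto
  qed
  have int2: "integrable lborel (\<lambda>z::'a. moll n z *\<^sub>R V x)" for x
    by (intro integrable_scaleR_left integrable_test_fun test_fun_moll)
  have conv_eq: "conv (moll n) V x - V x = (\<integral>z. moll n z *\<^sub>R (V (x - z) - V x) \<partial>lborel)" for x
  proof -
    have "conv (moll n) V x = (\<integral>z. moll n z *\<^sub>R V (x - z) \<partial>lborel)"
      unfolding conv_def using lborel_integral_reflect[of "\<lambda>y. moll n (x - y) *\<^sub>R V y" x] by simp
    moreover have "V x = (\<integral>z. moll n (z::'a) *\<^sub>R V x \<partial>lborel)"
      by (subst integral_scaleR_left) (simp_all add: integrable_test_fun test_fun_moll moll_integral)
    ultimately have "conv (moll n) V x - V x
        = (\<integral>z. moll n z *\<^sub>R V (x - z) \<partial>lborel) - (\<integral>z. moll n (z::'a) *\<^sub>R V x \<partial>lborel)" by simp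
    then show ?thesis
      using int[of x] int2[of x] by (simp add: scaleR_diff_right)
  qed
  have "(\<integral>\<^sup>+x. norm (conv (moll n) V x - V x) \<partial>lborel)
      \<le> (\<integral>\<^sup>+x. (\<integral>\<^sup>+z. ennreal (moll n z) * norm (V (x - z) - V x) \<partial>lborel) \<partial>lborel)"
  proof (rule nn_integral_mono)
    fix x
    have "ennreal (norm (conv (moll n) V x - V x)) \<le> (\<integral>\<^sup>+z. norm (moll n z *\<^sub>R (V (x - z) - V x)) \<partial>lborel)"
      unfolding conv_eq using int[of x] int2[of x]
      by (intro integral_norm_bound_ennreal) (simp add: scaleR_diff_right)
    also have "\<dots> = (\<integral>\<^sup>+z. ennreal (moll n z) * norm (V (x - z) - V x) \<partial>lborel)"
      by (intro nn_integral_cong) (simp add: moll_nonneg ennreal_mult)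
    finally show "ennreal (norm (conv (moll n) V x - V x))
        \<le> (\<integral>\<^sup>+z. ennreal (moll n z) * norm (V (x - z) - V x) \<partial>lborel)" .
  qed
  also have "\<dots> = (\<integral>\<^sup>+z. (\<integral>\<^sup>+x. ennreal (moll n z) * norm (V (x - z) - V x) \<partial>lborel) \<partial>lborel)"
    by (rule lborel_pair.Fubini') measurable
  also have "\<dots> \<le> (\<integral>\<^sup>+z. ennreal (moll n z) * ennreal e \<partial>(lborel :: 'a measure))"
  proof (rule nn_integral_mono)
    fix z :: 'a
    have "(\<integral>\<^sup>+x. ennreal (moll n z) * norm (V (x - z) - V x) \<partial>lborel)
        = ennreal (moll n z) * (\<integral>\<^sup>+x. norm (V (x - z) - V x) \<partial>lborel)"
      by (rule nn_integral_cmult) measurable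
    also have "(\<integral>\<^sup>+x. norm (V (x - z) - V x) \<partial>lborel) = ennreal (\<integral>x. norm (V (x - z) - V x) \<partial>lborel)"
      using V integrable_lborel_shift(1)[OF V, of z] by (intro nn_integral_eq_integral) auto
    also have "ennreal (moll n z) * \<dots> \<le> ennreal (moll n z) * ennreal e"
    proof (cases "norm z < 1 / Suc n")
      case True
      then show ?thesis using e[of z] by (intro mult_left_mono ennreal_leI) auto
    next
      case False
      then show ?thesis using moll_support[of n z] by simp
    qed
    finally show "(\<integral>\<^sup>+x. ennreal (moll n z) * norm (V (x - z) - V x) \<partial>lborel)
        \<le> ennreal (moll n z) * ennreal e" .
  qed
  also have "\<dots> = ennreal e"
    using moll_nn_integral[of n, where ?'a='a] by (simp add: nn_integral_multc)
  finally show ?thesis .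
qed

lemma conv_moll_tendsto_L1:
  fixes V :: "'a::euclidean_space \<Rightarrow> 'b::{banach, second_countable_topology}"
  assumes V: "integrable lborel V"
  shows "integrable lborel (conv (moll n) V)"
    and "(\<lambda>n. \<integral>x. norm (conv (moll n) V x - V x) \<partial>lborel) \<longlonglongrightarrow> 0"
proof -
  have [measurable]: "V \<in> borel_measurable borel"
    using V by (auto dest: borel_measurable_integrable)
  have int: "integrable lborel (\<lambda>x. conv (moll n) V x - V x)" for n
  proof (rule integrableI_bounded)
    \<comment> \<open>A crude bound valid for every shift; it yields integrability, while the
      convergence below uses small shifts.\<close>
    have "(\<integral>x. norm (V (x - z) - V x) \<partial>lborel) \<le> 2 * (\<integral>x. norm (V x) \<partial>lborel)" for z
    proof -
      have "(\<integral>x. norm (V (x - z) - V x) \<partial>lborel) \<le> (\<integral>x. norm (V (x - z)) + norm (V x) \<partial>lborel)"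
        using V integrable_lborel_shift(1)[OF V, of z]
        by (intro integral_mono) (simp_all add: norm_triangle_ineq4)
      also have "\<dots> = 2 * (\<integral>x. norm (V x) \<partial>lborel)"
        using V integrable_lborel_shift(1)[OF V, of z]
          integrable_lborel_shift(2)[OF integrable_norm[OF V], of z] by simp
      finally show ?thesis .
    qed
    then have "(\<integral>\<^sup>+x. norm (conv (moll n) V x - V x) \<partial>lborel) \<le> ennreal (2 * (\<integral>x. norm (V x) \<partial>lborel))"
      by (intro conv_L1_bound[OF V])
    then show "(\<integral>\<^sup>+x. norm (conv (moll n) V x - V x) \<partial>lborel) < \<infinity>"
      by (auto simp: less_top[symmetric] top_unique)
  qed measurable
  show "integrable lborel (conv (moll n) V)"
    using Bochner_Integration.integrable_add[OF int[of n] V] by simp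
  show "(\<lambda>n. \<integral>x. norm (conv (moll n) V x - V x) \<partial>lborel) \<longlonglongrightarrow> 0"
  proof (rule LIMSEQ_I)
    fix e :: real assume e: "e > 0"
    obtain d where d: "d > 0" "\<And>z. norm z < d \<Longrightarrow> (\<integral>x. norm (V (x - z) - V x) \<partial>lborel) < e / 2"
      using L1_shift_small[OF V, of "e / 2"] e by auto
    obtain N where N: "1 / Suc N < d"
      using d(1) nat_approx_posE by blast
    have "(\<integral>x. norm (conv (moll n) V x - V x) \<partial>lborel) < e" if "n \<ge> N" for n
    proof -
      have "1 / Suc n \<le> 1 / Suc N"
        using that by (simp add: field_simps)
      then have "(\<integral>\<^sup>+x. norm (conv (moll n) V x - V x) \<partial>lborel) \<le> ennreal (e / 2)"
        using N by (intro conv_L1_bound[OF V] less_imp_le d(2)) linarith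
      then have "ennreal (\<integral>x. norm (conv (moll n) V x - V x) \<partial>lborel) \<le> ennreal (e / 2)"
        by (subst nn_integral_eq_integral[symmetric]) (use int[of n] in auto)
      then show ?thesis
        using e by (simp add: ennreal_le_iff)
    qed
    then show "\<exists>no. \<forall>n\<ge>no. norm ((\<integral>x. norm (conv (moll n) V x - V x) \<partial>lborel) - 0) < e"
      by (auto intro!: exI[of _ N])
  qed
qed

text \<open>On the ball of radius R the mollifiers see only values within radius R + 1, so
  \<open>U\<close> may be cut off there and the global L1 result applied. L1 convergence then yields
  a subsequence converging almost everywhere.\<close>

lemma conv_moll_local_convergence:
  fixes U :: "'a::euclidean_space \<Rightarrow> 'b::{banach, second_countable_topology}"
  assumes [measurable]: "U \<in> borel_measurable borel" and U: "\<And>R. set_integrable lborel (cball 0 R) U"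
  obtains s where "strict_mono s"
    "AE x in lborel. x \<in> cball 0 R \<longrightarrow> (\<lambda>n. conv (moll (s n)) U x) \<longlonglongrightarrow> U x"
    "\<And>n. set_integrable lborel (cball 0 R) (conv (moll n) U)"
    "(\<lambda>n. \<integral>x. indicator (cball 0 R) x * norm (conv (moll (s n)) U x - U x) \<partial>lborel) \<longlonglongrightarrow> 0"
proof -
  define V where "V x = indicator (cball 0 (R + 1)) x *\<^sub>R U x" for x
  have V: "integrable lborel V"
    using U[of "R + 1"] unfolding set_integrable_def V_def .
  have eq: "conv (moll n) U x = conv (moll n) V x" "U x = V x" if "x \<in> cball 0 R" for n x
  proof -
    have e: "moll n (x - y) *\<^sub>R U y = moll n (x - y) *\<^sub>R V y" for y
    proof (cases "y \<in> cball 0 (R + 1)")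
      case False
      then have "x - y \<notin> cball 0 1"
        using that norm_triangle_ineq2[of y x] by (auto simp: norm_minus_commute)
      then show ?thesis by (simp add: moll_outside)
    qed (simp add: V_def)
    show "conv (moll n) U x = conv (moll n) V x" unfolding conv_def e ..
    show "U x = V x" using that by (simp add: V_def)
  qed
  note c = conv_moll_tendsto_L1[OF V]
  have "integrable lborel (\<lambda>x. conv (moll n) V x - V x)" for n
    using c(1) V by simp
  then obtain s where s: "strict_mono s" "AE x in lborel. (\<lambda>n. conv (moll (s n)) V x - V x) \<longlonglongrightarrow> 0"
    using tendsto_L1_AE_subseq[OF _ c(2)] by blast
  show ?thesis
  proof
    show "strict_mono s" by (rule s)
    show "AE x in lborel. x \<in> cball 0 R \<longrightarrow> (\<lambda>n. conv (moll (s n)) U x) \<longlonglongrightarrow> U x"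
      using s(2) by (rule AE_mp) (auto simp: eq LIM_zero_iff simp del: mem_cball intro!: AE_I2)
    show "set_integrable lborel (cball 0 R) (conv (moll n) U)" for n
    proof -
      have "set_integrable lborel (cball 0 R) (conv (moll n) V)"
        using c(1)[of n] unfolding set_integrable_def by (intro integrable_mult_indicator) auto
      moreover have "(\<lambda>x. indicator (cball 0 R) x *\<^sub>R conv (moll n) V x) = (\<lambda>x. indicator (cball 0 R) x *\<^sub>R conv (moll n) U x)"
        using eq by (auto simp: fun_eq_iff indicator_def)
      ultimately show ?thesis unfolding set_integrable_def by simp
    qed
    let ?f = "\<lambda>n. \<integral>x. indicator (cball 0 R) x * norm (conv (moll (s n)) U x - U x) \<partial>lborel"
    have le: "?f n \<le> (\<integral>x. norm (conv (moll (s n)) V x - V x) \<partial>lborel)" for n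
      using eq c(1) V by (intro integral_mono_AE') (auto simp: indicator_def simp del: mem_cball)
    have lim: "(\<lambda>n. \<integral>x. norm (conv (moll (s n)) V x - V x) \<partial>lborel) \<longlonglongrightarrow> 0"
      using LIMSEQ_subseq_LIMSEQ[OF c(2) s(1)] by (simp add: o_def)
    show "?f \<longlonglongrightarrow> 0"
      by (rule tendsto_sandwich[OF _ _ tendsto_const lim]) (use le in \<open>auto intro!: Bochner_Integration.integral_nonneg\<close>)
  qed
qed

section \<open>Homogeneity of the anisotropic norm\<close>

text \<open>For nonzero \<xi> this is the Hessian of F^2 / 2 at \<xi>, applied to p in both
  slots.\<close>

definition quad :: "('a::euclidean_space \<Rightarrow> real) \<Rightarrow> 'a \<Rightarrow> 'a \<Rightarrow> real" where
  "quad F \<xi> p = (\<Sum>i\<in>Basis. \<Sum>j\<in>Basis.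
      (Fgrad F \<xi> \<bullet> i) * (Fgrad F \<xi> \<bullet> j) * (p \<bullet> i) * (p \<bullet> j)
      + F \<xi> * Fhess F \<xi> i j * (p \<bullet> i) * (p \<bullet> j))"

definition hess_form :: "('a::euclidean_space \<Rightarrow> real) \<Rightarrow> 'a \<Rightarrow> 'a \<Rightarrow> 'a \<Rightarrow> real" where
  "hess_form F \<xi> p q = (\<Sum>i\<in>Basis. \<Sum>j\<in>Basis. Fhess F \<xi> i j * (p \<bullet> i) * (q \<bullet> j))"

lemma quad_eq: "quad F \<xi> p = (Fgrad F \<xi> \<bullet> p)\<^sup>2 + F \<xi> * hess_form F \<xi> p p"
proof -
  have "(Fgrad F \<xi> \<bullet> p)\<^sup>2 = (\<Sum>i\<in>Basis. (Fgrad F \<xi> \<bullet> i) * (p \<bullet> i)) * (\<Sum>j\<in>Basis. (Fgrad F \<xi> \<bullet> j) * (p \<bullet> j))"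
    unfolding power2_eq_square by (simp add: euclidean_inner[of "Fgrad F \<xi>" p])
  also have "\<dots> = (\<Sum>i\<in>Basis. \<Sum>j\<in>Basis. (Fgrad F \<xi> \<bullet> i) * (Fgrad F \<xi> \<bullet> j) * (p \<bullet> i) * (p \<bullet> j))"
    unfolding sum_product by (intro sum.cong refl) (simp add: mult_ac)
  finally show ?thesis
    unfolding quad_def hess_form_def by (simp add: sum.distrib sum_distrib_left mult.assoc)
qed

lemma hess_form_add:
  "hess_form F \<xi> (a *\<^sub>R p + q) r = a * hess_form F \<xi> p r + hess_form F \<xi> q r"
  "hess_form F \<xi> r (a *\<^sub>R p + q) = a * hess_form F \<xi> r p + hess_form F \<xi> r q"
  unfolding hess_form_def
  by (simp_all add: inner_simps algebra_simps sum.distrib sum_distrib_left)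

lemma unit_decomp:
  fixes \<xi> :: "'a::real_normed_vector"
  assumes "\<xi> \<noteq> 0"
  obtains t w where "t > 0" "\<xi> = t *\<^sub>R w" "norm w = 1"
  using assms that[of "norm \<xi>" "\<xi> /\<^sub>R norm \<xi>"] by simp

lemma sum_inner_Basis_mult:
  fixes c :: "'a::euclidean_space \<Rightarrow> real"
  assumes "i \<in> Basis"
  shows "(\<Sum>k\<in>Basis. (i \<bullet> k) * c k) = c i"
proof -
  have "(\<Sum>k\<in>Basis. (i \<bullet> k) * c k) = (\<Sum>k\<in>Basis. if k = i then c i else 0)"
    using assms by (intro sum.cong) (auto simp: inner_Basis)
  then show ?thesis using assms by simp
qed

context
  fixes F :: "'a::euclidean_space \<Rightarrow> real"
  assumes adm: "admissible_F F"
begin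

lemma F_differentiable: "\<xi> \<noteq> 0 \<Longrightarrow> F differentiable (at \<xi>)"
  and Fgrad_differentiable: "\<xi> \<noteq> 0 \<Longrightarrow> j \<in> Basis \<Longrightarrow> (\<lambda>\<eta>. Fgrad F \<eta> \<bullet> j) differentiable (at \<xi>)"
  and Fhess_continuous: "i \<in> Basis \<Longrightarrow> j \<in> Basis \<Longrightarrow> continuous_on (UNIV - {0}) (\<lambda>\<xi>. Fhess F \<xi> i j)"
  and F_scale: "F (t *\<^sub>R \<xi>) = \<bar>t\<bar> * F \<xi>"
  and F_nonneg: "F \<xi> \<ge> 0"
  and F_bounds: "\<exists>a b. 0 < a \<and> a \<le> b \<and> (\<forall>\<xi>. a * norm \<xi> \<le> F \<xi> \<and> F \<xi> \<le> b * norm \<xi>)"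
  using adm unfolding admissible_F_def by blast+

lemma F_0: "F 0 = 0"
  using F_scale[of 0 0] by simp

lemma F_has_derivative: "\<xi> \<noteq> 0 \<Longrightarrow> (F has_derivative (\<lambda>h. Fgrad F \<xi> \<bullet> h)) (at \<xi>)"
  using has_derivative_grad[OF F_differentiable] by (simp add: Fgrad_def)

lemma Fgrad_scale:
  assumes "t > 0"
  shows "Fgrad F (t *\<^sub>R \<xi>) = Fgrad F \<xi>"
proof (cases "\<xi> = 0")
  case False
  have s: "((\<lambda>\<eta>. t *\<^sub>R \<eta>) has_derivative (\<lambda>h. t *\<^sub>R h)) (at \<xi>)"
    by (auto intro!: derivative_eq_intros)
  have "((\<lambda>\<eta>. F (t *\<^sub>R \<eta>)) has_derivative (\<lambda>h. Fgrad F (t *\<^sub>R \<xi>) \<bullet> (t *\<^sub>R h))) (at \<xi>)"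
    using has_derivative_compose[OF s F_has_derivative] False assms by auto
  moreover have "((\<lambda>\<eta>. F (t *\<^sub>R \<eta>)) has_derivative (\<lambda>h. t * (Fgrad F \<xi> \<bullet> h))) (at \<xi>)"
    unfolding F_scale using assms F_has_derivative[OF False] by (auto intro!: derivative_eq_intros)
  ultimately have "(\<lambda>h. Fgrad F (t *\<^sub>R \<xi>) \<bullet> (t *\<^sub>R h)) = (\<lambda>h. t * (Fgrad F \<xi> \<bullet> h))"
    by (rule has_derivative_unique)
  then have "\<And>h. Fgrad F (t *\<^sub>R \<xi>) \<bullet> h = Fgrad F \<xi> \<bullet> h"
    using assms by (simp add: fun_eq_iff)
  then show ?thesis
    using vector_eq_rdot by blast
qed simp

lemma Fgrad_Euler: "Fgrad F \<xi> \<bullet> \<xi> = F \<xi>"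
proof (cases "\<xi> = 0")
  case False
  have s: "((\<lambda>t::real. t *\<^sub>R \<xi>) has_derivative (\<lambda>h. h *\<^sub>R \<xi>)) (at 1)"
    by (auto intro!: derivative_eq_intros)
  have "((\<lambda>t. F (t *\<^sub>R \<xi>)) has_derivative (\<lambda>h. Fgrad F \<xi> \<bullet> (h *\<^sub>R \<xi>))) (at 1)"
    using has_derivative_compose[OF s, of F "\<lambda>h. Fgrad F \<xi> \<bullet> h"] F_has_derivative[OF False] by simp
  then have "((\<lambda>t. t * F \<xi>) has_derivative (\<lambda>h. Fgrad F \<xi> \<bullet> (h *\<^sub>R \<xi>))) (at 1)"
    by (rule has_derivative_transform_within_open[where s="{0<..}"]) (auto simp: F_scale)
  moreover have "((\<lambda>t. t * F \<xi>) has_derivative (\<lambda>h. h * F \<xi>)) (at 1)"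
    by (auto intro!: derivative_eq_intros)
  ultimately have "(\<lambda>h. Fgrad F \<xi> \<bullet> (h *\<^sub>R \<xi>)) = (\<lambda>h. h * F \<xi>)"
    by (rule has_derivative_unique)
  from fun_cong[OF this, of 1] show ?thesis by simp
qed (simp add: F_0)

lemma Fgrad_has_derivative:
  assumes "\<xi> \<noteq> 0" "j \<in> Basis"
  shows "((\<lambda>\<eta>. Fgrad F \<eta> \<bullet> j) has_derivative (\<lambda>h. \<Sum>i\<in>Basis. (h \<bullet> i) * Fhess F \<xi> i j)) (at \<xi>)"
proof -
  let ?D = "frechet_derivative (\<lambda>\<eta>. Fgrad F \<eta> \<bullet> j) (at \<xi>)"
  note d = Fgrad_differentiable[OF assms]
  have "?D h = (\<Sum>i\<in>Basis. (h \<bullet> i) * Fhess F \<xi> i j)" for h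
  proof -
    have "?D h = ?D (\<Sum>i\<in>Basis. (h \<bullet> i) *\<^sub>R i)"
      by (simp add: euclidean_representation)
    also have "\<dots> = (\<Sum>i\<in>Basis. (h \<bullet> i) * ?D i)"
      using linear_frechet_derivative[OF d] by (simp add: linear_sum linear_cmul)
    finally show ?thesis using assms by (simp add: Fhess_def)
  qed
  then have "?D = (\<lambda>h. \<Sum>i\<in>Basis. (h \<bullet> i) * Fhess F \<xi> i j)" by auto
  then show ?thesis using d frechet_derivative_works by metis
qed

lemma Fhess_scale:
  assumes "t > 0" "i \<in> Basis" "j \<in> Basis"
  shows "t * Fhess F (t *\<^sub>R \<xi>) i j = Fhess F \<xi> i j"
proof (cases "\<xi> = 0")
  case False
  have s: "((\<lambda>\<eta>. t *\<^sub>R \<eta>) has_derivative (\<lambda>h. t *\<^sub>R h)) (at \<xi>)"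
    by (auto intro!: derivative_eq_intros)
  have "((\<lambda>\<eta>. Fgrad F (t *\<^sub>R \<eta>) \<bullet> j) has_derivative
      (\<lambda>h. \<Sum>i\<in>Basis. ((t *\<^sub>R h) \<bullet> i) * Fhess F (t *\<^sub>R \<xi>) i j)) (at \<xi>)"
    using has_derivative_compose[OF s Fgrad_has_derivative] False assms by auto
  then have "(\<lambda>h. \<Sum>i\<in>Basis. ((t *\<^sub>R h) \<bullet> i) * Fhess F (t *\<^sub>R \<xi>) i j)
      = (\<lambda>h. \<Sum>i\<in>Basis. (h \<bullet> i) * Fhess F \<xi> i j)"
    unfolding Fgrad_scale[OF assms(1)]
    by (rule has_derivative_unique[OF _ Fgrad_has_derivative[OF False assms(3)]])
  from fun_cong[OF this, of i] show ?thesis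
    using assms by (simp add: mult.assoc sum_distrib_left[symmetric] sum_inner_Basis_mult)
qed (simp add: Fhess_def)

text \<open>The gradient of F has degree 0, hence is constant along rays, and its derivative in the
  direction \<xi> vanishes.\<close>

lemma Fhess_Euler_left:
  assumes "j \<in> Basis"
  shows "(\<Sum>i\<in>Basis. (\<xi> \<bullet> i) * Fhess F \<xi> i j) = 0"
proof (cases "\<xi> = 0")
  case False
  have s: "((\<lambda>t::real. t *\<^sub>R \<xi>) has_derivative (\<lambda>h. h *\<^sub>R \<xi>)) (at 1)"
    by (auto intro!: derivative_eq_intros)
  have "((\<lambda>t. Fgrad F (t *\<^sub>R \<xi>) \<bullet> j) has_derivative
      (\<lambda>h. \<Sum>i\<in>Basis. ((h *\<^sub>R \<xi>) \<bullet> i) * Fhess F \<xi> i j)) (at 1)"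
    using has_derivative_compose[OF s, of "\<lambda>\<eta>. Fgrad F \<eta> \<bullet> j" "\<lambda>h. \<Sum>i\<in>Basis. (h \<bullet> i) * Fhess F \<xi> i j"]
      Fgrad_has_derivative[OF False assms] by simp
  then have "((\<lambda>t. Fgrad F \<xi> \<bullet> j) has_derivative
      (\<lambda>h. \<Sum>i\<in>Basis. ((h *\<^sub>R \<xi>) \<bullet> i) * Fhess F \<xi> i j)) (at (1::real))"
    by (rule has_derivative_transform_within_open[where s="{0<..}"]) (auto simp: Fgrad_scale)
  then have "(\<lambda>h::real. \<Sum>i\<in>Basis. ((h *\<^sub>R \<xi>) \<bullet> i) * Fhess F \<xi> i j) = (\<lambda>h. 0)"
    by (rule has_derivative_unique[OF _ has_derivative_const])
  from fun_cong[OF this, of 1] show ?thesis by simp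
qed (simp add: Fhess_def)

text \<open>Differentiating \<open>Fgrad_Euler\<close> in direction i yields the i-th partial of F
  on both sides and, in addition, this sum on the left.\<close>

lemma Fhess_Euler_right:
  assumes "i \<in> Basis"
  shows "(\<Sum>j\<in>Basis. Fhess F \<xi> i j * (\<xi> \<bullet> j)) = 0"
proof (cases "\<xi> = 0")
  case False
  let ?D = "\<lambda>h. \<Sum>j\<in>Basis. (Fgrad F \<xi> \<bullet> j) * (h \<bullet> j) + (\<Sum>i\<in>Basis. (h \<bullet> i) * Fhess F \<xi> i j) * (\<xi> \<bullet> j)"
  have "((\<lambda>\<eta>. \<Sum>j\<in>Basis. (Fgrad F \<eta> \<bullet> j) * (\<eta> \<bullet> j)) has_derivative ?D) (at \<xi>)"
    using Fgrad_has_derivative[OF False]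
    by (intro has_derivative_sum has_derivative_mult) (auto intro!: derivative_eq_intros)
  then have "(F has_derivative ?D) (at \<xi>)"
    by (simp add: euclidean_inner[symmetric] Fgrad_Euler)
  then have "?D = (\<lambda>h. Fgrad F \<xi> \<bullet> h)"
    by (rule has_derivative_unique[OF _ F_has_derivative[OF False]])
  from fun_cong[OF this, of i] show ?thesis
    using assms by (simp add: sum.distrib sum_inner_Basis_mult mult.commute[of "Fgrad F \<xi> \<bullet> _"])
qed simp

lemma hess_form_Euler: "hess_form F \<xi> \<xi> q = 0" "hess_form F \<xi> p \<xi> = 0"
proof -
  have "hess_form F \<xi> \<xi> q = (\<Sum>j\<in>Basis. (\<Sum>i\<in>Basis. (\<xi> \<bullet> i) * Fhess F \<xi> i j) * (q \<bullet> j))"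
    unfolding hess_form_def by (subst sum.swap) (simp add: sum_distrib_left mult_ac)
  then show "hess_form F \<xi> \<xi> q = 0"
    by (simp add: Fhess_Euler_left)
  have "hess_form F \<xi> p \<xi> = (\<Sum>i\<in>Basis. (p \<bullet> i) * (\<Sum>j\<in>Basis. Fhess F \<xi> i j * (\<xi> \<bullet> j)))"
    unfolding hess_form_def by (simp add: sum_distrib_left mult_ac)
  then show "hess_form F \<xi> p \<xi> = 0"
    by (simp add: Fhess_Euler_right)
qed

text \<open>Euler's relations remove every Hessian term in which \<xi> occupies a slot and turn the
  gradient applied to \<xi> into F. This holds for multiples of \<xi> itself, not for a mollified
  gradient.\<close>

lemma quad_expand:
  "quad F \<xi> (a *\<^sub>R \<xi> + q) = a\<^sup>2 * (F \<xi>)\<^sup>2 + 2 * a * (F \<xi> * (Fgrad F \<xi> \<bullet> q)) + quad F \<xi> q"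
  unfolding quad_eq hess_form_add hess_form_Euler
  by (simp add: inner_add_right Fgrad_Euler power2_eq_square algebra_simps)

section \<open>Measurability and uniform bounds from homogeneity\<close>

lemma Fgrad_continuous: "continuous_on (UNIV - {0}) (Fgrad F)"
  by (subst continuous_on_componentwise)
    (auto intro!: continuous_at_imp_continuous_on differentiable_imp_continuous_within Fgrad_differentiable)

lemma F_continuous: "continuous_on (UNIV - {0}) F"
  by (auto intro!: continuous_at_imp_continuous_on differentiable_imp_continuous_within F_differentiable)

text \<open>Regularity is available off the origin; at the origin \<open>F\<close>,
  \<open>Fgrad\<close> and \<open>Fhess\<close> have the value 0, so multiplication by the indicator
  of the complement changes nothing.\<close>

lemma F_measurable: "F \<in> borel_measurable borel"
  using borel_measurable_continuous_on_indicator[OF _ F_continuous]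
  by (rule measurable_cong[THEN iffD1, rotated]) (auto simp: indicator_def F_0)

lemma Fgrad_measurable: "Fgrad F \<in> borel_measurable borel"
  using borel_measurable_continuous_on_indicator[OF _ Fgrad_continuous]
  by (rule measurable_cong[THEN iffD1, rotated]) (auto simp: indicator_def Fgrad_def)

lemma Fhess_measurable: "i \<in> Basis \<Longrightarrow> j \<in> Basis \<Longrightarrow> (\<lambda>\<xi>. Fhess F \<xi> i j) \<in> borel_measurable borel"
  using borel_measurable_continuous_on_indicator[OF _ Fhess_continuous[of i j]]
  by (rule measurable_cong[THEN iffD1, rotated]) (auto simp: indicator_def Fhess_def)

lemma quad_measurable:
  assumes [measurable]: "g \<in> borel_measurable borel" "p \<in> borel_measurable borel"
  shows "(\<lambda>x. quad F (g x) (p x)) \<in> borel_measurable borel"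
proof -
  have [measurable]: "(\<lambda>x. Fhess F (g x) i j) \<in> borel_measurable borel" if "i \<in> Basis" "j \<in> Basis" for i j
    using measurable_compose[OF assms(1) Fhess_measurable[OF that]] .
  note [measurable] = F_measurable Fgrad_measurable
  show ?thesis
    unfolding quad_def by (intro borel_measurable_sum) measurable
qed

lemma Fgrad_bounded: obtains M where "M > 0" "\<And>\<xi>. norm (Fgrad F \<xi>) \<le> M"
proof -
  have "bounded (Fgrad F ` sphere 0 1)"
    by (intro compact_imp_bounded compact_continuous_image continuous_on_subset[OF Fgrad_continuous]) auto
  then obtain M where M: "M > 0" "\<And>\<xi>. norm \<xi> = 1 \<Longrightarrow> norm (Fgrad F \<xi>) \<le> M"
    unfolding bounded_pos by auto
  have "norm (Fgrad F \<xi>) \<le> M" for \<xi>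
  proof (cases "\<xi> = 0")
    case False
    then obtain t w where "t > 0" "\<xi> = t *\<^sub>R w" "norm w = 1" by (rule unit_decomp)
    then show ?thesis using M Fgrad_scale by simp
  qed (use M in \<open>simp add: Fgrad_def\<close>)
  then show ?thesis using that M by blast
qed

text \<open>F has degree 1 and its Hessian degree -1, so the product is constant along rays and a
  bound on the unit sphere is global.\<close>

lemma F_Fhess_bounded: obtains B where "\<And>\<xi> i j. i \<in> Basis \<Longrightarrow> j \<in> Basis \<Longrightarrow> \<bar>F \<xi> * Fhess F \<xi> i j\<bar> \<le> B"
proof -
  \<comment> \<open>One continuous function that dominates all entries at once.\<close>
  let ?h = "\<lambda>\<xi>. \<Sum>i\<in>Basis. \<Sum>j\<in>Basis. \<bar>F \<xi> * Fhess F \<xi> i j\<bar>"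
  have "continuous_on (UNIV - {0}) ?h"
    using Fhess_continuous F_continuous by (intro continuous_intros) auto
  then have "bounded (?h ` sphere 0 1)"
    by (intro compact_imp_bounded compact_continuous_image) (auto intro: continuous_on_subset)
  then obtain B where B0: "B > 0" "\<forall>y\<in>?h ` sphere 0 1. norm y \<le> B"
    unfolding bounded_pos by blast
  have B: "\<bar>?h \<xi>\<bar> \<le> B" if "norm \<xi> = 1" for \<xi>
    using B0(2)[rule_format, OF imageI[of \<xi>]] that by simp
  have "\<bar>F \<xi> * Fhess F \<xi> i j\<bar> \<le> B" if ij: "i \<in> Basis" "j \<in> Basis" for \<xi> i j
  proof (cases "\<xi> = 0")
    case False
    then obtain t w where tw: "t > 0" "\<xi> = t *\<^sub>R w" "norm w = 1" by (rule unit_decomp)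
    have "F \<xi> * Fhess F \<xi> i j = F w * (t * Fhess F (t *\<^sub>R w) i j)"
      using tw by (simp add: F_scale)
    also have "\<bar>\<dots>\<bar> \<le> (\<Sum>j\<in>Basis. \<bar>F w * Fhess F w i j\<bar>)"
      unfolding Fhess_scale[OF tw(1) ij] by (rule member_le_sum) (use ij in auto)
    also have "\<dots> \<le> ?h w"
      by (rule member_le_sum) (use ij in \<open>auto intro: sum_nonneg\<close>)
    also have "\<dots> \<le> B" using B[OF tw(3)] by linarith
    finally show ?thesis .
  qed (use B0 in \<open>simp add: F_0\<close>)
  then show ?thesis using that by blast
qed

lemma quad_bounded: obtains C where "C > 0" "\<And>\<xi> p. \<bar>quad F \<xi> p\<bar> \<le> C * (norm p)\<^sup>2"
proof -
  obtain M where M: "M > 0" "\<And>\<xi>. norm (Fgrad F \<xi>) \<le> M" using Fgrad_bounded by blast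
  obtain B where B: "\<And>\<xi> i j. i \<in> Basis \<Longrightarrow> j \<in> Basis \<Longrightarrow> \<bar>F \<xi> * Fhess F \<xi> i j\<bar> \<le> B"
    using F_Fhess_bounded by blast
  let ?N = "real DIM('a)"
  have "\<bar>quad F \<xi> p\<bar> \<le> (M\<^sup>2 + ?N * (?N * \<bar>B\<bar>)) * (norm p)\<^sup>2" for \<xi> p
  proof -
    have "\<bar>Fgrad F \<xi> \<bullet> p\<bar> \<le> M * norm p"
      by (meson Cauchy_Schwarz_ineq2 M(2) mult_right_mono norm_ge_zero order_trans)
    then have 1: "(Fgrad F \<xi> \<bullet> p)\<^sup>2 \<le> M\<^sup>2 * (norm p)\<^sup>2"
      by (metis abs_ge_zero power2_abs power_mono power_mult_distrib)
    have "\<bar>F \<xi> * hess_form F \<xi> p p\<bar> = \<bar>\<Sum>i\<in>Basis. \<Sum>j\<in>Basis. (F \<xi> * Fhess F \<xi> i j) * (p \<bullet> i) * (p \<bullet> j)\<bar>"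
      unfolding hess_form_def by (simp add: sum_distrib_left mult.assoc)
    also have "\<dots> \<le> (\<Sum>i\<in>(Basis :: 'a set). \<Sum>j\<in>(Basis :: 'a set). \<bar>B\<bar> * (norm p)\<^sup>2)"
    proof (intro order_trans[OF sum_abs] sum_mono)
      fix i j :: 'a assume ij: "i \<in> Basis" "j \<in> Basis"
      have "\<bar>(F \<xi> * Fhess F \<xi> i j) * (p \<bullet> i) * (p \<bullet> j)\<bar> = \<bar>F \<xi> * Fhess F \<xi> i j\<bar> * (\<bar>p \<bullet> i\<bar> * \<bar>p \<bullet> j\<bar>)"
        by (simp add: abs_mult)
      also have "\<dots> \<le> \<bar>B\<bar> * (norm p * norm p)"
        using order_trans[OF B[OF ij] abs_ge_self] ij by (intro mult_mono Basis_le_norm) auto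
      finally show "\<bar>(F \<xi> * Fhess F \<xi> i j) * (p \<bullet> i) * (p \<bullet> j)\<bar> \<le> \<bar>B\<bar> * (norm p)\<^sup>2"
        by (simp add: power2_eq_square)
    qed
    also have "\<dots> = ?N * (?N * \<bar>B\<bar>) * (norm p)\<^sup>2" by simp
    finally show ?thesis
      unfolding quad_eq distrib_right using 1 zero_le_power2[of "Fgrad F \<xi> \<bullet> p"] by linarith
  qed
  moreover have "M\<^sup>2 + ?N * (?N * \<bar>B\<bar>) > 0"
    using M(1) by (intro add_pos_nonneg) auto
  ultimately show ?thesis using that by blast
qed

lemma Fdual_bounds:
  obtains c d where "c > 0" "d > 0" "\<And>x. c * norm x \<le> Fdual F x" "\<And>x. Fdual F x \<le> d * norm x"
proof -
  obtain a b where ab: "0 < a" "a \<le> b" "\<And>\<xi>. a * norm \<xi> \<le> F \<xi>" "\<And>\<xi>. F \<xi> \<le> b * norm \<xi>"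
    using F_bounds by blast
  have upper: "x \<bullet> \<xi> \<le> 1 / a * norm x" if "F \<xi> < 1" for x \<xi>
  proof -
    have "norm \<xi> \<le> 1 / a" using ab(3)[of \<xi>] that ab(1) by (simp add: field_simps)
    then have "norm x * norm \<xi> \<le> norm x * (1 / a)" by (intro mult_left_mono) auto
    then show ?thesis using norm_cauchy_schwarz[of x \<xi>] by simp
  qed
  have bdd: "bdd_above ((\<lambda>\<xi>. x \<bullet> \<xi>) ` {\<xi>. F \<xi> < 1})" for x
    using upper by (intro bdd_aboveI[of _ "1 / a * norm x"]) auto
  have "Fdual F x \<le> 1 / a * norm x" for x
    unfolding Fdual_def using upper by (intro cSup_least) (auto intro: exI[of _ 0] simp: F_0)
  moreover have "1 / (2 * b) * norm x \<le> Fdual F x" for x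
  proof (cases "x = 0")
    case True
    have "x \<bullet> 0 \<le> Fdual F x"
      unfolding Fdual_def by (rule cSup_upper[OF _ bdd]) (auto simp: F_0 intro!: image_eqI[of _ _ 0])
    then show ?thesis using True by simp
  next
    case False
    \<comment> \<open>Half the length permitted by F \<xi> \<le> b |\<xi>|, since the supremum runs
      over the strict inequality F \<xi> < 1.\<close>
    let ?\<xi> = "(1 / (2 * b * norm x)) *\<^sub>R x"
    have "norm ?\<xi> = 1 / (2 * b)" using False ab by simp
    then have "F ?\<xi> < 1" using ab(4)[of ?\<xi>] ab by simp
    then have "x \<bullet> ?\<xi> \<le> Fdual F x"
      unfolding Fdual_def by (intro cSup_upper[OF _ bdd] imageI) simp
    moreover have "x \<bullet> ?\<xi> = 1 / (2 * b) * norm x"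
      using False ab by (simp add: power2_norm_eq_inner[symmetric] power2_eq_square)
    ultimately show ?thesis by simp
  qed
  ultimately show ?thesis
    using that[of "1 / (2 * b)" "1 / a"] ab by auto
qed

end

section \<open>The pointwise inequalities behind the energy estimate\<close>

text \<open>The primitive of the squared derivative of softplus(t s) that vanishes as s tends to
  minus infinity: \<sigma>^2 = \<sigma> - \<sigma> (1 - \<sigma>) is the derivative of
  \<open>softplus\<close> - \<open>sigm\<close>.\<close>

definition gam :: "real \<Rightarrow> real \<Rightarrow> real" where
  "gam t s = t * (softplus (t * s) - sigm (t * s))"

lemma has_real_derivative_softplus_scaled:
  "((\<lambda>s. softplus (t * s)) has_real_derivative t * sigm (t * s)) (at s)"
proof -
  have "((\<lambda>s. t * s) has_real_derivative t) (at s)"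
    by (auto intro!: derivative_eq_intros)
  from DERIV_chain2[where g="\<lambda>s. t * s", OF has_real_derivative_softplus this]
  show ?thesis by (simp add: mult.commute)
qed

lemma has_real_derivative_gam: "(gam t has_real_derivative (t * sigm (t * s))\<^sup>2) (at s)"
proof -
  have "((\<lambda>s. sigm (t * s)) has_real_derivative sigm (t * s) * (1 - sigm (t * s)) * t) (at s)"
    by (rule DERIV_chain2[where g="\<lambda>s. t * s", OF has_real_derivative_sigm]) (auto intro!: derivative_eq_intros)
  from DERIV_cmult[OF DERIV_diff[OF has_real_derivative_softplus_scaled[of t s] this], of t]
  show ?thesis
    unfolding gam_def[abs_def] by (simp add: power2_eq_square algebra_simps)
qed

lemma gam_bounds:
  assumes "t > 0"
  shows "0 \<le> gam t s" "gam t s \<le> t / 2 * (softplus (t * s))\<^sup>2"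
    "gam t s \<le> softplus (t * s) * (t * sigm (t * s))" "gam t s \<le> t * softplus (t * s)"
proof -
  show "0 \<le> gam t s"
    unfolding gam_def using assms softplus_minus_sigm_nonneg by (intro mult_nonneg_nonneg) auto
  show "gam t s \<le> t / 2 * (softplus (t * s))\<^sup>2"
    unfolding gam_def using mult_left_mono[OF softplus_minus_sigm_le_square[of "t * s"], of t] assms by simp
  show "gam t s \<le> softplus (t * s) * (t * sigm (t * s))"
    unfolding gam_def using mult_left_mono[OF softplus_minus_sigm_le_mult[of "t * s"], of t] assms
    by (simp add: mult_ac)
  show "gam t s \<le> t * softplus (t * s)"
    unfolding gam_def using assms sigm_bounds(1)[of "t * s"] by (intro mult_left_mono) auto
qed

text \<open>The gradient part of the two tested relations combined: \<xi> stands for Du,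
  \<open>s\<close> and \<open>g\<close> for the value and gradient of the mollified function,
  \<open>e\<close> and \<open>v\<close> for those of the cutoff. \<xi> and \<open>g\<close> are
  separate slots because they agree only in the limit.\<close>

definition energy :: "('a::euclidean_space \<Rightarrow> real) \<Rightarrow> real \<Rightarrow> real \<Rightarrow> 'a \<Rightarrow> real \<Rightarrow> 'a \<Rightarrow> real \<Rightarrow> 'a \<Rightarrow> real" where
  "energy F t \<kappa> \<xi> s g e v =
     quad F \<xi> ((t * sigm (t * s) * e) *\<^sub>R g + softplus (t * s) *\<^sub>R v)
     - \<kappa> * (F \<xi> * (Fgrad F \<xi> \<bullet> (((t * sigm (t * s))\<^sup>2 * e\<^sup>2) *\<^sub>R g + (gam t s * (2 * e)) *\<^sub>R v)))"

lemma square_add3_le: "(x + y + z)\<^sup>2 \<le> 3 * (x\<^sup>2 + y\<^sup>2 + (z::real)\<^sup>2)"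
proof -
  have "0 \<le> (x - y)\<^sup>2 + (y - z)\<^sup>2 + (x - z)\<^sup>2" by simp
  then show ?thesis by (simp add: power2_eq_square algebra_simps)
qed

context
  fixes F :: "'a::euclidean_space \<Rightarrow> real"
  assumes adm: "admissible_F F"
begin

lemma flux_bounded:
  obtains M where "M > 0" "\<And>\<xi> v. \<bar>F \<xi> * (Fgrad F \<xi> \<bullet> v)\<bar> \<le> M * (norm \<xi> * norm v)"
proof -
  obtain M where M: "M > 0" "\<And>\<xi>. norm (Fgrad F \<xi>) \<le> M" using Fgrad_bounded[OF adm] by blast
  obtain b where b: "b > 0" "\<And>\<xi>. F \<xi> \<le> b * norm \<xi>"
    using F_bounds[OF adm] by (meson less_le_trans)
  have "\<bar>F \<xi> * (Fgrad F \<xi> \<bullet> v)\<bar> \<le> (b * M) * (norm \<xi> * norm v)" for \<xi> v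
  proof -
    have "\<bar>Fgrad F \<xi> \<bullet> v\<bar> \<le> M * norm v"
      by (meson Cauchy_Schwarz_ineq2 M(2) mult_right_mono norm_ge_zero order_trans)
    then have "F \<xi> * \<bar>Fgrad F \<xi> \<bullet> v\<bar> \<le> (b * norm \<xi>) * (M * norm v)"
      using b F_nonneg[OF adm] by (intro mult_mono) auto
    then show ?thesis
      using F_nonneg[OF adm, of \<xi>] by (simp add: abs_mult mult_ac)
  qed
  then show ?thesis using that[of "b * M"] b M by simp
qed

text \<open>Linear growth of softplus and \<open>gam\<close>, with bounded derivatives, gives
  quadratic growth here. The group s^2 + |g|^2 is kept together because the mollified density
  \<open>w n\<close> dominates it.\<close>

lemma energy_bounded:
  assumes t: "0 < t" "t < 2" and \<kappa>: "\<kappa> \<ge> 0"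
  obtains C where "C > 0" "\<And>\<xi> s g e v. \<bar>e\<bar> \<le> E \<Longrightarrow> norm v \<le> E \<Longrightarrow>
    \<bar>energy F t \<kappa> \<xi> s g e v\<bar> \<le> C * (1 + (s\<^sup>2 + (norm g)\<^sup>2) + (norm \<xi>)\<^sup>2)"
proof -
  obtain CA where CA: "CA > 0" "\<And>\<xi> p. \<bar>quad F \<xi> p\<bar> \<le> CA * (norm p)\<^sup>2" using quad_bounded[OF adm] by blast
  obtain M where M: "M > 0" "\<And>\<xi> v. \<bar>F \<xi> * (Fgrad F \<xi> \<bullet> v)\<bar> \<le> M * (norm \<xi> * norm v)"
    using flux_bounded by blast
  \<comment> \<open>12 = 3 * 2^2 and 192 = 3 * 8^2, where 2 and 8 are the largest coefficients in
    the bounds on p and q and the 3 is that of \<open>square_add3_le\<close>. The summand 1 comes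
    from |\<xi>| |q| \<le> |\<xi>|^2 + |q|^2.\<close>
  define C where "C = CA * (12 * E\<^sup>2) + \<kappa> * (M * (1 + 192 * E ^ 4))"
  have "\<bar>energy F t \<kappa> \<xi> s g e v\<bar> \<le> C * (1 + (s\<^sup>2 + (norm g)\<^sup>2) + (norm \<xi>)\<^sup>2)"
    if e: "\<bar>e\<bar> \<le> E" and v: "norm v \<le> E" for \<xi> s g e v
  proof -
    let ?S = "1 + (s\<^sup>2 + (norm g)\<^sup>2) + (norm \<xi>)\<^sup>2"
    define a where "a = t * sigm (t * s)"
    define \<beta> where "\<beta> = softplus (t * s)"
    have E: "E \<ge> 0" using e by linarith
    have a: "0 \<le> a" "a \<le> 2"
      using t sigm_bounds[of "t * s"] mult_mono[of t 2 "sigm (t * s)" 1] unfolding a_def by auto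
    have ts: "\<bar>t * s\<bar> \<le> 2 * \<bar>s\<bar>" using t by (simp add: abs_mult mult_right_mono)
    have \<beta>: "0 \<le> \<beta>" "\<beta> \<le> 1 + 2 * \<bar>s\<bar>"
      using softplus_pos[of "t * s"] softplus_le_linear[of "t * s"] ts unfolding \<beta>_def by auto
    have \<gamma>: "0 \<le> gam t s" "gam t s \<le> 2 * (1 + 2 * \<bar>s\<bar>)"
      using gam_bounds(1,4)[OF t(1), of s] \<beta> t mult_mono[of t 2 \<beta> "1 + 2 * \<bar>s\<bar>"] unfolding \<beta>_def by auto
    define p where "p = (a * e) *\<^sub>R g + \<beta> *\<^sub>R v"
    define q where "q = (a\<^sup>2 * e\<^sup>2) *\<^sub>R g + (gam t s * (2 * e)) *\<^sub>R v"
    have "norm p \<le> \<bar>a * e\<bar> * norm g + \<beta> * norm v"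
      unfolding p_def using norm_triangle_ineq[of "(a * e) *\<^sub>R g" "\<beta> *\<^sub>R v"] \<beta> by simp
    also have "\<dots> \<le> (2 * E) * norm g + (1 + 2 * \<bar>s\<bar>) * E"
      using a e v \<beta> E by (intro add_mono mult_mono) (auto simp: abs_mult intro!: mult_mono)
    also have "\<dots> = E * (2 * norm g + 1 + 2 * \<bar>s\<bar>)" by (simp add: algebra_simps)
    finally have "(norm p)\<^sup>2 \<le> (E * (2 * norm g + 1 + 2 * \<bar>s\<bar>))\<^sup>2"
      by (intro power_mono) auto
    also have "\<dots> \<le> E\<^sup>2 * (3 * ((2 * norm g)\<^sup>2 + 1\<^sup>2 + (2 * \<bar>s\<bar>)\<^sup>2))"
      unfolding power_mult_distrib[of E] by (intro mult_left_mono square_add3_le) auto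
    also have "\<dots> \<le> E\<^sup>2 * (12 * ?S)"
      by (intro mult_left_mono) (auto simp: power_mult_distrib)
    finally have p: "(norm p)\<^sup>2 \<le> 12 * E\<^sup>2 * ?S" by (simp only: mult_ac)
    have "norm q \<le> (a\<^sup>2 * e\<^sup>2) * norm g + (gam t s * (2 * \<bar>e\<bar>)) * norm v"
      unfolding q_def using norm_triangle_ineq[of "(a\<^sup>2 * e\<^sup>2) *\<^sub>R g" "(gam t s * (2 * e)) *\<^sub>R v"] \<gamma>
      by (simp add: abs_mult)
    also have "\<dots> \<le> (2\<^sup>2 * E\<^sup>2) * norm g + ((2 * (1 + 2 * \<bar>s\<bar>)) * (2 * E)) * E"
    proof -
      have "e\<^sup>2 \<le> E\<^sup>2" using e by (metis abs_ge_zero power2_abs power_mono)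
      moreover have "a\<^sup>2 \<le> 2\<^sup>2" using a by (intro power_mono) auto
      ultimately show ?thesis
        using e v \<gamma> E by (intro add_mono mult_mono) (auto intro!: mult_mono)
    qed
    also have "\<dots> = E\<^sup>2 * (4 * norm g + 4 + 8 * \<bar>s\<bar>)" by (simp add: power2_eq_square algebra_simps)
    finally have "(norm q)\<^sup>2 \<le> (E\<^sup>2 * (4 * norm g + 4 + 8 * \<bar>s\<bar>))\<^sup>2"
      by (intro power_mono) auto
    also have "\<dots> \<le> E ^ 4 * (3 * ((4 * norm g)\<^sup>2 + 4\<^sup>2 + (8 * \<bar>s\<bar>)\<^sup>2))"
      unfolding power_mult_distrib[of "E\<^sup>2"] power_mult[symmetric]
      using square_add3_le[of "4 * norm g" 4 "8 * \<bar>s\<bar>"] by (simp add: mult_left_mono)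
    also have "\<dots> \<le> E ^ 4 * (192 * ?S)"
      by (intro mult_left_mono) (auto simp: power_mult_distrib)
    finally have q: "(norm q)\<^sup>2 \<le> 192 * E ^ 4 * ?S" by (simp only: mult_ac)
    have "norm \<xi> * norm q \<le> (norm \<xi>)\<^sup>2 + (norm q)\<^sup>2"
      using sum_squares_bound[of "norm \<xi>" "norm q"] mult_nonneg_nonneg[OF norm_ge_zero norm_ge_zero, of \<xi> q]
      unfolding mult.assoc by linarith
    also have "\<dots> \<le> (1 + 192 * E ^ 4) * ?S"
      unfolding distrib_right[of 1] mult_1 using q zero_le_power2[of s] zero_le_power2[of "norm g"] by linarith
    finally have "M * (norm \<xi> * norm q) \<le> M * ((1 + 192 * E ^ 4) * ?S)"
      using M(1) by (intro mult_left_mono) auto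
    then have "\<bar>F \<xi> * (Fgrad F \<xi> \<bullet> q)\<bar> \<le> M * ((1 + 192 * E ^ 4) * ?S)"
      using M(2)[of \<xi> q] by linarith
    then have 1: "\<bar>\<kappa> * (F \<xi> * (Fgrad F \<xi> \<bullet> q))\<bar> \<le> \<kappa> * (M * (1 + 192 * E ^ 4)) * ?S"
      using \<kappa> mult_left_mono[of _ _ \<kappa>] by (simp add: abs_mult[of \<kappa>] mult.assoc)
    have 2: "\<bar>quad F \<xi> p\<bar> \<le> CA * (12 * E\<^sup>2) * ?S"
      using order_trans[OF CA(2)[of \<xi> p] mult_left_mono[OF p, of CA]] CA(1) by (simp only: mult.assoc)
    have "energy F t \<kappa> \<xi> s g e v = quad F \<xi> p - \<kappa> * (F \<xi> * (Fgrad F \<xi> \<bullet> q))"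
      unfolding energy_def p_def q_def a_def \<beta>_def ..
    then show ?thesis
      using 1 2 unfolding C_def distrib_right[of "CA * (12 * E\<^sup>2)"] by linarith
  qed
  note bound = this
  have C: "C \<ge> 0"
    unfolding C_def using CA(1) M(1) \<kappa> by (intro add_nonneg_nonneg mult_nonneg_nonneg) auto
  have "\<bar>energy F t \<kappa> \<xi> s g e v\<bar> \<le> (C + 1) * (1 + (s\<^sup>2 + (norm g)\<^sup>2) + (norm \<xi>)\<^sup>2)"
    if "\<bar>e\<bar> \<le> E" "norm v \<le> E" for \<xi> s g e v
    by (rule order_trans[OF bound[OF that] mult_right_mono[of C "C + 1"]]) auto
  then show ?thesis
    using that[of "C + 1"] C by simp
qed

text \<open>With \<open>g\<close> equal to \<xi> the squares combine to -(\<kappa> - 1) (a e F)^2,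
  where a = t \<open>sigm (t * s)\<close>, and completing the square absorbs the mixed term. All
  terms with \<open>e\<close> disappear, so the cutoff enters the bound only through its gradient
  \<open>v\<close>.\<close>

lemma energy_le:
  assumes t: "0 < t" and \<kappa>: "\<kappa> > 1"
  obtains C where "C > 0" "\<And>\<xi> s e v. energy F t \<kappa> \<xi> s \<xi> e v \<le> C * ((softplus (t * s))\<^sup>2 * (norm v)\<^sup>2)"
proof -
  obtain CA where CA: "CA > 0" "\<And>\<xi> p. \<bar>quad F \<xi> p\<bar> \<le> CA * (norm p)\<^sup>2" using quad_bounded[OF adm] by blast
  obtain M where M: "M > 0" "\<And>\<xi>. norm (Fgrad F \<xi>) \<le> M" using Fgrad_bounded[OF adm] by blast
  define \<delta> where "\<delta> = \<kappa> - 1"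
  have \<delta>: "\<delta> > 0" using \<kappa> by (simp add: \<delta>_def)
  have "energy F t \<kappa> \<xi> s \<xi> e v \<le> (CA + \<kappa>\<^sup>2 * M\<^sup>2 / \<delta>) * ((softplus (t * s))\<^sup>2 * (norm v)\<^sup>2)" for \<xi> s e v
  proof -
    define a where "a = t * sigm (t * s)"
    define \<beta> where "\<beta> = softplus (t * s)"
    define k where "k = Fgrad F \<xi> \<bullet> v"
    have a: "a \<ge> 0" and \<beta>: "\<beta> \<ge> 0"
      using t sigm_bounds[of "t * s"] softplus_pos[of "t * s"] unfolding a_def \<beta>_def by auto
    have \<gamma>: "0 \<le> gam t s" "gam t s \<le> \<beta> * a"
      using gam_bounds[OF t, of s] unfolding a_def \<beta>_def by auto
    have "energy F t \<kappa> \<xi> s \<xi> e v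
        = (a * e)\<^sup>2 * (F \<xi>)\<^sup>2 + 2 * (a * e) * (F \<xi> * (\<beta> * k)) + quad F \<xi> (\<beta> *\<^sub>R v)
          - \<kappa> * (F \<xi> * (a\<^sup>2 * e\<^sup>2 * F \<xi> + gam t s * (2 * e) * k))"
      unfolding energy_def a_def[symmetric] \<beta>_def[symmetric] quad_expand[OF adm] k_def
      by (simp add: inner_add_right Fgrad_Euler[OF adm])
    also have "\<dots> = - \<delta> * (a * e * F \<xi>)\<^sup>2 + 2 * (a * \<beta> - \<kappa> * gam t s) * (e * F \<xi> * k) + quad F \<xi> (\<beta> *\<^sub>R v)"
      unfolding \<delta>_def by (simp add: power2_eq_square algebra_simps)
    also have "2 * (a * \<beta> - \<kappa> * gam t s) * (e * F \<xi> * k) \<le> 2 * (a * \<bar>e\<bar> * F \<xi>) * (\<kappa> * M * (\<beta> * norm v))"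
    proof -
      \<comment> \<open>A difference of two numbers that both lie between 0 and \<kappa> a
        \<beta>.\<close>
      have "\<bar>a * \<beta> - \<kappa> * gam t s\<bar> \<le> \<kappa> * (a * \<beta>)"
      proof -
        have "\<kappa> * gam t s \<le> \<kappa> * (a * \<beta>)" using \<gamma> \<kappa> by (simp add: mult.commute)
        moreover have "0 \<le> \<kappa> * gam t s" using \<gamma> \<kappa> by simp
        moreover have "1 * (a * \<beta>) \<le> \<kappa> * (a * \<beta>)" using a \<beta> \<kappa> by (intro mult_right_mono) auto
        moreover have "0 \<le> a * \<beta>" using a \<beta> by simp
        ultimately show ?thesis by linarith
      qed
      moreover have "\<bar>e * F \<xi> * k\<bar> \<le> \<bar>e\<bar> * F \<xi> * (M * norm v)"
      proof -
        have "\<bar>k\<bar> \<le> M * norm v"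
          unfolding k_def by (meson Cauchy_Schwarz_ineq2 M(2) mult_right_mono norm_ge_zero order_trans)
        then show ?thesis
          using F_nonneg[OF adm, of \<xi>] by (simp add: abs_mult mult_left_mono)
      qed
      ultimately have "\<bar>(a * \<beta> - \<kappa> * gam t s) * (e * F \<xi> * k)\<bar> \<le> (\<kappa> * (a * \<beta>)) * (\<bar>e\<bar> * F \<xi> * (M * norm v))"
        unfolding abs_mult[of "a * \<beta> - \<kappa> * gam t s"] using a \<beta> \<kappa> by (intro mult_mono) auto
      also have "\<dots> = (a * \<bar>e\<bar> * F \<xi>) * (\<kappa> * M * (\<beta> * norm v))" by (simp add: mult_ac)
      finally show ?thesis by linarith
    qed
    also have "2 * (a * \<bar>e\<bar> * F \<xi>) * (\<kappa> * M * (\<beta> * norm v)) \<le> \<delta> * (a * \<bar>e\<bar> * F \<xi>)\<^sup>2 + (\<kappa> * M * (\<beta> * norm v))\<^sup>2 / \<delta>"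
    proof -
      have "0 \<le> (\<delta> * (a * \<bar>e\<bar> * F \<xi>) - (\<kappa> * M * (\<beta> * norm v)))\<^sup>2 / \<delta>" using \<delta> by simp
      also have "\<dots> = \<delta> * (a * \<bar>e\<bar> * F \<xi>)\<^sup>2 + (\<kappa> * M * (\<beta> * norm v))\<^sup>2 / \<delta>
          - 2 * (a * \<bar>e\<bar> * F \<xi>) * (\<kappa> * M * (\<beta> * norm v))"
        using \<delta> by (simp add: power2_diff diff_divide_distrib add_divide_distrib)
          (simp add: power2_eq_square)
      finally show ?thesis by linarith
    qed
    also have "quad F \<xi> (\<beta> *\<^sub>R v) \<le> CA * (\<beta>\<^sup>2 * (norm v)\<^sup>2)"
      using CA(2)[of \<xi> "\<beta> *\<^sub>R v"] by (simp add: power_mult_distrib abs_le_iff)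
    also have "- \<delta> * (a * e * F \<xi>)\<^sup>2 + (\<delta> * (a * \<bar>e\<bar> * F \<xi>)\<^sup>2 + (\<kappa> * M * (\<beta> * norm v))\<^sup>2 / \<delta>)
        + CA * (\<beta>\<^sup>2 * (norm v)\<^sup>2) = (CA + \<kappa>\<^sup>2 * M\<^sup>2 / \<delta>) * (\<beta>\<^sup>2 * (norm v)\<^sup>2)"
      by (simp add: power_mult_distrib algebra_simps)
    finally show ?thesis unfolding \<beta>_def by simp
  qed
  moreover have "CA + \<kappa>\<^sup>2 * M\<^sup>2 / \<delta> > 0"
    using CA(1) \<delta> by (intro add_pos_nonneg) auto
  ultimately show ?thesis using that by blast
qed

end

lemma quad_tendsto: "(p \<longlongrightarrow> q) A \<Longrightarrow> ((\<lambda>n. quad F \<xi> (p n)) \<longlongrightarrow> quad F \<xi> q) A"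
  unfolding quad_def by (intro tendsto_intros)

lemma energy_tendsto:
  assumes "(s \<longlongrightarrow> s0) A" "(g \<longlongrightarrow> g0) A"
  shows "((\<lambda>n. energy F t \<kappa> \<xi> (s n) (g n) e v) \<longlongrightarrow> energy F t \<kappa> \<xi> s0 g0 e v) A"
proof -
  have 1: "((\<lambda>n. sigm (t * s n)) \<longlongrightarrow> sigm (t * s0)) A"
    by (rule isCont_tendsto_compose[OF DERIV_isCont[OF has_real_derivative_sigm]]) (intro tendsto_intros assms)
  have 2: "((\<lambda>n. softplus (t * s n)) \<longlongrightarrow> softplus (t * s0)) A"
    by (rule isCont_tendsto_compose[OF DERIV_isCont[OF has_real_derivative_softplus]]) (intro tendsto_intros assms)
  have 3: "((\<lambda>n. gam t (s n)) \<longlongrightarrow> gam t s0) A"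
    by (rule isCont_tendsto_compose[OF DERIV_isCont[OF has_real_derivative_gam]]) (rule assms)
  show ?thesis
    unfolding energy_def by (intro tendsto_intros quad_tendsto 1 2 3 assms)
qed

section \<open>The energy estimate\<close>

text \<open>Form of Fatou's lemma in which integrability of the limit is part of the result; the
  energy estimate obtains the integrability of its source term from it.\<close>

lemma fatou_bounded:
  fixes f :: "nat \<Rightarrow> 'a \<Rightarrow> real"
  assumes f: "\<And>n. integrable M (f n)" "\<And>n x. 0 \<le> f n x"
    and le: "\<And>n. (\<integral>x. f n x \<partial>M) \<le> a n" and a: "a \<longlonglongrightarrow> A"
    and lim: "AE x in M. (\<lambda>n. f n x) \<longlonglongrightarrow> g x" and g: "g \<in> borel_measurable M"
  shows "integrable M g" "(\<integral>x. g x \<partial>M) \<le> A"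
proof -
  have g0: "AE x in M. 0 \<le> g x"
    using lim by eventually_elim (use f(2) in \<open>auto intro: LIMSEQ_le_const\<close>)
  have "0 \<le> a n" for n
    using order_trans[OF Bochner_Integration.integral_nonneg le[of n]] f(2) by blast
  then have A0: "0 \<le> A"
    using a by (auto intro: LIMSEQ_le_const)
  have "(\<integral>\<^sup>+x. ennreal (g x) \<partial>M) = (\<integral>\<^sup>+x. liminf (\<lambda>n. ennreal (f n x)) \<partial>M)"
  proof (rule nn_integral_cong_AE)
    show "AE x in M. ennreal (g x) = liminf (\<lambda>n. ennreal (f n x))"
      using lim by eventually_elim (rule lim_imp_Liminf[symmetric], auto intro: tendsto_ennrealI)
  qed
  also have "\<dots> \<le> liminf (\<lambda>n. \<integral>\<^sup>+x. ennreal (f n x) \<partial>M)"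
    using borel_measurable_integrable[OF f(1)] by (intro nn_integral_liminf) measurable
  also have "\<dots> \<le> liminf (\<lambda>n. ennreal (a n))"
    using f le by (intro Liminf_mono always_eventually allI) (simp add: nn_integral_eq_integral ennreal_leI)
  also have "\<dots> = ennreal A"
    by (intro lim_imp_Liminf tendsto_ennrealI a) simp
  finally have *: "(\<integral>\<^sup>+x. ennreal (g x) \<partial>M) \<le> ennreal A" .
  then show int: "integrable M g"
    using g g0 by (intro integrableI_nonneg) (auto simp: less_top[symmetric] top_unique)
  show "(\<integral>x. g x \<partial>M) \<le> A"
    using * nn_integral_eq_integral[OF int g0] A0 by simp
qed

lemma grad_comp_mult:
  assumes f: "(f has_real_derivative f') (at (v x))"
    and v: "v differentiable (at x)" and h: "h differentiable (at x)"
  shows "grad (\<lambda>x. f (v x) * h x) x = (f' * h x) *\<^sub>R grad v x + f (v x) *\<^sub>R grad h x"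
proof (rule grad_eqI)
  have "((\<lambda>x. f (v x)) has_derivative (\<lambda>k. f' * (grad v x \<bullet> k))) (at x)"
    using has_derivative_compose[OF has_derivative_grad[OF v], of f "\<lambda>k. f' * k"] f
    by (simp add: has_field_derivative_def)
  from has_derivative_mult[OF this has_derivative_grad[OF h]]
  show "((\<lambda>x. f (v x) * h x) has_derivative (\<lambda>k. ((f' * h x) *\<^sub>R grad v x + f (v x) *\<^sub>R grad h x) \<bullet> k)) (at x)"
    by (simp add: inner_add_left algebra_simps)
qed

lemma grad_power:
  assumes "v differentiable (at x)"
  shows "grad (\<lambda>x. v x ^ n) x = (real n * v x ^ (n - 1)) *\<^sub>R grad v x"
proof -
  have "grad (\<lambda>x. v x ^ n * 1) x = (real n * v x ^ (n - 1) * 1) *\<^sub>R grad v x + v x ^ n *\<^sub>R grad (\<lambda>x. 1) x"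
    using assms by (intro grad_comp_mult[where f="\<lambda>s. s ^ n"]) (auto intro!: derivative_eq_intros)
  moreover have "grad (\<lambda>x. 1) x = 0"
    by (rule grad_eqI) simp
  ultimately show ?thesis by simp
qed

section \<open>Measurability and local integrability of the terms of the problem\<close>

lemma set_integrable_cball_bound:
  fixes f :: "'a::euclidean_space \<Rightarrow> 'b::{banach, second_countable_topology}"
  assumes "set_integrable lborel (cball 0 R) g" "f \<in> borel_measurable borel" "\<And>x. norm (f x) \<le> g x"
  shows "set_integrable lborel (cball 0 R) f"
  unfolding set_integrable_def
proof (rule Bochner_Integration.integrable_bound)
  show "integrable lborel (\<lambda>x. indicator (cball 0 R) x *\<^sub>R g x)"
    using assms(1) unfolding set_integrable_def .
  show "(\<lambda>x. indicator (cball 0 R) x *\<^sub>R f x) \<in> borel_measurable lborel"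
    using assms(2) by (intro borel_measurable_scaleR borel_measurable_indicator) auto
  show "AE x in lborel. norm (indicator (cball 0 R) x *\<^sub>R f x) \<le> norm (indicator (cball 0 R) x *\<^sub>R g x)"
    using order_trans[OF assms(3) abs_ge_self] by (auto simp: indicator_def intro!: AE_I2)
qed

lemma set_integrable_cball_of_square:
  fixes f :: "'a::euclidean_space \<Rightarrow> 'b::{banach, second_countable_topology}"
  assumes "f \<in> borel_measurable borel" "set_integrable lborel (cball 0 R) (\<lambda>x. (norm (f x))\<^sup>2)"
  shows "set_integrable lborel (cball 0 R) f"
proof (rule set_integrable_cball_bound[OF _ assms(1)])
  show "set_integrable lborel (cball 0 R) (\<lambda>x. 1 + (norm (f x))\<^sup>2)"
    by (intro set_integral_add set_integrable_const_cball assms(2))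
  show "norm (f x) \<le> 1 + (norm (f x))\<^sup>2" for x
    using sum_squares_bound[of "norm (f x)" 1] norm_ge_zero[of "f x"]
    unfolding mult_1_right power_one by linarith
qed

lemma test_fun_bounds:
  assumes "test_fun f"
  obtains R E where "R > 0" "E > 0" "\<And>x. x \<notin> cball 0 R \<Longrightarrow> f x = 0" "\<And>x. x \<notin> cball 0 R \<Longrightarrow> grad f x = 0"
    "\<And>x. \<bar>f x\<bar> \<le> E" "\<And>x. norm (grad f x) \<le> E"
proof -
  obtain R where R: "R > 0" "\<And>x. x \<notin> cball 0 R \<Longrightarrow> f x = 0"
    using test_fun_support[OF assms] by metis
  have g: "grad f x = 0" if "x \<notin> cball 0 R" for x
    using grad_eq_0_outside[of R f x] R that by blast
  note c = smooth_fun_continuous[OF test_funD[OF assms], of UNIV] continuous_on_grad[OF test_funD[OF assms], of UNIV]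
  obtain A where A: "A > 0" "\<And>x. norm (f x) \<le> A"
    using bounded_continuous_support[OF c(1) R(2)] by metis
  obtain B where B: "B > 0" "\<And>x. norm (grad f x) \<le> B"
    using bounded_continuous_support[OF c(2) g] by metis
  have "\<bar>f x\<bar> \<le> A + B" "norm (grad f x) \<le> A + B" for x
    using A(2)[of x] B(2)[of x] A(1) B(1) by auto
  then show ?thesis using that[of R "A + B"] R g A(1) B(1) by auto
qed

lemma smooth_fun_measurable: "smooth_fun f \<Longrightarrow> f \<in> borel_measurable borel"
  by (rule borel_measurable_continuous_onI[OF smooth_fun_continuous])

lemma grad_measurable: "smooth_fun f \<Longrightarrow> grad f \<in> borel_measurable borel"
  by (rule borel_measurable_continuous_onI[OF continuous_on_grad])

definition source :: "('a::euclidean_space \<Rightarrow> real) \<Rightarrow> real \<Rightarrow> ('a \<Rightarrow> real) \<Rightarrow> 'a \<Rightarrow> real" where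
  "source F \<alpha> u x = Fdual F x powr \<alpha> * exp (u x)"

lemma weak_solutionD:
  assumes "weak_solution F \<alpha> u Du"
  shows "u \<in> borel_measurable borel" "Du \<in> borel_measurable borel"
    "\<And>R. set_integrable lborel (cball 0 R) (\<lambda>x. (norm (u x))\<^sup>2)"
    "\<And>R. set_integrable lborel (cball 0 R) (\<lambda>x. (norm (Du x))\<^sup>2)"
    "\<And>R. set_integrable lborel (cball 0 R) (source F \<alpha> u)"
    "weak_grad u Du"
    "\<And>\<psi>. test_fun \<psi> \<Longrightarrow> (\<integral>x. F (Du x) * (Fgrad F (Du x) \<bullet> grad \<psi> x) \<partial>lborel) = (\<integral>x. source F \<alpha> u x * \<psi> x \<partial>lborel)"
  using assms unfolding weak_solution_def H1loc_grad_def loc_L2_def loc_integrable_def source_def[abs_def]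
  by auto

lemma source_nonneg: "0 \<le> source F \<alpha> u x"
  by (simp add: source_def)

text \<open>Local integrability includes measurability on each ball, and at each point the
  truncations to growing balls eventually agree with the function.\<close>

lemma source_measurable:
  assumes "weak_solution F \<alpha> u Du"
  shows "source F \<alpha> u \<in> borel_measurable borel"
proof (rule borel_measurable_LIMSEQ_metric)
  fix n :: nat
  show "(\<lambda>x. indicator (cball 0 (real n)) x *\<^sub>R source F \<alpha> u x) \<in> borel_measurable borel"
    using weak_solutionD(5)[OF assms, of n] unfolding set_integrable_def
    by (auto dest: borel_measurable_integrable)
next
  fix x :: 'a
  have "\<forall>\<^sub>F n in sequentially. indicator (cball 0 (real n)) x *\<^sub>R source F \<alpha> u x = source F \<alpha> u x"
    using eventually_ge_at_top[of "nat \<lceil>norm x\<rceil>"] by eventually_elim (auto simp: nat_le_iff ceiling_le_iff)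
  then show "(\<lambda>n. indicator (cball 0 (real n)) x *\<^sub>R source F \<alpha> u x) \<longlonglongrightarrow> source F \<alpha> u x"
    by (rule tendsto_eventually)
qed

lemma stable_quad:
  assumes "stable F \<alpha> u Du" "test_fun \<phi>"
  shows "0 \<le> (\<integral>x. quad F (Du x) (grad \<phi> x) - source F \<alpha> u x * (\<phi> x)\<^sup>2 \<partial>lborel)"
  using assms unfolding stable_def quad_def source_def by blast

lemma integrable_quad_test:
  assumes adm: "admissible_F F" and [measurable]: "Du \<in> borel_measurable borel" and \<phi>: "test_fun \<phi>"
  shows "integrable lborel (\<lambda>x. quad F (Du x) (grad \<phi> x))"
proof -
  obtain C where C: "C > 0" "\<And>\<xi> p. \<bar>quad F \<xi> p\<bar> \<le> C * (norm p)\<^sup>2" using quad_bounded[OF adm] by blast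
  obtain R E where \<phi>b: "\<And>x. x \<notin> cball 0 R \<Longrightarrow> grad \<phi> x = 0" "\<And>x. norm (grad \<phi> x) \<le> E"
    using test_fun_bounds[OF \<phi>] by metis
  have "integrable lborel (\<lambda>x. quad F (Du x) (grad \<phi> x) *\<^sub>R (1::real))"
  proof (rule integrable_bounded_support[where B="C * E\<^sup>2" and R=R])
    show "(\<lambda>x. quad F (Du x) (grad \<phi> x)) \<in> borel_measurable borel"
      using grad_measurable[OF test_funD[OF \<phi>]] by (intro quad_measurable[OF adm]) auto
    show "\<bar>quad F (Du x) (grad \<phi> x)\<bar> \<le> C * E\<^sup>2" for x
      using C(1) \<phi>b(2)[of x] by (intro order_trans[OF C(2)] mult_left_mono power_mono) auto
    show "quad F (Du x) (grad \<phi> x) = 0" if "x \<notin> cball 0 R" for x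
      using \<phi>b(1)[OF that] by (simp add: quad_def)
  qed (rule set_integrable_const_cball)
  then show ?thesis by simp
qed

lemma integrable_source_mult:
  assumes sol: "weak_solution F \<alpha> u Du" and \<phi>: "test_fun \<phi>"
  shows "integrable lborel (\<lambda>x. source F \<alpha> u x * \<phi> x)"
proof -
  obtain R E where \<phi>b: "\<And>x. x \<notin> cball 0 R \<Longrightarrow> \<phi> x = 0" "\<And>x. \<bar>\<phi> x\<bar> \<le> E"
    using test_fun_bounds[OF \<phi>] by metis
  have "integrable lborel (\<lambda>x. \<phi> x *\<^sub>R source F \<alpha> u x)"
    by (rule integrable_bounded_support[OF smooth_fun_measurable[OF test_funD[OF \<phi>]] \<phi>b(2,1) weak_solutionD(5)[OF sol]])
  then show ?thesis by (simp add: mult.commute)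
qed

lemma integrable_flux:
  assumes adm: "admissible_F F" and sol: "weak_solution F \<alpha> u Du" and \<psi>: "test_fun \<psi>"
  shows "integrable lborel (\<lambda>x. F (Du x) * (Fgrad F (Du x) \<bullet> grad \<psi> x))"
proof -
  note [measurable] = weak_solutionD(2)[OF sol] F_measurable[OF adm] Fgrad_measurable[OF adm]
    grad_measurable[OF test_funD[OF \<psi>]]
  obtain R E where \<psi>b: "\<And>x. x \<notin> cball 0 R \<Longrightarrow> grad \<psi> x = 0" "\<And>x. norm (grad \<psi> x) \<le> E"
    using test_fun_bounds[OF \<psi>] by metis
  obtain M where M: "M > 0" "\<And>\<xi> v. \<bar>F \<xi> * (Fgrad F \<xi> \<bullet> v)\<bar> \<le> M * (norm \<xi> * norm v)"
    using flux_bounded[OF adm] by blast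
  have Du: "set_integrable lborel (cball 0 R) Du"
    using set_integrable_cball_of_square weak_solutionD(2,4)[OF sol] by blast
  show ?thesis
  proof (rule Bochner_Integration.integrable_bound)
    show "integrable lborel (\<lambda>x. (M * E) * norm (indicator (cball 0 R) x *\<^sub>R Du x))"
      using Du unfolding set_integrable_def by (intro integrable_mult_right integrable_norm)
    show "AE x in lborel. norm (F (Du x) * (Fgrad F (Du x) \<bullet> grad \<psi> x))
        \<le> norm ((M * E) * norm (indicator (cball 0 R) x *\<^sub>R Du x))"
    proof (rule AE_I2)
      fix x
      show "norm (F (Du x) * (Fgrad F (Du x) \<bullet> grad \<psi> x)) \<le> norm ((M * E) * norm (indicator (cball 0 R) x *\<^sub>R Du x))"
      proof (cases "x \<in> cball 0 R")
        case True
        have "\<bar>F (Du x) * (Fgrad F (Du x) \<bullet> grad \<psi> x)\<bar> \<le> M * (norm (Du x) * norm (grad \<psi> x))"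
          by (rule M(2))
        also have "\<dots> \<le> M * (norm (Du x) * E)"
          using M(1) \<psi>b(2)[of x] by (intro mult_left_mono) auto
        also have "\<dots> \<le> norm ((M * E) * norm (indicator (cball 0 R) x *\<^sub>R Du x))"
          using True by (simp add: mult_ac)
        finally show ?thesis by simp
      next
        case False
        then show ?thesis using \<psi>b(1) by simp
      qed
    qed
  qed measurable
qed

lemma conv_bounded_linear:
  fixes U :: "'a::euclidean_space \<Rightarrow> 'b::{banach, second_countable_topology}"
    and T :: "'b \<Rightarrow> 'c::{banach, second_countable_topology}"
  assumes T: "bounded_linear T" and U: "\<And>R. set_integrable lborel (cball 0 R) U"
  shows "conv (moll n) (\<lambda>x. T (U x)) x = T (conv (moll n) U x)"
  unfolding conv_def integral_bounded_linear[OF T integrable_moll_conv[OF U], symmetric]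
  by (simp add: linear_cmul[OF bounded_linear.linear[OF T]])

text \<open>The density \<open>w n\<close>, which converges in \<open>L\<^sup>1\<close>, plays the role of the dominating function in
  Fatou's lemma.\<close>
lemma mollified_solution:
  fixes u :: "'a::euclidean_space \<Rightarrow> real" and Du :: "'a \<Rightarrow> 'a" and R :: real
  assumes sol: "weak_solution F \<alpha> u Du"
  obtains v g w where
    "\<And>n::nat. smooth_fun (v n)" "\<And>n x. grad (v n) x = g n x"
    "\<And>n x. (v n x)\<^sup>2 + (norm (g n x))\<^sup>2 \<le> w n x"
    "AE x in lborel. x \<in> cball 0 R \<longrightarrow> (\<lambda>n. v n x) \<longlonglongrightarrow> u x \<and> (\<lambda>n. g n x) \<longlonglongrightarrow> Du x
       \<and> (\<lambda>n. w n x) \<longlonglongrightarrow> (u x)\<^sup>2 + (norm (Du x))\<^sup>2"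
    "\<And>n. integrable lborel (\<lambda>x. indicator (cball 0 R) x * w n x)"
    "(\<lambda>n. \<integral>x. indicator (cball 0 R) x * w n x \<partial>lborel)
       \<longlonglongrightarrow> (\<integral>x. indicator (cball 0 R) x * ((u x)\<^sup>2 + (norm (Du x))\<^sup>2) \<partial>lborel)"
proof -
  note [measurable] = weak_solutionD(1,2)[OF sol]
  define e where "e x = (norm (u x))\<^sup>2 + (norm (Du x))\<^sup>2" for x
  \<comment> \<open>Mollifying the triple as one vector-valued function makes a single subsequence
    serve all three components; the projections commute with \<open>conv\<close>.\<close>
  define U where "U x = (u x, Du x, e x)" for x
  have e_meas [measurable]: "e \<in> borel_measurable borel" unfolding e_def by measurable
  have e_loc: "set_integrable lborel (cball 0 R) e" for R
    unfolding e_def using weak_solutionD(3,4)[OF sol] by (intro set_integral_add)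
  have u_loc: "set_integrable lborel (cball 0 R) u" and Du_loc: "set_integrable lborel (cball 0 R) Du" for R
    using set_integrable_cball_of_square weak_solutionD(1,2,3,4)[OF sol] by blast+
  have U_meas [measurable]: "U \<in> borel_measurable borel"
    unfolding U_def[abs_def] by measurable
  have U_loc: "set_integrable lborel (cball 0 R) U" for R
  proof (rule set_integrable_cball_bound[OF _ U_meas])
    show "set_integrable lborel (cball 0 R) (\<lambda>x. 2 + 2 * e x)"
      by (intro set_integral_add set_integrable_const_cball set_integrable_mult_right e_loc)
    show "norm (U x) \<le> 2 + 2 * e x" for x
    proof -
      have 1: "r \<le> 1 + r\<^sup>2 / 2" for r :: real
        using sum_squares_bound[of r 1] by (simp add: field_simps)
      have "norm (U x) \<le> norm (u x) + (norm (Du x) + norm (e x))"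
        unfolding U_def by (meson norm_Pair_le add_left_mono order_trans)
      moreover have "norm (e x) = e x" by (simp add: e_def)
      moreover have "0 \<le> (norm (u x))\<^sup>2" "0 \<le> (norm (Du x))\<^sup>2" by auto
      moreover have "norm (u x) + norm (Du x) \<le> 2 + e x / 2"
        using add_mono[OF 1[of "norm (u x)"] 1[of "norm (Du x)"]] by (simp add: e_def add_divide_distrib)
      moreover have "0 \<le> e x" by (simp add: e_def)
      ultimately show ?thesis by linarith
    qed
  qed
  obtain s where s: "strict_mono s"
    "AE x in lborel. x \<in> cball 0 R \<longrightarrow> (\<lambda>n. conv (moll (s n)) U x) \<longlonglongrightarrow> U x"
    "\<And>n. set_integrable lborel (cball 0 R) (conv (moll n) U)"
    "(\<lambda>n. \<integral>x. indicator (cball 0 R) x * norm (conv (moll (s n)) U x - U x) \<partial>lborel) \<longlonglongrightarrow> 0"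
    by (rule conv_moll_local_convergence[OF U_meas U_loc, of R]) (rule that; assumption)
  define v where "v n = conv (moll (s n)) u" for n
  define g where "g n = conv (moll (s n)) Du" for n
  define w where "w n = conv (moll (s n)) e" for n
  have U_eq: "conv (moll (s n)) U x = (v n x, g n x, w n x)" for n x
  proof -
    have "fst (conv (moll (s n)) U x) = v n x"
      unfolding v_def conv_bounded_linear[OF bounded_linear_fst U_loc, symmetric] by (simp add: U_def)
    moreover have "fst (snd (conv (moll (s n)) U x)) = g n x"
      unfolding g_def conv_bounded_linear[OF bounded_linear_fst_comp[OF bounded_linear_snd] U_loc, symmetric]
      by (simp add: U_def)
    moreover have "snd (snd (conv (moll (s n)) U x)) = w n x"
      unfolding w_def conv_bounded_linear[OF bounded_linear_snd_comp[OF bounded_linear_snd] U_loc, symmetric]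
      by (simp add: U_def)
    ultimately show ?thesis by (metis prod.collapse)
  qed
  have w_int: "integrable lborel (\<lambda>x. indicator (cball 0 R) x * w n x)" for n
  proof -
    have "integrable lborel (\<lambda>x. snd (snd (indicator (cball 0 R) x *\<^sub>R conv (moll (s n)) U x)))"
      using s(3)[of "s n"] unfolding set_integrable_def by (intro integrable_snd)
    then show ?thesis by (simp add: U_eq)
  qed
  have e_int: "integrable lborel (\<lambda>x. indicator (cball 0 R) x * e x)"
    using e_loc[of R] unfolding set_integrable_def by simp
  let ?I = "\<lambda>n. \<integral>x. indicator (cball 0 R) x * w n x \<partial>lborel"
  let ?J = "\<integral>x. indicator (cball 0 R) x * e x \<partial>lborel"
  have "norm (?I n - ?J) \<le> (\<integral>x. indicator (cball 0 R) x * norm (conv (moll (s n)) U x - U x) \<partial>lborel)" for n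
  proof -
    have "?I n - ?J = (\<integral>x. indicator (cball 0 R) x * w n x - indicator (cball 0 R) x * e x \<partial>lborel)"
      using w_int e_int by simp
    also have "norm \<dots> \<le> (\<integral>x. indicator (cball 0 R) x * norm (conv (moll (s n)) U x - U x) \<partial>lborel)"
    proof (rule Bochner_Integration.integral_norm_bound_integral)
      show "integrable lborel (\<lambda>x. indicator (cball 0 R) x * w n x - indicator (cball 0 R) x * e x)"
        using w_int e_int by simp
      have "integrable lborel (\<lambda>x. norm (indicator (cball 0 R) x *\<^sub>R conv (moll (s n)) U x - indicator (cball 0 R) x *\<^sub>R U x))"
        using s(3)[of "s n"] U_loc[of R] unfolding set_integrable_def
        by (intro integrable_norm Bochner_Integration.integrable_diff)
      then show "integrable lborel (\<lambda>x. indicator (cball 0 R) x * norm (conv (moll (s n)) U x - U x))"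
        by (simp add: scaleR_diff_right[symmetric])
      fix x
      have "\<bar>w n x - e x\<bar> \<le> norm (conv (moll (s n)) U x - U x)"
        unfolding U_eq U_def using norm_snd_le[of "(g n x - Du x, w n x - e x)" "v n x - u x"]
          norm_snd_le[of "w n x - e x" "g n x - Du x"] by simp
      then show "norm (indicator (cball 0 R) x * w n x - indicator (cball 0 R) x * e x)
          \<le> indicator (cball 0 R) x * norm (conv (moll (s n)) U x - U x)"
        by (simp add: indicator_def)
    qed
    finally show ?thesis .
  qed
  then have I_lim: "?I \<longlonglongrightarrow> ?J"
    by (intro Lim_null_comparison[OF _ s(4), THEN LIM_zero_cancel] always_eventually allI)
  show ?thesis
  proof
    show "smooth_fun (v n)" for n
      unfolding v_def by (rule smooth_fun_conv[OF test_fun_moll u_loc])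
    show "grad (v n) x = g n x" for n x
      unfolding v_def g_def
      by (rule grad_conv[OF test_fun_moll test_fun_moll_shift u_loc Du_loc weak_solutionD(6)[OF sol]])
    \<comment> \<open>Since \<open>w n\<close> mollifies |u|^2 + |Du|^2, this is Jensen's inequality
      for u and for Du.\<close>
    show "(v n x)\<^sup>2 + (norm (g n x))\<^sup>2 \<le> w n x" for n x
    proof -
      have "w n x = conv (moll (s n)) (\<lambda>x. (norm (u x))\<^sup>2) x + conv (moll (s n)) (\<lambda>x. (norm (Du x))\<^sup>2) x"
        unfolding w_def e_def conv_def scaleR_add_right
        by (intro Bochner_Integration.integral_add integrable_moll_conv weak_solutionD(3,4)[OF sol])
      then show ?thesis
        using norm_conv_square_le[OF u_loc weak_solutionD(3)[OF sol], of "s n" x]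
          norm_conv_square_le[OF Du_loc weak_solutionD(4)[OF sol], of "s n" x]
        unfolding v_def g_def by simp
    qed
    show "AE x in lborel. x \<in> cball 0 R \<longrightarrow> (\<lambda>n. v n x) \<longlonglongrightarrow> u x \<and> (\<lambda>n. g n x) \<longlonglongrightarrow> Du x
       \<and> (\<lambda>n. w n x) \<longlonglongrightarrow> (u x)\<^sup>2 + (norm (Du x))\<^sup>2"
      using s(2)
    proof eventually_elim
      case (elim x)
      then show ?case
        unfolding U_eq using tendsto_fst[of "\<lambda>n. (v n x, g n x, w n x)" "U x"]
          tendsto_fst[OF tendsto_snd[of "\<lambda>n. (v n x, g n x, w n x)" "U x"]]
          tendsto_snd[OF tendsto_snd[of "\<lambda>n. (v n x, g n x, w n x)" "U x"]]
        by (auto simp: U_def e_def)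
    qed
    show "integrable lborel (\<lambda>x. indicator (cball 0 R) x * w n x)" for n by (rule w_int)
    show "?I \<longlonglongrightarrow> (\<integral>x. indicator (cball 0 R) x * ((u x)\<^sup>2 + (norm (Du x))\<^sup>2) \<partial>lborel)"
      using I_lim by (simp add: e_def)
  qed
qed

section \<open>Testing with functions of the mollified solution, and the limit\<close>

lemma energy_zero: "energy F t \<kappa> \<xi> s g 0 0 = 0"
  by (simp add: energy_def quad_def)

lemma energy_measurable:
  assumes adm: "admissible_F F"
    and [measurable]: "Du \<in> borel_measurable borel" "v \<in> borel_measurable borel" "g \<in> borel_measurable borel"
      "\<eta> \<in> borel_measurable borel" "d \<in> borel_measurable borel"
  shows "(\<lambda>x. energy F t \<kappa> (Du x) (v x) (g x) (\<eta> x) (d x)) \<in> borel_measurable borel"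
proof -
  have [measurable]: "sigm \<in> borel_measurable borel" "softplus \<in> borel_measurable borel"
    by (auto intro!: smooth_fun_measurable smooth_fun_sigm smooth_fun_softplus)
  note [measurable] = F_measurable[OF adm] Fgrad_measurable[OF adm]
  have [measurable]: "(\<lambda>x. quad F (Du x) ((t * sigm (t * v x) * \<eta> x) *\<^sub>R g x + softplus (t * v x) *\<^sub>R d x)) \<in> borel_measurable borel"
    by (rule quad_measurable[OF adm]) measurable
  show ?thesis
    unfolding energy_def gam_def by measurable
qed

lemma smooth_fun_gam: "smooth_fun (gam t)"
proof -
  have s: "smooth_fun (\<lambda>s. t * s)" for t :: real
    using smooth_fun_cmult[OF smooth_fun_inner[of "1::real"], of t] by simp
  show ?thesis
    unfolding gam_def[abs_def]
    by (intro smooth_fun_cmult smooth_fun_diff smooth_fun_compose[OF smooth_fun_softplus s]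
        smooth_fun_compose[OF smooth_fun_sigm s])
qed

text \<open>Stability tested with \<open>softplus (t * v) * \<eta>\<close>, minus \<open>\<kappa>\<close> times the equation tested with
  \<open>gam t v * \<eta>\<^sup>2\<close>.\<close>
lemma stability_minus_equation:
  fixes F :: "'a::euclidean_space \<Rightarrow> real" and t \<kappa> :: real
  assumes adm: "admissible_F F" and sol: "weak_solution F \<alpha> u Du" and stab: "stable F \<alpha> u Du"
    and v: "smooth_fun v" and \<eta>: "test_fun \<eta>"
  defines "Z \<equiv> \<lambda>x. energy F t \<kappa> (Du x) (v x) (grad v x) (\<eta> x) (grad \<eta> x)
      - source F \<alpha> u x * (((softplus (t * v x))\<^sup>2 - \<kappa> * gam t (v x)) * (\<eta> x)\<^sup>2)"
  shows "integrable lborel Z" "0 \<le> (\<integral>x. Z x \<partial>lborel)"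
proof -
  let ?\<phi> = "\<lambda>x. softplus (t * v x) * \<eta> x" and ?\<psi> = "\<lambda>x. gam t (v x) * (\<eta> x)\<^sup>2"
  let ?G = "source F \<alpha> u"
  note \<eta>s = test_funD[OF \<eta>]
  note d = smooth_fun_differentiable
  have \<phi>: "test_fun ?\<phi>"
    by (rule test_fun_mult[OF smooth_fun_compose[OF smooth_fun_softplus smooth_fun_cmult[OF v]] \<eta>])
  have \<eta>2: "test_fun (\<lambda>x. (\<eta> x)\<^sup>2)"
    unfolding power2_eq_square by (rule test_fun_mult[OF \<eta>s \<eta>])
  have \<psi>: "test_fun ?\<psi>"
    by (rule test_fun_mult[OF smooth_fun_compose[OF smooth_fun_gam v] \<eta>2])
  have g\<phi>: "grad ?\<phi> x = (t * sigm (t * v x) * \<eta> x) *\<^sub>R grad v x + softplus (t * v x) *\<^sub>R grad \<eta> x" for x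
    by (rule grad_comp_mult[OF has_real_derivative_softplus_scaled d[OF v] d[OF \<eta>s]])
  have g\<psi>: "grad ?\<psi> x = ((t * sigm (t * v x))\<^sup>2 * (\<eta> x)\<^sup>2) *\<^sub>R grad v x + (gam t (v x) * (2 * \<eta> x)) *\<^sub>R grad \<eta> x" for x
    using grad_comp_mult[OF has_real_derivative_gam d[OF v] d[OF test_funD[OF \<eta>2]], of t x]
      grad_power[OF d[OF \<eta>s], of 2 x] by simp
  have 1: "integrable lborel (\<lambda>x. quad F (Du x) (grad ?\<phi> x) - ?G x * (?\<phi> x)\<^sup>2)"
    using integrable_quad_test[OF adm weak_solutionD(2)[OF sol] \<phi>]
      integrable_source_mult[OF sol test_fun_mult[OF test_funD[OF \<phi>] \<phi>]]
    by (simp add: power2_eq_square)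
  note 2 = integrable_flux[OF adm sol \<psi>] and 3 = integrable_source_mult[OF sol \<psi>]
  have Z: "Z = (\<lambda>x. (quad F (Du x) (grad ?\<phi> x) - ?G x * (?\<phi> x)\<^sup>2)
      - \<kappa> * (F (Du x) * (Fgrad F (Du x) \<bullet> grad ?\<psi> x)) + \<kappa> * (?G x * ?\<psi> x))"
    unfolding Z_def g\<phi> g\<psi> energy_def by (simp add: fun_eq_iff algebra_simps)
  show "integrable lborel Z"
    unfolding Z
    by (rule Bochner_Integration.integrable_add, rule Bochner_Integration.integrable_diff, rule 1)
      (intro integrable_mult_right 2 3)+
  have "(\<integral>x. Z x \<partial>lborel) = (\<integral>x. quad F (Du x) (grad ?\<phi> x) - ?G x * (?\<phi> x)\<^sup>2 \<partial>lborel)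
      - \<kappa> * (\<integral>x. F (Du x) * (Fgrad F (Du x) \<bullet> grad ?\<psi> x) \<partial>lborel) + \<kappa> * (\<integral>x. ?G x * ?\<psi> x \<partial>lborel)"
    unfolding Z
    by (subst Bochner_Integration.integral_add[OF Bochner_Integration.integrable_diff[OF 1 integrable_mult_right[OF 2]]
          integrable_mult_right[OF 3]], subst Bochner_Integration.integral_diff[OF 1 integrable_mult_right[OF 2]])
      simp
  then show "0 \<le> (\<integral>x. Z x \<partial>lborel)"
    using stable_quad[OF stab \<phi>] weak_solutionD(7)[OF sol \<psi>] by simp
qed

text \<open>An estimate of Caccioppoli type. Integrability of the left-hand integrand belongs to the
  conclusion because half of that integral is absorbed later.\<close>

lemma energy_estimate:
  fixes F :: "'a::euclidean_space \<Rightarrow> real"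
  assumes adm: "admissible_F F" and sol: "weak_solution F \<alpha> u Du" and stab: "stable F \<alpha> u Du"
    and t: "0 < t" "t < 2"
  obtains C where "C > 0"
    "\<And>\<eta>. test_fun \<eta> \<Longrightarrow> integrable lborel (\<lambda>x. source F \<alpha> u x * (softplus (t * u x))\<^sup>2 * (\<eta> x)\<^sup>2)"
    "\<And>\<eta>. test_fun \<eta> \<Longrightarrow> integrable lborel (\<lambda>x. (softplus (t * u x))\<^sup>2 * (norm (grad \<eta> x))\<^sup>2)"
    "\<And>\<eta>. test_fun \<eta> \<Longrightarrow> (\<integral>x. source F \<alpha> u x * (softplus (t * u x))\<^sup>2 * (\<eta> x)\<^sup>2 \<partial>lborel)
       \<le> C * (\<integral>x. (softplus (t * u x))\<^sup>2 * (norm (grad \<eta> x))\<^sup>2 \<partial>lborel)"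
proof -
  \<comment> \<open>The midpoint of 1 and 2 / t. Then \<kappa> t / 2 = 1 - c, so subtracting
    \<kappa> \<open>gam\<close> leaves at least the fraction c of softplus^2.\<close>
  define \<kappa> where "\<kappa> = (2 + t) / (2 * t)"
  define c where "c = (2 - t) / 4"
  have c: "c > 0" using t by (simp add: c_def)
  have \<kappa>: "\<kappa> > 1" using t by (simp add: \<kappa>_def field_simps)
  have gap: "c * (softplus (t * s))\<^sup>2 \<le> (softplus (t * s))\<^sup>2 - \<kappa> * gam t s" for s
  proof -
    have "\<kappa> * gam t s \<le> \<kappa> * (t / 2 * (softplus (t * s))\<^sup>2)"
      using \<kappa> gam_bounds(2)[OF t(1)] by (intro mult_left_mono) auto
    also have "\<dots> = (1 - c) * (softplus (t * s))\<^sup>2"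
      using t by (simp add: \<kappa>_def c_def field_simps)
    finally show ?thesis by (simp add: algebra_simps)
  qed
  have gap_nonneg: "0 \<le> (softplus (t * s))\<^sup>2 - \<kappa> * gam t s" for s
    using gap[of s] c by (meson less_imp_le mult_nonneg_nonneg order_trans zero_le_power2)
  obtain C where C: "C > 0"
    "\<And>\<xi> s e v. energy F t \<kappa> \<xi> s \<xi> e v \<le> C * ((softplus (t * s))\<^sup>2 * (norm v)\<^sup>2)"
    using energy_le[OF adm t(1) \<kappa>] by metis
  let ?G = "source F \<alpha> u"
  note G_meas = source_measurable[OF sol]
  have sg_meas: "sigm \<in> borel_measurable borel" "softplus \<in> borel_measurable borel" "gam t \<in> borel_measurable borel"
    by (auto intro!: smooth_fun_measurable smooth_fun_sigm smooth_fun_softplus smooth_fun_gam)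
  note [measurable] = weak_solutionD(1,2)[OF sol] G_meas sg_meas
  have main: "integrable lborel (\<lambda>x. ?G x * (softplus (t * u x))\<^sup>2 * (\<eta> x)\<^sup>2)
      \<and> integrable lborel (\<lambda>x. (softplus (t * u x))\<^sup>2 * (norm (grad \<eta> x))\<^sup>2)
      \<and> c * (\<integral>x. ?G x * (softplus (t * u x))\<^sup>2 * (\<eta> x)\<^sup>2 \<partial>lborel)
        \<le> C * (\<integral>x. (softplus (t * u x))\<^sup>2 * (norm (grad \<eta> x))\<^sup>2 \<partial>lborel)"
    if \<eta>: "test_fun \<eta>" for \<eta>
  proof -
    note \<eta>_meas [measurable] = smooth_fun_measurable[OF test_funD[OF \<eta>]] grad_measurable[OF test_funD[OF \<eta>]]
    obtain R E where \<eta>b: "\<And>x. x \<notin> cball 0 R \<Longrightarrow> \<eta> x = 0" "\<And>x. x \<notin> cball 0 R \<Longrightarrow> grad \<eta> x = 0"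
        "\<And>x. \<bar>\<eta> x\<bar> \<le> E" "\<And>x. norm (grad \<eta> x) \<le> E"
      using test_fun_bounds[OF \<eta>] by metis
    obtain v g w where
      v: "\<And>n::nat. smooth_fun (v n)" and g: "\<And>n x. grad (v n) x = g n x"
      and w: "\<And>n x. (v n x)\<^sup>2 + (norm (g n x))\<^sup>2 \<le> w n x"
      and lim: "AE x in lborel. x \<in> cball 0 R \<longrightarrow> (\<lambda>n. v n x) \<longlonglongrightarrow> u x \<and> (\<lambda>n. g n x) \<longlonglongrightarrow> Du x
         \<and> (\<lambda>n. w n x) \<longlonglongrightarrow> (u x)\<^sup>2 + (norm (Du x))\<^sup>2"
      and w_int: "\<And>n. integrable lborel (\<lambda>x. indicator (cball 0 R) x * w n x)"
      and w_lim: "(\<lambda>n. \<integral>x. indicator (cball 0 R) x * w n x \<partial>lborel)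
         \<longlonglongrightarrow> (\<integral>x. indicator (cball 0 R) x * ((u x)\<^sup>2 + (norm (Du x))\<^sup>2) \<partial>lborel)"
      by (rule mollified_solution[OF sol, of R]) (rule that; assumption)
    obtain B where B: "B > 0" "\<And>\<xi> s g e v. \<bar>e\<bar> \<le> E \<Longrightarrow> norm v \<le> E \<Longrightarrow>
        \<bar>energy F t \<kappa> \<xi> s g e v\<bar> \<le> B * (1 + (s\<^sup>2 + (norm g)\<^sup>2) + (norm \<xi>)\<^sup>2)"
      using energy_bounded[OF adm t, of \<kappa> E] \<kappa> by (metis less_imp_le less_trans zero_less_one)
    let ?K = "indicator (cball 0 R) :: 'a \<Rightarrow> real"
    define e where "e x = (u x)\<^sup>2 + (norm (Du x))\<^sup>2" for x
    define W where "W n x = B * (?K x + ?K x * w n x + ?K x * (norm (Du x))\<^sup>2)" for n x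
    define W0 where "W0 x = B * (?K x + ?K x * e x + ?K x * (norm (Du x))\<^sup>2)" for x
    define H where "H x = energy F t \<kappa> (Du x) (u x) (Du x) (\<eta> x) (grad \<eta> x)" for x
    define D where "D x = ?G x * (((softplus (t * u x))\<^sup>2 - \<kappa> * gam t (u x)) * (\<eta> x)\<^sup>2)" for x
    define Z where "Z n x = energy F t \<kappa> (Du x) (v n x) (g n x) (\<eta> x) (grad \<eta> x)
      - ?G x * (((softplus (t * v n x))\<^sup>2 - \<kappa> * gam t (v n x)) * (\<eta> x)\<^sup>2)" for n x
    have Z: "integrable lborel (Z n)" "0 \<le> (\<integral>x. Z n x \<partial>lborel)" for n
      using stability_minus_equation[OF adm sol stab v[of n] \<eta>, of t \<kappa>] unfolding Z_def g by auto
    have K_int: "integrable lborel ?K"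
      using set_integrable_const_cball[of R "1::real"] by (simp add: set_integrable_def)
    have Du_int: "integrable lborel (\<lambda>x. ?K x * (norm (Du x))\<^sup>2)"
      using weak_solutionD(4)[OF sol, of R] by (simp add: set_integrable_def)
    have u_int: "integrable lborel (\<lambda>x. ?K x * (u x)\<^sup>2)"
      using weak_solutionD(3)[OF sol, of R] by (simp add: set_integrable_def)
    have e_int: "integrable lborel (\<lambda>x. ?K x * e x)"
      unfolding e_def distrib_left using u_int Du_int by (rule Bochner_Integration.integrable_add)
    have W_int: "integrable lborel (W n)" for n
      unfolding W_def
      by (intro integrable_mult_right Bochner_Integration.integrable_add K_int w_int Du_int)
    have W0_int: "integrable lborel W0"
      unfolding W0_def
      by (intro integrable_mult_right Bochner_Integration.integrable_add K_int e_int Du_int)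
    have W_integral: "(\<integral>x. W n x \<partial>lborel) = B * ((\<integral>x. ?K x \<partial>lborel) + (\<integral>x. ?K x * w n x \<partial>lborel)
        + (\<integral>x. ?K x * (norm (Du x))\<^sup>2 \<partial>lborel))" for n
      unfolding W_def integral_mult_right_zero
      by (subst Bochner_Integration.integral_add[OF Bochner_Integration.integrable_add[OF K_int w_int] Du_int],
          subst Bochner_Integration.integral_add[OF K_int w_int]) (rule refl)
    have W0_integral: "(\<integral>x. W0 x \<partial>lborel) = B * ((\<integral>x. ?K x \<partial>lborel) + (\<integral>x. ?K x * e x \<partial>lborel)
        + (\<integral>x. ?K x * (norm (Du x))\<^sup>2 \<partial>lborel))"
      unfolding W0_def integral_mult_right_zero
      by (subst Bochner_Integration.integral_add[OF Bochner_Integration.integrable_add[OF K_int e_int] Du_int],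
          subst Bochner_Integration.integral_add[OF K_int e_int]) (rule refl)
    have W_lim: "(\<lambda>n. \<integral>x. W n x \<partial>lborel) \<longlonglongrightarrow> (\<integral>x. W0 x \<partial>lborel)"
      unfolding W_integral W0_integral e_def by (intro tendsto_intros w_lim)
    have bound: "\<bar>energy F t \<kappa> (Du x) (v n x) (g n x) (\<eta> x) (grad \<eta> x)\<bar> \<le> W n x" for n x
    proof (cases "x \<in> cball 0 R")
      case True
      have "\<bar>energy F t \<kappa> (Du x) (v n x) (g n x) (\<eta> x) (grad \<eta> x)\<bar>
          \<le> B * (1 + ((v n x)\<^sup>2 + (norm (g n x))\<^sup>2) + (norm (Du x))\<^sup>2)"
        by (rule B(2)[OF \<eta>b(3,4)])
      also have "\<dots> \<le> B * (1 + w n x + (norm (Du x))\<^sup>2)"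
        using B(1) w[of n x] by (intro mult_left_mono) auto
      finally show ?thesis unfolding W_def using True by simp
    qed (simp add: \<eta>b(1,2) energy_zero W_def)
    have bound0: "\<bar>H x\<bar> \<le> W0 x" for x
    proof (cases "x \<in> cball 0 R")
      case True
      show ?thesis
        using B(2)[OF \<eta>b(3,4), of "Du x" "u x" "Du x" x x] True unfolding H_def W0_def e_def by simp
    qed (simp add: \<eta>b(1,2) energy_zero W0_def H_def)
    have H_meas [measurable]: "H \<in> borel_measurable borel"
      unfolding H_def[abs_def] by (intro energy_measurable[OF adm]) measurable
    have H_int: "integrable lborel H"
      using order_trans[OF bound0 abs_ge_self] by (intro Bochner_Integration.integrable_bound[OF W0_int]) auto
    have D_meas [measurable]: "D \<in> borel_measurable borel"
      unfolding D_def[abs_def] by measurable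
    \<comment> \<open>\<open>W n\<close> dominates the energy part of \<open>Z n\<close>, and the
      source part enters \<open>Z n\<close> with a minus sign, so \<open>W n - Z n\<close> is
      nonnegative. Its integral is at most that of \<open>W n\<close>, which converges; Fatou's
      lemma then compares the integrals of \<open>D\<close> and \<open>H\<close>.\<close>
    have WZ_int: "integrable lborel (\<lambda>x. W n x - Z n x)" for n
      using W_int Z(1) by (rule Bochner_Integration.integrable_diff)
    have WZ_nonneg: "0 \<le> W n x - Z n x" for n x
    proof -
      have "0 \<le> ?G x * (((softplus (t * v n x))\<^sup>2 - \<kappa> * gam t (v n x)) * (\<eta> x)\<^sup>2)"
        using gap_nonneg source_nonneg by (intro mult_nonneg_nonneg) auto
      then show ?thesis using bound[of x n] unfolding Z_def by linarith
    qed
    have WZ_le: "(\<integral>x. W n x - Z n x \<partial>lborel) \<le> (\<integral>x. W n x \<partial>lborel)" for n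
      using Z(2)[of n] W_int[of n] Z(1)[of n] by simp
    have WZ_lim: "AE x in lborel. (\<lambda>n. W n x - Z n x) \<longlonglongrightarrow> W0 x - (H x - D x)"
      using lim
    proof eventually_elim
      case (elim x)
      show ?case
      proof (cases "x \<in> cball 0 R")
        case True
        with elim have l: "(\<lambda>n. v n x) \<longlonglongrightarrow> u x" "(\<lambda>n. g n x) \<longlonglongrightarrow> Du x" "(\<lambda>n. w n x) \<longlonglongrightarrow> e x"
          unfolding e_def by auto
        have s: "(\<lambda>n. softplus (t * v n x)) \<longlonglongrightarrow> softplus (t * u x)"
          by (rule isCont_tendsto_compose[OF DERIV_isCont[OF has_real_derivative_softplus]]) (intro tendsto_intros l)
        have s': "(\<lambda>n. gam t (v n x)) \<longlonglongrightarrow> gam t (u x)"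
          by (rule isCont_tendsto_compose[OF DERIV_isCont[OF has_real_derivative_gam]]) (rule l)
        show ?thesis
          unfolding W_def Z_def W0_def H_def D_def by (intro tendsto_intros energy_tendsto l s s')
      next
        case False
        then show ?thesis
          unfolding W_def Z_def W0_def H_def D_def by (simp add: \<eta>b(1,2) energy_zero)
      qed
    qed
    have V_meas: "(\<lambda>x. W0 x - (H x - D x)) \<in> borel_measurable lborel"
      using borel_measurable_integrable[OF W0_int] by measurable
    note V = fatou_bounded[OF WZ_int WZ_nonneg WZ_le W_lim WZ_lim V_meas]
    \<comment> \<open>Integrability of source times softplus^2 is not known beforehand; it comes out
      of Fatou's lemma by cancelling \<open>W0\<close> and \<open>H\<close>.\<close>
    have D_int: "integrable lborel D"
    proof -
      have "integrable lborel (\<lambda>x. (W0 x - (H x - D x)) - W0 x + H x)"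
        by (intro Bochner_Integration.integrable_add Bochner_Integration.integrable_diff V(1) W0_int H_int)
      then show ?thesis by simp
    qed
    have D_le: "(\<integral>x. D x \<partial>lborel) \<le> (\<integral>x. H x \<partial>lborel)"
      using V(2) W0_int H_int D_int by simp
    have lower: "c * (?G x * (softplus (t * u x))\<^sup>2 * (\<eta> x)\<^sup>2) \<le> D x" for x
      using mult_right_mono[OF mult_left_mono[OF gap[of "u x"] source_nonneg[of F \<alpha> u x]], of "(\<eta> x)\<^sup>2"]
      unfolding D_def by (simp add: mult_ac)
    have nonneg: "0 \<le> ?G x * (softplus (t * u x))\<^sup>2 * (\<eta> x)\<^sup>2" for x
      using source_nonneg by (intro mult_nonneg_nonneg) auto
    have int1: "integrable lborel (\<lambda>x. c * (?G x * (softplus (t * u x))\<^sup>2 * (\<eta> x)\<^sup>2))"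
    proof (rule Bochner_Integration.integrable_bound[OF D_int])
      show "AE x in lborel. norm (c * (?G x * (softplus (t * u x))\<^sup>2 * (\<eta> x)\<^sup>2)) \<le> norm (D x)"
      proof (rule AE_I2)
        fix x
        have "0 \<le> c * (?G x * (softplus (t * u x))\<^sup>2 * (\<eta> x)\<^sup>2)" using nonneg[of x] c by simp
        then show "norm (c * (?G x * (softplus (t * u x))\<^sup>2 * (\<eta> x)\<^sup>2)) \<le> norm (D x)"
          using lower[of x] unfolding real_norm_def by linarith
      qed
    qed measurable
    then have int: "integrable lborel (\<lambda>x. ?G x * (softplus (t * u x))\<^sup>2 * (\<eta> x)\<^sup>2)"
      using c by simp
    have int2: "integrable lborel (\<lambda>x. (softplus (t * u x))\<^sup>2 * (norm (grad \<eta> x))\<^sup>2)"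
    proof (rule Bochner_Integration.integrable_bound)
      show "integrable lborel (\<lambda>x. (E\<^sup>2 * 2) * (?K x + ?K x * (4 * (u x)\<^sup>2)))"
        using integrable_mult_right[OF u_int, of 4] K_int
        by (intro integrable_mult_right Bochner_Integration.integrable_add) (auto simp: mult_ac)
      show "AE x in lborel. norm ((softplus (t * u x))\<^sup>2 * (norm (grad \<eta> x))\<^sup>2)
          \<le> norm ((E\<^sup>2 * 2) * (?K x + ?K x * (4 * (u x)\<^sup>2)))"
      proof (rule AE_I2)
        fix x
        show "norm ((softplus (t * u x))\<^sup>2 * (norm (grad \<eta> x))\<^sup>2) \<le> norm ((E\<^sup>2 * 2) * (?K x + ?K x * (4 * (u x)\<^sup>2)))"
        proof (cases "x \<in> cball 0 R")
          case True
          have "\<bar>t * u x\<bar> \<le> 2 * \<bar>u x\<bar>" using t by (simp add: abs_mult mult_right_mono)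
          then have "softplus (t * u x) \<le> 1 + 2 * \<bar>u x\<bar>" using softplus_le_linear[of "t * u x"] by linarith
          then have "(softplus (t * u x))\<^sup>2 \<le> (1 + 2 * \<bar>u x\<bar>)\<^sup>2"
            using softplus_pos[of "t * u x"] by (intro power_mono) auto
          also have "\<dots> \<le> 2 * (1 + 4 * (u x)\<^sup>2)"
            using sum_squares_bound[of 1 "2 * \<bar>u x\<bar>"] by (simp add: power2_sum power_mult_distrib)
          finally have "(softplus (t * u x))\<^sup>2 * (norm (grad \<eta> x))\<^sup>2 \<le> 2 * (1 + 4 * (u x)\<^sup>2) * E\<^sup>2"
            using \<eta>b(4)[of x] by (intro mult_mono power_mono) auto
          moreover have "norm ((softplus (t * u x))\<^sup>2 * (norm (grad \<eta> x))\<^sup>2) = (softplus (t * u x))\<^sup>2 * (norm (grad \<eta> x))\<^sup>2"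
            by simp
          moreover have "norm ((E\<^sup>2 * 2) * (?K x + ?K x * (4 * (u x)\<^sup>2))) = 2 * (1 + 4 * (u x)\<^sup>2) * E\<^sup>2"
            using True by (simp add: abs_mult)
          ultimately show ?thesis by (simp only:)
        qed (simp add: \<eta>b(2))
      qed
    qed measurable
    have "c * (\<integral>x. ?G x * (softplus (t * u x))\<^sup>2 * (\<eta> x)\<^sup>2 \<partial>lborel) \<le> (\<integral>x. D x \<partial>lborel)"
      unfolding integral_mult_right_zero[symmetric] using lower by (intro integral_mono int1 D_int)
    also note D_le
    \<comment> \<open>In \<open>H\<close> both gradient slots hold \<open>Du\<close>, so
      \<open>energy_le\<close> applies.\<close>
    also have "(\<integral>x. H x \<partial>lborel) \<le> (\<integral>x. C * ((softplus (t * u x))\<^sup>2 * (norm (grad \<eta> x))\<^sup>2) \<partial>lborel)"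
      using C(2) int2 unfolding H_def[abs_def, symmetric]
      by (intro integral_mono H_int integrable_mult_right) (auto simp: H_def)
    finally show ?thesis
      using int int2 by simp
  qed
  show ?thesis
  proof (rule that[of "C / c"])
    show "C / c > 0" using C c by simp
    fix \<eta> :: "'a \<Rightarrow> real" assume \<eta>: "test_fun \<eta>"
    note m = main[OF \<eta>]
    show "integrable lborel (\<lambda>x. ?G x * (softplus (t * u x))\<^sup>2 * (\<eta> x)\<^sup>2)"
      and "integrable lborel (\<lambda>x. (softplus (t * u x))\<^sup>2 * (norm (grad \<eta> x))\<^sup>2)"
      using m by blast+
    show "(\<integral>x. ?G x * (softplus (t * u x))\<^sup>2 * (\<eta> x)\<^sup>2 \<partial>lborel)
       \<le> C / c * (\<integral>x. (softplus (t * u x))\<^sup>2 * (norm (grad \<eta> x))\<^sup>2 \<partial>lborel)"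
      using m c by (simp add: field_simps)
  qed
qed

section \<open>The cutoff argument\<close>

text \<open>\<open>flat (monom 1 2)\<close> is the derivative of \<open>flat 1\<close>; with y = 1/s
  the bound says y^2 \<le> 2 exp y.\<close>

lemma flat_deriv_bound: "\<bar>flat (monom 1 2) s\<bar> \<le> 2"
proof (cases "s > 0")
  case True
  have "(1 / s)\<^sup>2 / 2 \<le> exp (1 / s)"
    using exp_lower_Taylor_quadratic[of "1 / s"] True by (smt (verit) divide_pos_pos)
  then have "(1 / s)\<^sup>2 * exp (- 1 / s) \<le> 2 * exp (1 / s) * exp (- 1 / s)"
    by (intro mult_right_mono) auto
  also have "\<dots> = 2" by (simp add: mult.assoc exp_add[symmetric])
  finally show ?thesis using True by (simp add: flat_def poly_monom abs_mult)
qed (simp add: flat_def)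

text \<open>The power \<open>m\<close> makes the gradient of the cutoff vanish at the origin to high order, which
  compensates the singularity of the weight \<open>Fdual powr (- 2 * t * \<alpha>)\<close> there.\<close>
lemma norm_grad_bump_le:
  fixes x :: "'a::euclidean_space"
  assumes r: "r > 0" and m: "m > 0"
  shows "norm (grad (bump m r 0) x) \<le> 4 * real m * (norm x / r) ^ (2 * m - 1) / r"
proof -
  let ?q = "\<lambda>x::'a. x \<bullet> x / r\<^sup>2"
  let ?s = "?q x"
  have qd: "(?q has_derivative (\<lambda>h. ((2 / r\<^sup>2) *\<^sub>R x) \<bullet> h)) (at x)"
    using r by (auto intro!: derivative_eq_intros simp: inner_commute power2_eq_square)
  have f: "((\<lambda>s. flat 1 (1 - s ^ m)) has_real_derivative flat (monom 1 2) (1 - ?s ^ m) * (- (real m * ?s ^ (m - 1)))) (at ?s)"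
  proof (rule DERIV_chain2[where g="\<lambda>s. 1 - s ^ m"])
    show "(flat 1 has_real_derivative flat (monom 1 2) (1 - ?s ^ m)) (at (1 - ?s ^ m))"
      using has_real_derivative_flat[of 1 "1 - ?s ^ m"] by simp
  qed (auto intro!: derivative_eq_intros)
  have "grad (\<lambda>x. flat 1 (1 - ?q x ^ m) * 1) x
      = (flat (monom 1 2) (1 - ?s ^ m) * (- (real m * ?s ^ (m - 1))) * 1) *\<^sub>R grad ?q x
        + flat 1 (1 - ?q x ^ m) *\<^sub>R grad (\<lambda>x. 1) x"
    using qd by (intro grad_comp_mult[where v="?q", OF f]) (auto simp: differentiable_def)
  moreover have "grad (\<lambda>x. 1) x = 0"
    by (rule grad_eqI) simp
  moreover have "bump m r 0 = (\<lambda>x. flat 1 (1 - ?q x ^ m) * 1)"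
    by (simp add: bump_def fun_eq_iff)
  ultimately have "grad (bump m r 0) x
      = (flat (monom 1 2) (1 - ?s ^ m) * (- (real m * ?s ^ (m - 1)))) *\<^sub>R ((2 / r\<^sup>2) *\<^sub>R x)"
    using grad_eqI[OF qd] by simp
  then have "norm (grad (bump m r 0) x)
      = \<bar>flat (monom 1 2) (1 - ?s ^ m)\<bar> * (real m * ?s ^ (m - 1) * (2 / r\<^sup>2 * norm x))"
    using r by (simp add: abs_mult power_abs)
  also have "\<dots> \<le> 2 * (real m * ?s ^ (m - 1) * (2 / r\<^sup>2 * norm x))"
    using flat_deriv_bound r by (intro mult_right_mono) auto
  also have "?s = (norm x / r)\<^sup>2"
    by (simp add: power2_norm_eq_inner power_divide)
  also have "2 * (real m * ((norm x / r)\<^sup>2) ^ (m - 1) * (2 / r\<^sup>2 * norm x))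
      = 4 * real m * ((norm x / r) ^ (2 * (m - 1)) * (norm x / r)) / r"
    by (simp add: power_mult power2_eq_square)
  also have "(norm x / r) ^ (2 * (m - 1)) * (norm x / r) = (norm x / r) ^ (2 * m - 1)"
    using m by (cases m) (auto simp: power_Suc2[symmetric])
  finally show ?thesis .
qed

text \<open>A substitute for Young's inequality: either the gradient term \<open>a\<close> is absorbed by the
  exponential nonlinearity, or \<open>exp s\<close> itself is controlled by \<open>a\<close>.\<close>
lemma absorb_or_control:
  fixes a b f s t z L :: real
  assumes a: "0 \<le> a" and f: "f > 0" and z: "0 \<le> z" "z \<le> 1" and t: "0 < t" "t \<le> 2" and L: "L > 0"
    and b: "0 < b" "b \<le> exp (t * s)"
  shows "L * (b\<^sup>2 * (z ^ 8 * a)) \<le> 1 / 2 * (f * exp s * b\<^sup>2 * z ^ 10) + L * a * (2 * L * a / f) powr (2 * t)"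
proof (cases "2 * L * a \<le> f * exp s * z\<^sup>2")
  case True
  have "L * (b\<^sup>2 * (z ^ 8 * a)) = 1 / 2 * (b\<^sup>2 * z ^ 8 * (2 * L * a))" by simp
  also have "\<dots> \<le> 1 / 2 * (b\<^sup>2 * z ^ 8 * (f * exp s * z\<^sup>2))"
    using True z by (intro mult_left_mono) auto
  also have "\<dots> = 1 / 2 * (f * exp s * b\<^sup>2 * z ^ 10)"
    by (simp add: power_add[symmetric] mult_ac)
  finally show ?thesis
    using a f L by (intro order_trans[OF _ le_add_same_cancel1[THEN iffD2]]) auto
next
  case False
  have nn: "0 \<le> 1 / 2 * (f * exp s * b\<^sup>2 * z ^ 10)" using f z by simp
  \<comment> \<open>Here exp(s) z^2 < 2 L a / f, and the power 2 t of the left side is exp(2 t s)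
    z^(4 t). The first factor dominates b^2, the second z^8, because z \<le> 1 and 4 t \<le>
    8.\<close>
  have "b\<^sup>2 * z ^ 8 \<le> (2 * L * a / f) powr (2 * t)"
  proof (cases "z = 0")
    case False
    then have z0: "z > 0" using z by simp
    have "exp s * z\<^sup>2 \<le> 2 * L * a / f"
      using \<open>\<not> 2 * L * a \<le> f * exp s * z\<^sup>2\<close> f by (simp add: field_simps)
    then have "(exp s * z\<^sup>2) powr (2 * t) \<le> (2 * L * a / f) powr (2 * t)"
      using t by (intro powr_mono2) auto
    moreover have "(exp s * z\<^sup>2) powr (2 * t) = exp (t * s) ^ 2 * z powr (4 * t)"
    proof -
      have "(exp s * z\<^sup>2) powr (2 * t) = exp s powr (2 * t) * (z powr 2) powr (2 * t)"
        using z0 by (simp add: powr_mult)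
      also have "exp s powr (2 * t) = exp (t * s) ^ 2"
        by (simp add: powr_def exp_double[symmetric] mult_ac)
      finally show ?thesis unfolding powr_powr by (simp add: mult.assoc[symmetric])
    qed
    moreover have "z ^ 8 \<le> z powr (4 * t)"
    proof -
      have "z powr 8 \<le> z powr (4 * t)" using z0 z t by (intro powr_mono') auto
      then show ?thesis using z0 by simp
    qed
    moreover have "b\<^sup>2 \<le> exp (t * s) ^ 2" using b by (intro power_mono) auto
    ultimately show ?thesis
      using mult_mono[of "b\<^sup>2" "exp (t * s) ^ 2" "z ^ 8" "z powr (4 * t)"] by simp
  qed simp
  then have "(L * a) * (b\<^sup>2 * z ^ 8) \<le> (L * a) * (2 * L * a / f) powr (2 * t)"
    using L a by (intro mult_left_mono) auto
  then show ?thesis using nn by (simp add: mult_ac)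
qed

text \<open>The exponent of R collects N from the volume of the ball, -2 from the squared gradient
  of the cutoff, and the power 2 t of that squared gradient divided by the weight, which is of order
  R^(-(2 + \<alpha>)).\<close>

lemma cutoff_estimate:
  fixes F :: "'a::euclidean_space \<Rightarrow> real"
  assumes adm: "admissible_F F" and sol: "weak_solution F \<alpha> u Du" and stab: "stable F \<alpha> u Du"
    and t: "0 < t" "t < 2" and m: "m > 0" "\<alpha> \<le> 4 * real m - 2"
  obtains Q where "\<And>R. R > 0 \<Longrightarrow>
      integrable lborel (\<lambda>x. source F \<alpha> u x * (softplus (t * u x))\<^sup>2 * bump m R 0 x ^ 10)"
    "\<And>R. R > 0 \<Longrightarrow> (\<integral>x. source F \<alpha> u x * (softplus (t * u x))\<^sup>2 * bump m R 0 x ^ 10 \<partial>lborel)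
      \<le> Q * R powr (real DIM('a) - 2 - 2 * t * (2 + \<alpha>))"
proof -
  obtain C where C: "C > 0"
    "\<And>\<eta>. test_fun \<eta> \<Longrightarrow> integrable lborel (\<lambda>x. source F \<alpha> u x * (softplus (t * u x))\<^sup>2 * (\<eta> x)\<^sup>2)"
    "\<And>\<eta>. test_fun \<eta> \<Longrightarrow> integrable lborel (\<lambda>x. (softplus (t * u x))\<^sup>2 * (norm (grad \<eta> x))\<^sup>2)"
    "\<And>\<eta>. test_fun \<eta> \<Longrightarrow> (\<integral>x. source F \<alpha> u x * (softplus (t * u x))\<^sup>2 * (\<eta> x)\<^sup>2 \<partial>lborel)
       \<le> C * (\<integral>x. (softplus (t * u x))\<^sup>2 * (norm (grad \<eta> x))\<^sup>2 \<partial>lborel)"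
    by (rule energy_estimate[OF adm sol stab t]) (rule that; assumption)
  obtain c d where cd: "c > 0" "d > 0" "\<And>x. c * norm x \<le> Fdual F x" "\<And>x. Fdual F x \<le> d * norm x"
    using Fdual_bounds[OF adm] by metis
  \<comment> \<open>The sum covers both signs of \<alpha>: for \<alpha> \<le> 0 the upper bound on
    \<open>Fdual\<close> is used, for \<alpha> > 0 the lower one.\<close>
  define k where "k = c powr (- \<alpha>) + d powr (- \<alpha>)"
  have Fdual_pos: "Fdual F x > 0" if "x \<noteq> 0" for x
    using cd(3)[of x] cd(1) that by (smt (verit) mult_pos_pos zero_less_norm_iff)
  have k: "1 / Fdual F x powr \<alpha> \<le> k * norm x powr (- \<alpha>)" if "x \<noteq> 0" for x
  proof -
    have "1 / Fdual F x powr \<alpha> = Fdual F x powr (- \<alpha>)"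
      by (simp add: powr_minus_divide)
    also have "\<dots> \<le> (c * norm x) powr (- \<alpha>) + (d * norm x) powr (- \<alpha>)"
    proof (cases "\<alpha> \<le> 0")
      case True
      then have "Fdual F x powr (- \<alpha>) \<le> (d * norm x) powr (- \<alpha>)"
        using cd(4)[of x] Fdual_pos[OF that] by (intro powr_mono2) auto
      then show ?thesis by (smt (verit) powr_ge_zero)
    next
      case False
      then have "Fdual F x powr (- \<alpha>) \<le> (c * norm x) powr (- \<alpha>)"
        using cd(1) cd(3)[of x] that by (intro powr_mono2') auto
      then show ?thesis by (smt (verit) powr_ge_zero)
    qed
    also have "\<dots> = k * norm x powr (- \<alpha>)"
      using cd by (simp add: k_def powr_mult distrib_right)
    finally show ?thesis .
  qed
  have k0: "k > 0" unfolding k_def using cd by (intro add_pos_pos) auto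
  \<comment> \<open>The squared gradient of \<zeta>^5 is 25 \<zeta>^8 times that of \<zeta>.\<close>
  define L where "L = 25 * C"
  have L: "L > 0" using C by (simp add: L_def)
  define A where "A = (4 * real m)\<^sup>2"
  define Q where "Q = L * A * (2 * L * (k * A)) powr (2 * t)"
  have A: "A \<ge> 0" by (simp add: A_def)
  define V where "V = measure lborel (cball (0::'a) 1)"
  have est: "integrable lborel (\<lambda>x. source F \<alpha> u x * (softplus (t * u x))\<^sup>2 * bump m R 0 x ^ 10)"
    "(\<integral>x. source F \<alpha> u x * (softplus (t * u x))\<^sup>2 * bump m R 0 x ^ 10 \<partial>lborel)
      \<le> 2 * Q * V * R powr (real DIM('a) - 2 - 2 * t * (2 + \<alpha>))" if R: "R > 0" for R
  proof -
    let ?\<zeta> = "bump m R (0::'a)" and ?\<eta> = "\<lambda>x. bump m R (0::'a) x ^ 5"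
    let ?b = "\<lambda>x. softplus (t * u x)"
    have \<zeta>: "test_fun ?\<zeta>" using test_fun_bump[OF R] .
    have \<eta>: "test_fun ?\<eta>"
      using test_fun_mult[OF smooth_fun_power[OF test_funD[OF \<zeta>], of 4] \<zeta>] by (simp add: eval_nat_numeral mult_ac)
    have \<eta>2: "(?\<eta> x)\<^sup>2 = ?\<zeta> x ^ 10" for x by (simp add: power_mult[symmetric])
    have g\<eta>: "C * ((?b x)\<^sup>2 * (norm (grad ?\<eta> x))\<^sup>2) = L * ((?b x)\<^sup>2 * (?\<zeta> x ^ 8 * (norm (grad ?\<zeta> x))\<^sup>2))" for x
      unfolding grad_power[OF smooth_fun_differentiable[OF test_funD[OF \<zeta>]]]
      by (simp add: power_mult_distrib L_def power_mult[symmetric])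
    define P where "P = Q * R powr (- 2 - 2 * t * (2 + \<alpha>))"
    have point: "C * ((?b x)\<^sup>2 * (norm (grad ?\<eta> x))\<^sup>2)
        \<le> 1 / 2 * (source F \<alpha> u x * (?b x)\<^sup>2 * ?\<zeta> x ^ 10) + P * indicator (cball 0 R) x" if x: "x \<noteq> 0" for x
    proof (cases "x \<in> cball 0 R")
      case True
      define a where "a = (norm (grad ?\<zeta> x))\<^sup>2"
      define \<rho> where "\<rho> = norm x / R"
      have \<rho>: "0 < \<rho>" "\<rho> \<le> 1" using x R True by (auto simp: \<rho>_def)
      have "a \<le> (4 * real m * \<rho> ^ (2 * m - 1) / R)\<^sup>2"
        unfolding a_def \<rho>_def using norm_grad_bump_le[OF R m(1)] by (intro power_mono) auto
      also have "\<dots> = A * (\<rho> powr (4 * real m - 2) * R powr (- 2))"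
      proof -
        have "(\<rho> ^ (2 * m - 1))\<^sup>2 = \<rho> powr (4 * real m - 2)"
        proof -
          have "(\<rho> ^ (2 * m - 1))\<^sup>2 = \<rho> ^ ((2 * m - 1) * 2)" by (rule power_mult[symmetric])
          also have "\<dots> = \<rho> powr real ((2 * m - 1) * 2)" by (rule powr_realpow[symmetric]) (rule \<rho>)
          also have "real ((2 * m - 1) * 2) = 4 * real m - 2" using m by (simp add: of_nat_diff)
          finally show ?thesis .
        qed
        moreover have "1 / R\<^sup>2 = R powr (- 2)"
          using R by (simp add: powr_minus_divide)
        ultimately show ?thesis
          by (simp add: A_def power_divide power_mult_distrib divide_inverse power_inverse)
      qed
      finally have a1: "a \<le> A * (\<rho> powr (4 * real m - 2) * R powr (- 2))" .
      have "\<rho> powr (4 * real m - 2) \<le> 1" using \<rho> m by (intro powr_le1) auto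
      then have "A * (\<rho> powr (4 * real m - 2) * R powr (- 2)) \<le> A * (1 * R powr (- 2))"
        using A by (intro mult_left_mono mult_right_mono) auto
      then have a2: "a \<le> A * R powr (- 2)" using a1 by simp
      have a0: "a \<ge> 0" by (simp add: a_def)
      have "a / Fdual F x powr \<alpha> \<le> (A * (\<rho> powr (4 * real m - 2) * R powr (- 2))) * (k * norm x powr (- \<alpha>))"
        using mult_mono[OF a1 k[OF x]] A by simp
      also have "norm x powr (- \<alpha>) = \<rho> powr (- \<alpha>) * R powr (- \<alpha>)"
        using R by (simp add: \<rho>_def powr_mult[symmetric])
      also have "(A * (\<rho> powr (4 * real m - 2) * R powr (- 2))) * (k * (\<rho> powr (- \<alpha>) * R powr (- \<alpha>)))
          = k * A * (\<rho> powr (4 * real m - 2 - \<alpha>) * R powr (- (2 + \<alpha>)))"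
        by (simp add: powr_diff powr_add powr_minus_divide field_simps)
      \<comment> \<open>The flat centre of the cutoff pays here: \<rho>^(4 m - 2) from its gradient
        outweighs \<rho>^(-\<alpha>) from the weight, by the condition on m.\<close>
      also have "\<dots> \<le> k * A * (1 * R powr (- (2 + \<alpha>)))"
        using \<rho> m A k0 by (intro mult_left_mono mult_right_mono powr_le1) auto
      finally have af: "2 * L * (a / Fdual F x powr \<alpha>) \<le> 2 * L * (k * A * R powr (- (2 + \<alpha>)))"
        using L by (intro mult_left_mono) auto
      have "(2 * L * a / Fdual F x powr \<alpha>) powr (2 * t) \<le> (2 * L * (k * A) * R powr (- (2 + \<alpha>))) powr (2 * t)"
        using af t L a0 by (intro powr_mono2) (auto simp: mult_ac)
      also have "\<dots> = (2 * L * (k * A)) powr (2 * t) * R powr (- 2 * t * (2 + \<alpha>))"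
      proof -
        have "(R powr (- (2 + \<alpha>))) powr (2 * t) = R powr (- 2 * t * (2 + \<alpha>))"
          unfolding powr_powr by (rule arg_cong[where f="\<lambda>e. R powr e"]) (simp add: algebra_simps)
        then show ?thesis using L k0 A by (simp add: powr_mult)
      qed
      finally have "L * a * (2 * L * a / Fdual F x powr \<alpha>) powr (2 * t)
          \<le> L * (A * R powr (- 2)) * ((2 * L * (k * A)) powr (2 * t) * R powr (- 2 * t * (2 + \<alpha>)))"
        using a2 a0 L A by (intro mult_mono) auto
      also have "\<dots> = P"
        unfolding P_def Q_def by (simp add: powr_add[symmetric] mult_ac)
      finally have tail: "L * a * (2 * L * a / Fdual F x powr \<alpha>) powr (2 * t) \<le> P" .
      have "L * ((?b x)\<^sup>2 * (?\<zeta> x ^ 8 * a)) \<le> 1 / 2 * (Fdual F x powr \<alpha> * exp (u x) * (?b x)\<^sup>2 * ?\<zeta> x ^ 10)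
          + L * a * (2 * L * a / Fdual F x powr \<alpha>) powr (2 * t)"
        using a0 L t bump_nonneg bump_le_1 softplus_pos softplus_le_exp Fdual_pos[OF x]
        by (intro absorb_or_control) auto
      then show ?thesis
        unfolding g\<eta> a_def[symmetric] source_def using tail True by simp
    next
      case False
      then have "?\<zeta> x = 0" using R by (intro bump_eq_0) auto
      then show ?thesis unfolding g\<eta> using False by simp
    qed
    let ?I = "\<integral>x. source F \<alpha> u x * (?b x)\<^sup>2 * ?\<zeta> x ^ 10 \<partial>lborel"
    have int: "integrable lborel (\<lambda>x. source F \<alpha> u x * (?b x)\<^sup>2 * ?\<zeta> x ^ 10)"
      using C(2)[OF \<eta>] unfolding \<eta>2 .
    then show "integrable lborel (\<lambda>x. source F \<alpha> u x * (?b x)\<^sup>2 * ?\<zeta> x ^ 10)" .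
    have K_int: "integrable lborel (\<lambda>x::'a. P * indicator (cball 0 R) x)"
      by (intro integrable_mult_right integrable_real_indicator emeasure_lborel_cball_finite) simp
    have "?I \<le> (\<integral>x. C * ((?b x)\<^sup>2 * (norm (grad ?\<eta> x))\<^sup>2) \<partial>lborel)"
      using C(4)[OF \<eta>] unfolding \<eta>2 by simp
    also have "\<dots> \<le> (\<integral>x. 1 / 2 * (source F \<alpha> u x * (?b x)\<^sup>2 * ?\<zeta> x ^ 10) + P * indicator (cball 0 R) x \<partial>lborel)"
    proof (rule integral_mono_AE)
      show "integrable lborel (\<lambda>x. C * ((?b x)\<^sup>2 * (norm (grad ?\<eta> x))\<^sup>2))"
        using C(3)[OF \<eta>] by (rule integrable_mult_right)
      show "integrable lborel (\<lambda>x. 1 / 2 * (source F \<alpha> u x * (?b x)\<^sup>2 * ?\<zeta> x ^ 10) + P * indicator (cball 0 R) x)"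
        by (rule Bochner_Integration.integrable_add[OF integrable_mult_right[OF int] K_int])
      show "AE x in lborel. C * ((?b x)\<^sup>2 * (norm (grad ?\<eta> x))\<^sup>2)
          \<le> 1 / 2 * (source F \<alpha> u x * (?b x)\<^sup>2 * ?\<zeta> x ^ 10) + P * indicator (cball 0 R) x"
        using AE_lborel_singleton[of "0::'a"] by eventually_elim (rule point)
    qed
    also have "\<dots> = 1 / 2 * ?I + P * measure lborel (cball (0::'a) R)"
      by (subst Bochner_Integration.integral_add[OF integrable_mult_right[OF int] K_int]) simp
    \<comment> \<open>Half of \<open>?I\<close> moves to the left; splitting the integral relied on
      the integrability in \<open>int\<close>.\<close>
    finally have "?I \<le> 2 * (P * measure lborel (cball (0::'a) R))" by simp
    also have "measure lborel (cball (0::'a) R) = V * R ^ DIM('a)"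
      unfolding V_def using R content_cball[of R "0::'a"] content_cball[of 1 "0::'a"] by simp
    also have "2 * (P * (V * R ^ DIM('a))) = 2 * Q * V * (R powr (- 2 - 2 * t * (2 + \<alpha>)) * R powr (real DIM('a)))"
      unfolding P_def using R by (simp add: powr_realpow mult_ac)
    also have "\<dots> = 2 * Q * V * R powr (real DIM('a) - 2 - 2 * t * (2 + \<alpha>))"
      unfolding powr_add[symmetric] by (simp add: algebra_simps)
    finally show "?I \<le> 2 * Q * V * R powr (real DIM('a) - 2 - 2 * t * (2 + \<alpha>))" .
  qed
  then show ?thesis using that[of "2 * Q * V"] by blast
qed

text \<open>On the unit ball the argument of \<open>flat 1\<close> is at least 1/2 once R \<ge> 2.
  The bound does not depend on R and so survives the limit of large R.\<close>

lemma bump_lower_bound: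
  fixes x :: "'a::euclidean_space"
  assumes "norm x \<le> 1" "R \<ge> 2" "m > 0"
  shows "exp (- 2) \<le> bump m R 0 x"
proof -
  have "x \<bullet> x / R\<^sup>2 \<le> 1 / 2"
  proof -
    have "x \<bullet> x \<le> 1" using assms(1) by (simp add: dot_square_norm power_le_one)
    moreover have "2 \<le> R\<^sup>2" using power_mono[OF assms(2), of 2] by simp
    ultimately show ?thesis using assms(2) by (simp add: field_simps)
  qed
  then have "(x \<bullet> x / R\<^sup>2) ^ m \<le> (1 / 2) ^ m"
    by (intro power_mono) auto
  also have "\<dots> \<le> (1 / 2) ^ 1"
    using assms by (intro power_decreasing) auto
  finally have s: "1 - (x \<bullet> x / R\<^sup>2) ^ m \<ge> 1 / 2" by simp
  then have "1 / (1 - (x \<bullet> x / R\<^sup>2) ^ m) \<le> 2"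
    by (simp add: divide_le_eq)
  then show ?thesis
    using s unfolding bump_def flat_def by simp
qed

theorem theorem1p5:
  fixes F :: "'a::euclidean_space \<Rightarrow> real" and \<alpha> :: real
  assumes "admissible_F F"
    and "\<alpha> > -2"
    and "2 \<le> DIM('a)"
    and "real DIM('a) < 10 + 4 * \<alpha>"
  shows "\<not> (\<exists>u Du. weak_solution F \<alpha> u Du \<and> stable F \<alpha> u Du)"
proof
  assume "\<exists>u Du. weak_solution F \<alpha> u Du \<and> stable F \<alpha> u Du"
  then obtain u Du where sol: "weak_solution F \<alpha> u Du" and stab: "stable F \<alpha> u Du" by blast
  \<comment> \<open>The t at which the exponent of R vanishes. T < 2 amounts to N < 10 + 4 \<alpha>,
    and T \<ge> 0 to N \<ge> 2; the midpoint of T and 2 makes the exponent negative.\<close>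
  define T where "T = (real DIM('a) - 2) / (2 * (2 + \<alpha>))"
  define t where "t = (T + 2) / 2"
  have T: "0 \<le> T" "T < 2" using assms by (auto simp: T_def field_simps)
  then have t: "0 < t" "t < 2" "T < t" by (auto simp: t_def)
  define p where "p = real DIM('a) - 2 - 2 * t * (2 + \<alpha>)"
  have "T * (2 * (2 + \<alpha>)) < t * (2 * (2 + \<alpha>))"
    using t(3) assms(2) by (intro mult_strict_right_mono) auto
  moreover have "T * (2 * (2 + \<alpha>)) = real DIM('a) - 2"
    using assms(2) by (simp add: T_def)
  ultimately have p: "p < 0" unfolding p_def by (simp add: algebra_simps)
  \<comment> \<open>More than the required \<alpha> + 2 \<le> 4 m; since \<alpha> + 2 > 0, it also
    forces m > 0.\<close>
  obtain m :: nat where "\<alpha> + 2 \<le> real m" using real_arch_simple by blast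
  then have m: "m > 0" "\<alpha> \<le> 4 * real m - 2" using assms(2) by auto
  obtain Q where Q: "\<And>R. R > 0 \<Longrightarrow>
      integrable lborel (\<lambda>x. source F \<alpha> u x * (softplus (t * u x))\<^sup>2 * bump m R 0 x ^ 10)"
    "\<And>R. R > 0 \<Longrightarrow> (\<integral>x. source F \<alpha> u x * (softplus (t * u x))\<^sup>2 * bump m R 0 x ^ 10 \<partial>lborel) \<le> Q * R powr p"
    by (rule cutoff_estimate[OF assms(1) sol stab t(1,2) m, folded p_def]) (rule that; assumption)
  let ?h = "\<lambda>x. source F \<alpha> u x * (softplus (t * u x))\<^sup>2"
  let ?K = "indicator (cball 0 1) :: 'a \<Rightarrow> real"
  have h: "0 \<le> ?h x" for x by (intro mult_nonneg_nonneg source_nonneg) simp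
  have le: "exp (- 2) ^ 10 * (?K x * ?h x) \<le> ?h x * bump m R 0 x ^ 10" if "R \<ge> 2" for R x
  proof (cases "x \<in> cball 0 1")
    case True
    then have "exp (- 2) ^ 10 \<le> bump m R 0 x ^ 10"
      using bump_lower_bound[OF _ that m(1), of x] by (intro power_mono) auto
    from mult_left_mono[OF this h[of x]] show ?thesis
      using True by (simp add: mult.commute)
  next
    case False
    then show ?thesis using h bump_nonneg by simp
  qed
  note [measurable] = source_measurable[OF sol] weak_solutionD(1)[OF sol] smooth_fun_measurable[OF smooth_fun_softplus]
  have int: "integrable lborel (\<lambda>x. exp (- 2) ^ 10 * (?K x * ?h x))"
  proof (rule Bochner_Integration.integrable_bound[OF Q(1)[of 2]])
    show "AE x in lborel. norm (exp (- 2) ^ 10 * (?K x * ?h x)) \<le> norm (?h x * bump m 2 0 x ^ 10)"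
      using le[of 2] h by (intro AE_I2) (simp add: abs_mult source_nonneg)
    have "?h \<in> borel_measurable borel" by measurable
    then have "(\<lambda>x. exp (- 2) ^ 10 * (?K x * ?h x)) \<in> borel_measurable borel"
      by (intro borel_measurable_times borel_measurable_const borel_measurable_indicator) auto
    then show "(\<lambda>x. exp (- 2) ^ 10 * (?K x * ?h x)) \<in> borel_measurable lborel" by simp
  qed simp
  define I where "I = (\<integral>x. exp (- 2) ^ 10 * (?K x * ?h x) \<partial>lborel)"
  have I_le: "I \<le> Q * R powr p" if "R \<ge> 2" for R
    using integral_mono[OF int Q(1) le[OF that]] Q(2)[of R] that unfolding I_def by simp
  have "((\<lambda>R. Q * R powr p) \<longlongrightarrow> Q * 0) at_top"
    by (intro tendsto_mult tendsto_const tendsto_neg_powr p filterlim_ident)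
  moreover have "\<forall>\<^sub>F R in at_top. I \<le> Q * R powr p"
    using eventually_ge_at_top[of 2] by eventually_elim (rule I_le)
  ultimately have "I \<le> Q * 0"
    by (rule tendsto_lowerbound) simp
  then have "I \<le> 0" by simp
  moreover have nn: "0 \<le> exp (- 2) ^ 10 * (?K x * ?h x)" for x
    using h[of x] by simp
  ultimately have "I = 0"
    unfolding I_def using Bochner_Integration.integral_nonneg[of lborel] by (meson order_antisym)
  then have "AE x in lborel. exp (- 2) ^ 10 * (?K x * ?h x) = 0"
    using integral_nonneg_eq_0_iff_AE[OF int] nn unfolding I_def by simp
  \<comment> \<open>Away from the origin the weight, the exponential and softplus are all positive,
    so the vanishing integral makes the unit ball a null set.\<close>
  then have "AE x in lborel. x \<notin> cball (0::'a) 1"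
    using AE_lborel_singleton[of "0::'a"]
  proof eventually_elim
    case (elim x)
    obtain c d where "c > 0" "\<And>x. c * norm x \<le> Fdual F x"
      using Fdual_bounds[OF assms(1)] by metis
    then have "Fdual F x > 0"
      using elim(2) by (smt (verit) mult_pos_pos zero_less_norm_iff)
    then have "?h x > 0"
      unfolding source_def using softplus_pos[of "t * u x"] by simp
    then show ?case using elim(1) by (auto simp: indicator_def)
  qed
  then have "cball (0::'a) 1 \<in> null_sets lborel"
    using AE_iff_null_sets[of "cball (0::'a) 1" lborel] by simp
  then have "measure lborel (cball (0::'a) 1) = 0"
    by (auto simp: null_sets_def measure_def)
  then show False by simp
qed

end
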